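(* For every geodesic space $X$ with basepoint $\bullet$ and for every Abelian group $G$ there are isomorphisms of persistences $$\{\pi_1(\mathrm{Cech}(X,3r),\bullet)\}_{r>0}\cong\{\pi_1(\mathrm{Rips}(X,4r),\bullet)\}_{r>0}$$ and $$\{H_1(\mathrm{Cech}(X,3r),G)\}_{r>0}\cong\{H_1(\mathrm{Rips}(X,4r),G)\}_{r>0}.$$
   Context: A metric space $(X,d)$ is geodesic if any $x,y\in X$ are joined by a path of length $d(x,y)$. $\mathrm{Rips}(X,r)$ is the simplicial complex with vertex set $X$ in which a finite nonempty $\sigma\subset X$ is a simplex iff $\operatorname{diam}(\sigma)<r$. $\mathrm{Cech}(X,r)$ is the simplicial complex with vertex set $X$ in which a finite nonempty $\sigma\subset X$ is a simplex iff $\bigcap_{z\in\sigma}B(z,r)\neq\emptyset$ (open balls in $X$). The bonding maps of the persistences are induced by the inclusions of complexes as $r$ increases. An isomorphism of persistences is a family of group isomorphisms, one for each $r>0$, commuting with the bonding maps. *)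

theory Defs
  imports "HOL-Analysis.Analysis" "HOL-Algebra.Coset" "HOL-Algebra.FiniteProduct"
begin

section \<open>Geodesic spaces\<close>

definition path_length :: "('a \<Rightarrow> 'a \<Rightarrow> real) \<Rightarrow> (real \<Rightarrow> 'a) \<Rightarrow> ereal" where
  "path_length d g =
     (SUP (n, t) \<in> {(n::nat, t::nat \<Rightarrow> real). mono_on {..n} t \<and> t 0 = 0 \<and> t n = 1}.
        ereal (\<Sum>i<n. d (g (t i)) (g (t (Suc i)))))"

definition geodesic_space :: "'a set \<Rightarrow> ('a \<Rightarrow> 'a \<Rightarrow> real) \<Rightarrow> bool" where
  "geodesic_space M d \<longleftrightarrow> Metric_space M d \<and>
     (\<forall>x\<in>M. \<forall>y\<in>M. \<exists>g. pathin (Metric_space.mtopology M d) g \<and> g 0 = x \<and> g 1 = y \<and>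
        path_length d g = ereal (d x y))"

section \<open>Rips and Cech complexes\<close>

text \<open>An abstract simplicial complex is given by the set of its simplices.\<close>

definition diam :: "('a \<Rightarrow> 'a \<Rightarrow> real) \<Rightarrow> 'a set \<Rightarrow> real" where
  "diam d \<sigma> = (SUP (x, y) \<in> \<sigma> \<times> \<sigma>. d x y)"

definition Rips :: "'a set \<Rightarrow> ('a \<Rightarrow> 'a \<Rightarrow> real) \<Rightarrow> real \<Rightarrow> 'a set set" where
  "Rips M d r = {\<sigma>. finite \<sigma> \<and> \<sigma> \<noteq> {} \<and> \<sigma> \<subseteq> M \<and> diam d \<sigma> < r}"

definition Cech :: "'a set \<Rightarrow> ('a \<Rightarrow> 'a \<Rightarrow> real) \<Rightarrow> real \<Rightarrow> 'a set set" where
  "Cech M d r = {\<sigma>. finite \<sigma> \<and> \<sigma> \<noteq> {} \<and> \<sigma> \<subseteq> M \<and> (\<Inter>z\<in>\<sigma>. Metric_space.mball M d z r) \<noteq> {}}"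

section \<open>Geometric realization\<close>

text \<open>Points are given by their barycentric coordinates. For finite \<open>\<sigma>\<close> the topology induced on
  \<open>closed_simplex \<sigma>\<close> by the product topology of \<^typ>\<open>'a \<Rightarrow> real\<close> is the Euclidean one; the
  realization carries the weak topology with respect to its closed simplices.\<close>

definition closed_simplex :: "'a set \<Rightarrow> ('a \<Rightarrow> real) set" where
  "closed_simplex \<sigma> = {f. (\<forall>v. 0 \<le> f v) \<and> (\<forall>v. v \<notin> \<sigma> \<longrightarrow> f v = 0) \<and> sum f \<sigma> = 1}"

definition realization :: "'a set set \<Rightarrow> ('a \<Rightarrow> real) topology" where
  "realization K = topology (\<lambda>U. U \<subseteq> (\<Union>\<sigma>\<in>K. closed_simplex \<sigma>) \<and>
     (\<forall>\<sigma>\<in>K. openin (top_of_set (closed_simplex \<sigma>)) (U \<inter> closed_simplex \<sigma>)))"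

lemma openin_realization:
  "openin (realization K) U \<longleftrightarrow> U \<subseteq> (\<Union>\<sigma>\<in>K. closed_simplex \<sigma>) \<and>
     (\<forall>\<sigma>\<in>K. openin (top_of_set (closed_simplex \<sigma>)) (U \<inter> closed_simplex \<sigma>))"
proof -
  define P where "P = (\<lambda>U. U \<subseteq> (\<Union>\<sigma>\<in>K. closed_simplex \<sigma>) \<and>
     (\<forall>\<sigma>\<in>K. openin (top_of_set (closed_simplex \<sigma>)) (U \<inter> closed_simplex \<sigma>)))"
  have "P (S \<inter> T)" if S: "P S" and T: "P T" for S T
    unfolding P_def
  proof (intro conjI ballI)
    show "S \<inter> T \<subseteq> (\<Union>\<sigma>\<in>K. closed_simplex \<sigma>)"
      using S unfolding P_def by blast
    fix \<sigma> assume "\<sigma> \<in> K"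
    then have "openin (top_of_set (closed_simplex \<sigma>)) ((S \<inter> closed_simplex \<sigma>) \<inter> (T \<inter> closed_simplex \<sigma>))"
      using S T unfolding P_def by (blast intro: openin_Int[of _ "S \<inter> _" "T \<inter> _"])
    moreover have "(S \<inter> closed_simplex \<sigma>) \<inter> (T \<inter> closed_simplex \<sigma>) = S \<inter> T \<inter> closed_simplex \<sigma>"
      by blast
    ultimately show "openin (top_of_set (closed_simplex \<sigma>)) (S \<inter> T \<inter> closed_simplex \<sigma>)"
      by (rule back_subst)
  qed
  moreover have "P (\<Union>\<K>)" if \<K>: "\<forall>U\<in>\<K>. P U" for \<K>
    unfolding P_def
  proof (intro conjI ballI)
    show "\<Union>\<K> \<subseteq> (\<Union>\<sigma>\<in>K. closed_simplex \<sigma>)"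
      using \<K> unfolding P_def by (intro Union_least) blast
    fix \<sigma> assume "\<sigma> \<in> K"
    then have "openin (top_of_set (closed_simplex \<sigma>)) (\<Union>((\<lambda>U. U \<inter> closed_simplex \<sigma>) ` \<K>))"
      using \<K> unfolding P_def by (intro openin_Union) blast
    moreover have "\<Union>((\<lambda>U. U \<inter> closed_simplex \<sigma>) ` \<K>) = \<Union>\<K> \<inter> closed_simplex \<sigma>"
      by blast
    ultimately show "openin (top_of_set (closed_simplex \<sigma>)) (\<Union>\<K> \<inter> closed_simplex \<sigma>)"
      by (rule back_subst)
  qed
  ultimately have "istopology P"
    unfolding istopology_def by blast
  moreover have "realization K = topology P"
    unfolding realization_def P_def ..
  ultimately have "openin (realization K) U \<longleftrightarrow> P U"
    by (simp only: topology_inverse')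
  then show ?thesis
    unfolding P_def .
qed

lemma topspace_realization: "topspace (realization K) = (\<Union>\<sigma>\<in>K. closed_simplex \<sigma>)"
proof (rule antisym)
  show "topspace (realization K) \<subseteq> (\<Union>\<sigma>\<in>K. closed_simplex \<sigma>)"
    using openin_realization[of K "topspace (realization K)"] openin_topspace by blast
  have "openin (realization K) (\<Union>\<sigma>\<in>K. closed_simplex \<sigma>)"
    unfolding openin_realization
  proof (intro conjI ballI order_refl)
    fix \<sigma> assume "\<sigma> \<in> K"
    then have "(\<Union>\<sigma>\<in>K. closed_simplex \<sigma>) \<inter> closed_simplex \<sigma> = closed_simplex \<sigma>"
      by blast
    then show "openin (top_of_set (closed_simplex \<sigma>)) ((\<Union>\<sigma>\<in>K. closed_simplex \<sigma>) \<inter> closed_simplex \<sigma>)"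
      by (simp only: openin_subtopology_self)
  qed
  then show "(\<Union>\<sigma>\<in>K. closed_simplex \<sigma>) \<subseteq> topspace (realization K)"
    by (rule openin_subset)
qed

definition vertex_point :: "'a \<Rightarrow> 'a \<Rightarrow> real" where
  "vertex_point v = (\<lambda>w. if w = v then 1 else 0)"

section \<open>Fundamental group\<close>

text \<open>The sort of \<open>'b\<close> comes from \<^const>\<open>joinpaths\<close>, which does not depend on the type class
  topology; all continuity conditions refer to \<open>T\<close>.\<close>

definition loops :: "'b topology \<Rightarrow> 'b \<Rightarrow> (real \<Rightarrow> 'b) set" where
  "loops T b = {p. pathin T p \<and> p 0 = b \<and> p 1 = b}"

definition loop_rel :: "'b topology \<Rightarrow> 'b \<Rightarrow> ((real \<Rightarrow> 'b) \<times> (real \<Rightarrow> 'b)) set" where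
  "loop_rel T b = {(p, q). p \<in> loops T b \<and> q \<in> loops T b \<and>
     homotopic_with (\<lambda>r. r 0 = b \<and> r 1 = b) (top_of_set {0..1}) T p q}"

definition fundamental_group :: "'b::topological_space topology \<Rightarrow> 'b \<Rightarrow> (real \<Rightarrow> 'b) set monoid" where
  "fundamental_group T b =
     \<lparr>carrier = loops T b // loop_rel T b,
      mult = (\<lambda>A B. \<Union>p\<in>A. \<Union>q\<in>B. loop_rel T b `` {p +++ q}),
      one = loop_rel T b `` {\<lambda>_. b}\<rparr>"

definition pi1 :: "'a set set \<Rightarrow> 'a \<Rightarrow> (real \<Rightarrow> 'a \<Rightarrow> real) set monoid" where
  "pi1 K v = fundamental_group (realization K) (vertex_point v)"

text \<open>For \<open>K \<subseteq> L\<close> the inclusion of realizations is the identity on barycentric coordinates,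
  so the class of a loop in \<open>K\<close> is sent to the class of the same loop in \<open>L\<close>.\<close>

definition pi1_incl :: "'a set set \<Rightarrow> 'a \<Rightarrow> (real \<Rightarrow> 'a \<Rightarrow> real) set \<Rightarrow> (real \<Rightarrow> 'a \<Rightarrow> real) set" where
  "pi1_incl L v A = (\<Union>p\<in>A. loop_rel (realization L) (vertex_point v) `` {p})"

section \<open>Simplicial homology with coefficients\<close>

text \<open>A \<open>p\<close>-chain assigns coefficients to oriented \<open>p\<close>-simplices: it is a finitely supported
  function on the orderings \<open>[v\<^sub>0, \<dots>, v\<^sub>p]\<close> of the \<open>p\<close>-simplices (and trivial on all other lists)
  that takes inverse values on oppositely oriented orderings; adjacent transpositions suffice
  to express this. The coefficient group is written multiplicatively.\<close>

definition simplicial_chains :: "'a set set \<Rightarrow> ('g, 'm) monoid_scheme \<Rightarrow> nat \<Rightarrow> ('a list \<Rightarrow> 'g) set" where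
  "simplicial_chains K G p = {c. range c \<subseteq> carrier G \<and>
     finite {vs. c vs \<noteq> \<one>\<^bsub>G\<^esub>} \<and>
     (\<forall>vs. c vs \<noteq> \<one>\<^bsub>G\<^esub> \<longrightarrow> length vs = Suc p \<and> distinct vs \<and> set vs \<in> K) \<and>
     (\<forall>us v w ws. c (us @ w # v # ws) = inv\<^bsub>G\<^esub> c (us @ v # w # ws))}"

definition chain_grp :: "'a set set \<Rightarrow> ('g, 'm) monoid_scheme \<Rightarrow> nat \<Rightarrow> ('a list \<Rightarrow> 'g) monoid" where
  "chain_grp K G p =
     \<lparr>carrier = simplicial_chains K G p, mult = (\<lambda>c e vs. c vs \<otimes>\<^bsub>G\<^esub> e vs), one = (\<lambda>_. \<one>\<^bsub>G\<^esub>)\<rparr>"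

text \<open>The usual \<open>\<partial>[v\<^sub>0, \<dots>, v\<^sub>p] = \<Sum>\<^sub>i (-1)\<^sup>i [v\<^sub>0, \<dots>, v\<^sub>i\<^sub>-\<^sub>1, v\<^sub>i\<^sub>+\<^sub>1, \<dots>, v\<^sub>p]\<close> in terms of coefficients:
  \<open>(-1)\<^sup>i [v\<^sub>0, \<dots>, v\<^sub>p]\<close> is \<open>[v\<^sub>i, v\<^sub>0, \<dots>, v\<^sub>i\<^sub>-\<^sub>1, v\<^sub>i\<^sub>+\<^sub>1, \<dots>, v\<^sub>p]\<close>, so the coefficient of \<open>\<partial>c\<close> at an oriented
  simplex \<open>vs\<close> is the sum of the coefficients of \<open>c\<close> at all \<open>v # vs\<close>. The value at \<open>[]\<close> is
  trivial, since homology is unreduced.\<close>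

definition bdry :: "('g, 'm) monoid_scheme \<Rightarrow> ('a list \<Rightarrow> 'g) \<Rightarrow> 'a list \<Rightarrow> 'g" where
  "bdry G c vs = (if vs = [] then \<one>\<^bsub>G\<^esub>
     else finprod G (\<lambda>v. c (v # vs)) {v. c (v # vs) \<noteq> \<one>\<^bsub>G\<^esub>})"

definition cycles :: "'a set set \<Rightarrow> ('g, 'm) monoid_scheme \<Rightarrow> nat \<Rightarrow> ('a list \<Rightarrow> 'g) set" where
  "cycles K G p = {c \<in> simplicial_chains K G p. bdry G c = (\<lambda>_. \<one>\<^bsub>G\<^esub>)}"

definition boundaries :: "'a set set \<Rightarrow> ('g, 'm) monoid_scheme \<Rightarrow> nat \<Rightarrow> ('a list \<Rightarrow> 'g) set" where
  "boundaries K G p = bdry G ` simplicial_chains K G (Suc p)"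

definition homology :: "'a set set \<Rightarrow> ('g, 'm) monoid_scheme \<Rightarrow> nat \<Rightarrow> ('a list \<Rightarrow> 'g) set monoid" where
  "homology K G p = (chain_grp K G p)\<lparr>carrier := cycles K G p\<rparr> Mod boundaries K G p"

text \<open>For \<open>K \<subseteq> L\<close>, chains of \<open>K\<close> are chains of \<open>L\<close>.\<close>

definition homology_incl ::
  "'a set set \<Rightarrow> ('g, 'm) monoid_scheme \<Rightarrow> nat \<Rightarrow> ('a list \<Rightarrow> 'g) set \<Rightarrow> ('a list \<Rightarrow> 'g) set" where
  "homology_incl L G p A = (\<Union>c\<in>A. boundaries L G p #>\<^bsub>chain_grp L G p\<^esub> c)"

section \<open>Isomorphism of persistences\<close>

text \<open>A persistence is a family of groups \<open>F r\<close> (\<open>r > 0\<close>) with bonding maps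
  \<open>f r s : F r \<rightarrow> F s\<close> for \<open>r \<le> s\<close>.\<close>

definition persistence_iso ::
  "(real \<Rightarrow> 'x monoid) \<Rightarrow> (real \<Rightarrow> real \<Rightarrow> 'x \<Rightarrow> 'x) \<Rightarrow>
   (real \<Rightarrow> 'y monoid) \<Rightarrow> (real \<Rightarrow> real \<Rightarrow> 'y \<Rightarrow> 'y) \<Rightarrow> bool" where
  "persistence_iso F f F' f' \<longleftrightarrow> (\<exists>\<phi>.
     (\<forall>r>0. \<phi> r \<in> iso (F r) (F' r)) \<and>
     (\<forall>r s. 0 < r \<and> r \<le> s \<longrightarrow>
        (\<forall>x \<in> carrier (F r). \<phi> s (f r s x) = f' r s (\<phi> r x))))"

end

theory Submission
  imports Defs
begin

text \<open>Both complexes are compared inside their union \<open>L r = Cech (3r) \<union> Rips (4r)\<close>: the inclusions of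
  \<open>Cech (3r)\<close> and of \<open>Rips (4r)\<close> into \<open>L r\<close> induce isomorphisms on \<open>\<pi>\<^sub>1\<close> and \<open>H\<^sub>1\<close>. All maps in sight are
  induced by inclusions, so the composite isomorphisms commute with the bonding maps.

  To invert these inclusions, replace every edge \<open>{u, v}\<close> of \<open>L r\<close> by \<open>u, m, v\<close> with a geodesic midpoint
  \<open>m\<close>; edges of \<open>L r\<close> are shorter than \<open>6r\<close>, so the halves are edges of both complexes. It remains to
  contract the subdivided triangles, which bound loops of length less than \<open>12r\<close>. In \<open>Cech (3r)\<close> such a
  loop is cut by the edge joining a point to its antipode into two halves, each contained in a
  ball of radius \<open>3r\<close>; in \<open>Rips (4r)\<close> it is filled by the triangle on three equidistant points.

  Paths and homotopies in a realization are compact, hence lie in finite subcomplexes. A grid on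
  the square that is fine with respect to the cover by open stars turns a homotopy into a finite
  sequence of moves across triangles, applied to words of vertices.\<close>

section \<open>Finite subcomplexes of the realization\<close>

text \<open>Neither complex contains the other: a pair at distance 5r is an edge of
  \<open>Cech (3r)\<close> only, and three equidistant points on a circle slightly shorter than 12r
  span a triangle of \<open>Rips (4r)\<close> only. Hence the detour through \<open>L r\<close>,
  where both comparison maps are inclusions. The scales 3r and 4r belong together because a circle
  of length l becomes fillable in the Cech complex once l < 4 * 3r and in the Rips complex once l <
  3 * 4r, the same bound 12r. Edges of \<open>L r\<close> may be too long for
  \<open>Rips (4r)\<close>, so a word has to be subdivided before it can be read in either complex.
  Subdivision is defined on words and on 1-chains only, which is enough in degree one. What has to
  be filled is stated once, as an equivalence of words of vertices, and used twice: read as paths it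
  yields homotopies, read as chains with a coefficient g it yields boundaries. So homology with
  coefficients in any Abelian group is treated directly, without passing through the fundamental
  group.\<close>

definition abstract_complex :: "'a set set \<Rightarrow> bool" where
  "abstract_complex K \<longleftrightarrow>
     (\<forall>\<sigma>\<in>K. finite \<sigma> \<and> \<sigma> \<noteq> {} \<and> (\<forall>\<tau>. \<tau> \<subseteq> \<sigma> \<and> \<tau> \<noteq> {} \<longrightarrow> \<tau> \<in> K))"

text \<open>\<open>F\<close> need not be closed under faces, so any finite selection of simplices
  can play the part of a finite subcomplex.\<close>

definition simplex_union :: "'a set set \<Rightarrow> ('a \<Rightarrow> real) set" where
  "simplex_union F = (\<Union>\<sigma>\<in>F. closed_simplex \<sigma>)"

text \<open>For a point of a realization this is its carrier, the unique simplex with the point in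
  its interior.\<close>

definition support :: "('a \<Rightarrow> real) \<Rightarrow> 'a set" where
  "support x = {v. x v \<noteq> 0}"

lemma abstract_complexD:
  assumes "abstract_complex K" "\<sigma> \<in> K"
  shows "finite \<sigma>" "\<sigma> \<noteq> {}" "\<And>\<tau>. \<tau> \<subseteq> \<sigma> \<Longrightarrow> \<tau> \<noteq> {} \<Longrightarrow> \<tau> \<in> K"
  using assms unfolding abstract_complex_def by blast+

lemma simplex_union_mono: "F \<subseteq> F' \<Longrightarrow> simplex_union F \<subseteq> simplex_union F'"
  unfolding simplex_union_def by blast

lemma simplex_union_Un: "simplex_union (F \<union> F') = simplex_union F \<union> simplex_union F'"
  unfolding simplex_union_def by blast

lemma closed_simplex_support:
  assumes "x \<in> closed_simplex \<sigma>" "finite \<sigma>"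
  shows "support x \<subseteq> \<sigma>" "support x \<noteq> {}" "x \<in> closed_simplex (support x)"
proof -
  show sub: "support x \<subseteq> \<sigma>"
    using assms by (auto simp: support_def closed_simplex_def)
  have "sum x (support x) = sum x \<sigma>"
    by (rule sum.mono_neutral_left) (use assms sub in \<open>auto simp: support_def\<close>)
  then have "sum x (support x) = 1"
    using assms by (simp add: closed_simplex_def)
  then show "support x \<noteq> {}"
    by (metis sum.empty zero_neq_one)
  show "x \<in> closed_simplex (support x)"
    using assms \<open>sum x (support x) = 1\<close> by (auto simp: closed_simplex_def support_def)
qed

lemma support_in_complex:
  assumes "abstract_complex K" "x \<in> simplex_union K"
  shows "support x \<in> K" "x \<in> closed_simplex (support x)"
proof -
  obtain \<sigma> where \<sigma>: "\<sigma> \<in> K" "x \<in> closed_simplex \<sigma>"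
    using assms(2) unfolding simplex_union_def by blast
  with closed_simplex_support[OF \<sigma>(2)] abstract_complexD[OF assms(1) \<sigma>(1)]
  show "support x \<in> K" "x \<in> closed_simplex (support x)" by blast+
qed

lemma closed_closed_simplex:
  assumes "finite \<sigma>"
  shows "closed (closed_simplex \<sigma>)"
proof -
  have eq: "closed_simplex \<sigma> =
      (\<Inter>v. {x. 0 \<le> x v}) \<inter> (\<Inter>v\<in>- \<sigma>. {x. x v = 0}) \<inter> {x. sum x \<sigma> = 1}"
    by (auto simp: closed_simplex_def)
  show ?thesis
    unfolding eq
    by (intro closed_Int closed_INT ballI closed_Collect_le closed_Collect_eq
        continuous_on_const continuous_on_product_coordinates continuous_on_sum)
qed

lemma finite_imp_closed_fun:
  fixes A :: "('a \<Rightarrow> real) set"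
  assumes "finite A"
  shows "closed A"
  using assms
proof induction
  case (insert x A)
  have "{x} = (\<Inter>v. {y. y v = x v})"
    by auto
  also have "closed \<dots>"
    by (intro closed_INT ballI closed_Collect_eq continuous_on_const continuous_on_product_coordinates)
  finally show ?case
    using insert.IH by (metis closed_Un insert_is_Un)
qed auto

lemma topspace_realization_simplex_union: "topspace (realization K) = simplex_union K"
  by (simp add: topspace_realization simplex_union_def)

text \<open>The complement of a weakly open set meets each simplex of \<open>F\<close> in a set
  closed for the product topology, and a finite union of such sets is closed. So the identity of
  \<open>simplex_union F\<close> is continuous into the weak topology; finiteness of
  \<open>F\<close> is essential.\<close>

lemma continuous_map_into_realization:
  assumes K: "abstract_complex K" and F: "finite F" "F \<subseteq> K"
    and f: "continuous_on S f" "f ` S \<subseteq> simplex_union F"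
  shows "continuous_map (top_of_set S) (realization K) f"
proof -
  have id: "continuous_map (top_of_set (simplex_union F)) (realization K) (\<lambda>x. x)"
    unfolding continuous_map_def
  proof (intro conjI allI impI)
    show "(\<lambda>x. x) \<in> topspace (top_of_set (simplex_union F)) \<rightarrow> topspace (realization K)"
      using simplex_union_mono[OF F(2)] by (auto simp: topspace_realization_simplex_union)
    fix W assume W: "openin (realization K) W"
    have "closed (closed_simplex \<sigma> - W)" if "\<sigma> \<in> F" for \<sigma>
    proof -
      have "openin (top_of_set (closed_simplex \<sigma>)) (W \<inter> closed_simplex \<sigma>)"
        using W that F by (auto simp: openin_realization)
      then have "closedin (top_of_set (closed_simplex \<sigma>)) (closed_simplex \<sigma> - W \<inter> closed_simplex \<sigma>)"
        by (metis closedin_diff closedin_topspace topspace_euclidean_subtopology)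
      moreover have "closed (closed_simplex \<sigma>)"
        using that F abstract_complexD(1)[OF K] closed_closed_simplex by blast
      ultimately have "closed (closed_simplex \<sigma> - W \<inter> closed_simplex \<sigma>)"
        by (rule closedin_closed_trans)
      then show ?thesis
        by (simp add: Diff_Int2 Int_commute Diff_Int)
    qed
    then have "closed (\<Union>\<sigma>\<in>F. closed_simplex \<sigma> - W)"
      using F by (intro closed_UN) auto
    moreover have "{x \<in> simplex_union F. x \<in> W} = simplex_union F \<inter> - (\<Union>\<sigma>\<in>F. closed_simplex \<sigma> - W)"
      unfolding simplex_union_def by blast
    ultimately show "openin (top_of_set (simplex_union F)) {x \<in> topspace (top_of_set (simplex_union F)). x \<in> W}"
      by (simp only: topspace_euclidean_subtopology openin_open_Int open_Compl)
  qed
  have "continuous_map (top_of_set S) (top_of_set (simplex_union F)) f"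
    using f by (simp add: continuous_map_in_subtopology image_subset_iff_funcset)
  from continuous_map_compose[OF this id] show ?thesis
    by (simp add: o_def)
qed

text \<open>One point of \<open>C\<close> is chosen per carrier. A closed simplex has finitely many
  faces and so contains finitely many chosen points; hence every set of chosen points is closed, and
  an infinite closed discrete set cannot lie in a compact one.\<close>

lemma finite_supports_of_compactin:
  assumes K: "abstract_complex K" and C: "compactin (realization K) C"
  shows "finite (support ` C)"
proof -
  have CK: "C \<subseteq> simplex_union K"
    using C by (simp add: compactin_def topspace_realization_simplex_union)
  define pt where "pt = inv_into C support"
  define X where "X = pt ` support ` C"
  have pt: "pt s \<in> C" "support (pt s) = s" if "s \<in> support ` C" for s
    unfolding pt_def using that by (rule inv_into_into, rule f_inv_into_f)
  have X: "X \<subseteq> C" "inj_on support X" "support ` X = support ` C"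
  proof -
    show "X \<subseteq> C" unfolding X_def using pt(1) by blast
    show "inj_on support X"
    proof (rule inj_onI)
      fix x y assume "x \<in> X" "y \<in> X" "support x = support y"
      then show "x = y"
        unfolding X_def using pt(2) by (metis (no_types, lifting) imageE)
    qed
    have "support ` X = (\<lambda>s. support (pt s)) ` (support ` C)"
      unfolding X_def image_image ..
    also have "\<dots> = (\<lambda>s. s) ` (support ` C)"
      using pt(2) by (intro image_cong) auto
    finally show "support ` X = support ` C" by simp
  qed
  have open': "openin (realization K) (simplex_union K - Y)" if "Y \<subseteq> X" for Y
    unfolding openin_realization
  proof (intro conjI ballI)
    show "simplex_union K - Y \<subseteq> (\<Union>\<sigma>\<in>K. closed_simplex \<sigma>)"
      by (auto simp: simplex_union_def)
    fix \<sigma> assume \<sigma>: "\<sigma> \<in> K"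
    have "finite \<sigma>" using abstract_complexD[OF K \<sigma>] by blast
    have "support ` (Y \<inter> closed_simplex \<sigma>) \<subseteq> Pow \<sigma>"
      using closed_simplex_support(1)[OF _ \<open>finite \<sigma>\<close>] by blast
    then have "finite (support ` (Y \<inter> closed_simplex \<sigma>))"
      using \<open>finite \<sigma>\<close> by (meson finite_Pow_iff finite_subset)
    moreover have "inj_on support (Y \<inter> closed_simplex \<sigma>)"
      using X(2) that by (meson inf.coboundedI1 inj_on_subset)
    ultimately have "finite (Y \<inter> closed_simplex \<sigma>)"
      by (simp add: finite_image_iff)
    then have "open (- (Y \<inter> closed_simplex \<sigma>))"
      by (intro open_Compl finite_imp_closed_fun)
    moreover have "(simplex_union K - Y) \<inter> closed_simplex \<sigma> = closed_simplex \<sigma> \<inter> - (Y \<inter> closed_simplex \<sigma>)"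
      using \<sigma> by (auto simp: simplex_union_def)
    ultimately show "openin (top_of_set (closed_simplex \<sigma>)) ((simplex_union K - Y) \<inter> closed_simplex \<sigma>)"
      by (simp add: openin_open_Int)
  qed
  \<comment> \<open>Each member of this cover contains at most one point of \<open>X\<close>, so a
    finite subcover forces \<open>X\<close> to be finite.\<close>
  define \<U> where "\<U> = insert (simplex_union K - X) ((\<lambda>x. simplex_union K - (X - {x})) ` X)"
  have "(\<forall>U\<in>\<U>. openin (realization K) U) \<and> C \<subseteq> \<Union>\<U>"
    using open' CK unfolding \<U>_def by auto
  then obtain \<F> where \<F>: "finite \<F>" "\<F> \<subseteq> \<U>" "C \<subseteq> \<Union>\<F>"
    using C unfolding compactin_def by meson
  have "X \<subseteq> {x \<in> X. simplex_union K - (X - {x}) \<in> \<F>}"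
  proof
    fix x assume x: "x \<in> X"
    then obtain U where "U \<in> \<F>" "x \<in> U" "U \<in> \<U>" using \<F> X(1) by blast
    then show "x \<in> {x \<in> X. simplex_union K - (X - {x}) \<in> \<F>}"
      using x unfolding \<U>_def by auto
  qed
  moreover have "finite {x \<in> X. simplex_union K - (X - {x}) \<in> \<F>}"
  proof (rule finite_imageD)
    show "finite ((\<lambda>x. simplex_union K - (X - {x})) ` {x \<in> X. simplex_union K - (X - {x}) \<in> \<F>})"
      by (rule finite_subset[OF _ \<F>(1)]) auto
    show "inj_on (\<lambda>x. simplex_union K - (X - {x})) {x \<in> X. simplex_union K - (X - {x}) \<in> \<F>}"
      using X(1) CK by (intro inj_onI) blast
  qed
  ultimately have "finite X"
    by (rule finite_subset)
  then show ?thesis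
    using X(3) by (metis finite_imageI)
qed

text \<open>The carriers of the compact image form the finite family. Continuity for the product
  topology follows because it is coarser than the weak one.\<close>

lemma continuous_map_realization_compact:
  assumes K: "abstract_complex K" and S: "compact S"
    and f: "continuous_map (top_of_set S) (realization K) f"
  obtains F where "finite F" "F \<subseteq> K" "continuous_on S f" "f ` S \<subseteq> simplex_union F"
proof -
  have "compactin (realization K) (f ` S)"
    by (rule image_compactin[OF _ f]) (simp add: S compactin_subtopology)
  then have fin: "finite (support ` f ` S)"
    by (rule finite_supports_of_compactin[OF K])
  have fS: "f ` S \<subseteq> simplex_union K"
    using f by (auto simp: continuous_map_def topspace_realization_simplex_union)
  then have sub: "support ` f ` S \<subseteq> K" "f ` S \<subseteq> simplex_union (support ` f ` S)"
    using support_in_complex[OF K] unfolding simplex_union_def by blast+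
  have "continuous_map (realization K) euclidean (\<lambda>x. x)"
    unfolding continuous_map_def
  proof (intro conjI allI impI)
    fix U :: "('a \<Rightarrow> real) set" assume U: "openin euclidean U"
    show "openin (realization K) {x \<in> topspace (realization K). x \<in> U}"
      unfolding openin_realization
    proof (intro conjI ballI)
      fix \<sigma> assume "\<sigma> \<in> K"
      then have "{x \<in> topspace (realization K). x \<in> U} \<inter> closed_simplex \<sigma> = closed_simplex \<sigma> \<inter> U"
        by (auto simp: topspace_realization)
      then show "openin (top_of_set (closed_simplex \<sigma>)) ({x \<in> topspace (realization K). x \<in> U} \<inter> closed_simplex \<sigma>)"
        using U by (simp add: openin_open_Int)
    qed (auto simp: topspace_realization)
  qed auto
  from continuous_map_compose[OF f this] have "continuous_on S f"
    by (simp add: o_def)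
  with fin sub that show thesis by blast
qed

section \<open>Path homotopies in finite subcomplexes\<close>

text \<open>On a finite subcomplex the weak topology is the product topology of \<^typ>\<open>'a \<Rightarrow> real\<close>, so the
  type class based \<^const>\<open>homotopic_paths\<close> applies.\<close>

definition path_in_complex :: "'a set set \<Rightarrow> (real \<Rightarrow> 'a \<Rightarrow> real) \<Rightarrow> bool" where
  "path_in_complex K p \<longleftrightarrow> (\<exists>F. finite F \<and> F \<subseteq> K \<and> path p \<and> path_image p \<subseteq> simplex_union F)"

definition homotopic_in_complex :: "'a set set \<Rightarrow> (real \<Rightarrow> 'a \<Rightarrow> real) \<Rightarrow> (real \<Rightarrow> 'a \<Rightarrow> real) \<Rightarrow> bool" where
  "homotopic_in_complex K p q \<longleftrightarrow> (\<exists>F. finite F \<and> F \<subseteq> K \<and> homotopic_paths (simplex_union F) p q)"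

lemma pathin_realization_iff:
  assumes "abstract_complex K"
  shows "pathin (realization K) p \<longleftrightarrow> path_in_complex K p"
proof
  assume "pathin (realization K) p"
  then obtain F where "finite F" "F \<subseteq> K" "continuous_on {0..1} p" "p ` {0..1} \<subseteq> simplex_union F"
    using continuous_map_realization_compact[OF assms compact_Icc] unfolding pathin_def by metis
  then show "path_in_complex K p"
    unfolding path_in_complex_def path_def path_image_def by blast
next
  assume "path_in_complex K p"
  then show "pathin (realization K) p"
    unfolding path_in_complex_def pathin_def path_def path_image_def
    using continuous_map_into_realization[OF assms] by blast
qed

text \<open>The square is compact, so one and the same map serves both sides. Fixing
  \<open>p 0\<close> and \<open>p 1\<close> identifies the end condition here with the one in
  \<open>homotopic_paths\<close>.\<close>

lemma homotopic_with_realization_iff: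
  assumes "abstract_complex K" "p 0 = a" "p 1 = b"
  shows "homotopic_with (\<lambda>r. r 0 = a \<and> r 1 = b) (top_of_set {0..1}) (realization K) p q \<longleftrightarrow> homotopic_in_complex K p q"
proof
  assume "homotopic_with (\<lambda>r. r 0 = a \<and> r 1 = b) (top_of_set {0..1}) (realization K) p q"
  then obtain h where h: "continuous_map (top_of_set ({0..1} \<times> {0..1})) (realization K) h"
    "\<forall>x. h (0::real, x::real) = p x" "\<forall>x. h (1, x) = q x" "\<forall>t\<in>{0..1}. h (t, 0) = a \<and> h (t, 1) = b"
    unfolding homotopic_with_def prod_topology_subtopology_eu by blast
  obtain F where F: "finite F" "F \<subseteq> K" "continuous_on ({0..1} \<times> {0..1}) h"
      "h ` ({0..1} \<times> {0..1}) \<subseteq> simplex_union F"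
    using continuous_map_realization_compact[OF assms(1) _ h(1)] by (metis compact_Icc compact_Times)
  then have "homotopic_paths (simplex_union F) p q"
    unfolding homotopic_paths using h assms(2,3)
    by (intro exI[of _ h]) (auto simp: pathstart_def pathfinish_def)
  with F show "homotopic_in_complex K p q" unfolding homotopic_in_complex_def by blast
next
  assume "homotopic_in_complex K p q"
  then obtain F where F: "finite F" "F \<subseteq> K" "homotopic_paths (simplex_union F) p q"
    unfolding homotopic_in_complex_def by blast
  then have "homotopic_with (\<lambda>r. r 0 = a \<and> r 1 = b) (top_of_set {0..1}) (top_of_set (simplex_union F)) p q"
    using assms(2,3) unfolding homotopic_paths_def pathstart_def pathfinish_def by simp
  then obtain h where h: "continuous_map (top_of_set ({0..1} \<times> {0..1})) (top_of_set (simplex_union F)) h"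
    "\<forall>x. h (0::real, x::real) = p x" "\<forall>x. h (1, x) = q x" "\<forall>t\<in>{0..1}. h (t, 0) = a \<and> h (t, 1) = b"
    unfolding homotopic_with_def prod_topology_subtopology_eu by blast
  have "continuous_map (top_of_set ({0..1} \<times> {0..1})) (realization K) h"
    by (rule continuous_map_into_realization[OF assms(1) F(1,2)])
      (use h(1) in \<open>auto simp: continuous_map_in_subtopology\<close>)
  with h show "homotopic_with (\<lambda>r. r 0 = a \<and> r 1 = b) (top_of_set {0..1}) (realization K) p q"
    unfolding homotopic_with_def prod_topology_subtopology_eu by blast
qed

lemma homotopic_in_complex_refl: "homotopic_in_complex K p p \<longleftrightarrow> path_in_complex K p"
  unfolding homotopic_in_complex_def path_in_complex_def by simp

lemma homotopic_in_complex_sym: "homotopic_in_complex K p q \<Longrightarrow> homotopic_in_complex K q p"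
  unfolding homotopic_in_complex_def using homotopic_paths_sym by blast

text \<open>Each homotopy comes with its own finite family; the union of the two families carries
  the composite.\<close>

lemma homotopic_in_complex_trans [trans]:
  assumes "homotopic_in_complex K p q" "homotopic_in_complex K q r"
  shows "homotopic_in_complex K p r"
proof -
  obtain F F' where "finite F" "F \<subseteq> K" "homotopic_paths (simplex_union F) p q"
      "finite F'" "F' \<subseteq> K" "homotopic_paths (simplex_union F') q r"
    using assms unfolding homotopic_in_complex_def by blast
  then show ?thesis
    unfolding homotopic_in_complex_def
    by (intro exI[of _ "F \<union> F'"]) (auto simp: simplex_union_Un intro: homotopic_paths_trans homotopic_paths_subset)
qed

lemma homotopic_in_complex_mono: "homotopic_in_complex K p q \<Longrightarrow> K \<subseteq> L \<Longrightarrow> homotopic_in_complex L p q"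
  unfolding homotopic_in_complex_def by blast

lemma path_in_complex_mono: "path_in_complex K p \<Longrightarrow> K \<subseteq> L \<Longrightarrow> path_in_complex L p"
  unfolding path_in_complex_def by blast

lemma homotopic_in_complex_imp_path_in_complex: "homotopic_in_complex K p q \<Longrightarrow> path_in_complex K p" "homotopic_in_complex K p q \<Longrightarrow> path_in_complex K q"
  using homotopic_in_complex_trans homotopic_in_complex_sym homotopic_in_complex_refl by blast+

lemma homotopic_in_complex_imp_ends:
  assumes "homotopic_in_complex K p q"
  shows "pathstart p = pathstart q" "pathfinish p = pathfinish q"
  using assms homotopic_paths_imp_pathstart homotopic_paths_imp_pathfinish unfolding homotopic_in_complex_def by blast+

lemma homotopic_in_complex_join:
  assumes "homotopic_in_complex K p p'" "homotopic_in_complex K q q'" "pathfinish p = pathstart q"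
  shows "homotopic_in_complex K (p +++ q) (p' +++ q')"
proof -
  obtain F F' where "finite F" "F \<subseteq> K" "homotopic_paths (simplex_union F) p p'"
      "finite F'" "F' \<subseteq> K" "homotopic_paths (simplex_union F') q q'"
    using assms unfolding homotopic_in_complex_def by blast
  then show ?thesis
    unfolding homotopic_in_complex_def using assms(3)
    by (intro exI[of _ "F \<union> F'"]) (auto simp: simplex_union_Un intro!: homotopic_paths_join intro: homotopic_paths_subset)
qed

lemma path_in_complex_join:
  assumes "path_in_complex K p" "path_in_complex K q" "pathfinish p = pathstart q"
  shows "path_in_complex K (p +++ q)"
  using homotopic_in_complex_join[of K p p q q] assms by (simp add: homotopic_in_complex_refl)

lemma homotopic_in_complex_assoc:
  assumes "path_in_complex K p" "path_in_complex K q" "path_in_complex K r" "pathfinish p = pathstart q" "pathfinish q = pathstart r"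
  shows "homotopic_in_complex K (p +++ (q +++ r)) ((p +++ q) +++ r)"
proof -
  obtain F1 F2 F3 where F: "finite F1" "F1 \<subseteq> K" "path p" "path_image p \<subseteq> simplex_union F1"
      "finite F2" "F2 \<subseteq> K" "path q" "path_image q \<subseteq> simplex_union F2"
      "finite F3" "F3 \<subseteq> K" "path r" "path_image r \<subseteq> simplex_union F3"
    using assms unfolding path_in_complex_def by blast
  then show ?thesis
    unfolding homotopic_in_complex_def using assms(4,5)
    by (intro exI[of _ "F1 \<union> F2 \<union> F3"]) (auto simp: simplex_union_Un intro!: homotopic_paths_assoc)
qed

text \<open>\<open>p t\<close> and \<open>q t\<close> share a closed simplex, which is convex, so
  the coordinatewise straight homotopy never leaves \<open>simplex_union F\<close>.\<close>

lemma homotopic_in_complex_straight_line: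
  assumes F: "finite F" "F \<subseteq> K" and pq: "path p" "path q"
    and ends: "p 0 = q 0" "p 1 = q 1"
    and near: "\<And>t. t \<in> {0..1} \<Longrightarrow> \<exists>\<sigma>\<in>F. p t \<in> closed_simplex \<sigma> \<and> q t \<in> closed_simplex \<sigma>"
  shows "homotopic_in_complex K p q"
proof -
  define h where "h = (\<lambda>(s, t) v. (1 - s) * p t v + s * q t v)"
  have pv: "continuous_on {0..1} (\<lambda>t. p t v)" and qv: "continuous_on {0..1} (\<lambda>t. q t v)" for v
    using pq unfolding path_def by (auto intro: continuous_on_product_then_coordinatewise)
  have "continuous_on ({0..1} \<times> {0..1}) (\<lambda>x. h x v)" for v
    unfolding h_def case_prod_beta
    by (intro continuous_intros continuous_on_compose2[OF pv] continuous_on_compose2[OF qv]) auto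
  then have "continuous_on ({0..1} \<times> {0..1}) h"
    by (rule continuous_on_coordinatewise_then_product)
  moreover have "h (s, t) \<in> simplex_union F" if "s \<in> {0..1}" "t \<in> {0..1}" for s t
  proof -
    obtain \<sigma> where \<sigma>: "\<sigma> \<in> F" "p t \<in> closed_simplex \<sigma>" "q t \<in> closed_simplex \<sigma>"
      using near[OF \<open>t \<in> {0..1}\<close>] by blast
    have "h (s, t) \<in> closed_simplex \<sigma>"
      using \<sigma> that unfolding closed_simplex_def h_def
      by (auto simp: sum.distrib simp flip: sum_distrib_left)
    with \<sigma> show ?thesis unfolding simplex_union_def by blast
  qed
  ultimately have "homotopic_paths (simplex_union F) p q"
    unfolding homotopic_paths using ends
    by (intro exI[of _ h]) (auto simp: h_def pathstart_def pathfinish_def algebra_simps fun_eq_iff)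
  with F show ?thesis unfolding homotopic_in_complex_def by blast
qed

section \<open>Straight edges and elementary homotopies\<close>

definition edge :: "'a \<Rightarrow> 'a \<Rightarrow> real \<Rightarrow> 'a \<Rightarrow> real" where
  "edge u v = (\<lambda>t w. (1 - t) * vertex_point u w + t * vertex_point v w)"

lemma path_edge: "path (edge u v)"
  unfolding path_def edge_def
  by (intro continuous_on_coordinatewise_then_product continuous_intros)

lemma edge_ends [simp]:
  "pathstart (edge u v) = vertex_point u" "pathfinish (edge u v) = vertex_point v"
  "edge u v 0 = vertex_point u" "edge u v 1 = vertex_point v"
  by (auto simp: pathstart_def pathfinish_def edge_def)

lemma vertex_point_in_closed_simplex:
  assumes "finite \<sigma>" "v \<in> \<sigma>"
  shows "vertex_point v \<in> closed_simplex \<sigma>"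
  using assms by (auto simp: closed_simplex_def vertex_point_def)

lemma edge_in_closed_simplex:
  assumes "finite \<sigma>" "u \<in> \<sigma>" "v \<in> \<sigma>" "t \<in> {0..1}"
  shows "edge u v t \<in> closed_simplex \<sigma>"
  using vertex_point_in_closed_simplex[OF assms(1,2)] vertex_point_in_closed_simplex[OF assms(1,3)] assms(4)
  unfolding closed_simplex_def edge_def by (auto simp: sum.distrib simp flip: sum_distrib_left)

lemma path_in_complex_edge: 
  assumes "{u, v} \<in> K"
  shows "path_in_complex K (edge u v)"
  unfolding path_in_complex_def using assms path_edge edge_in_closed_simplex[of "{u, v}" u v]
  by (intro exI[of _ "{{u, v}}"]) (auto simp: simplex_union_def path_image_def)

lemma linepath_vertex_eq_edge: "edge u u = (\<lambda>_. vertex_point u)"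
  by (auto simp: edge_def fun_eq_iff algebra_simps)

text \<open>Both paths lie in one closed simplex. The vertices may coincide: \<open>u = w\<close>
  gives the cancellation of backtracking.\<close>

lemma homotopic_in_complex_edge_triangle:
  assumes "{u, v, w} \<in> K"
  shows "homotopic_in_complex K (edge u v +++ edge v w) (edge u w)"
proof (rule homotopic_in_complex_straight_line[of "{{u, v, w}}"])
  show "path (edge u v +++ edge v w)" by (simp add: path_edge)
  have "(edge u v +++ edge v w) t \<in> closed_simplex {u, v, w}" if "t \<in> {0..1}" for t
    unfolding joinpaths_def using that by (auto intro!: edge_in_closed_simplex)
  then show "\<exists>\<sigma>\<in>{{u, v, w}}. (edge u v +++ edge v w) t \<in> closed_simplex \<sigma> \<and> edge u w t \<in> closed_simplex \<sigma>"
    if "t \<in> {0..1}" for t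
    using that by (auto intro!: edge_in_closed_simplex)
qed (use assms in \<open>auto simp: path_edge joinpaths_def\<close>)

lemma homotopic_in_complex_reparam:
  assumes "path_in_complex K p" "continuous_on {0..1} f" "f \<in> {0..1} \<rightarrow> {0..1}" "f 0 = 0" "f 1 = 1"
    "\<And>t. t \<in> {0..1} \<Longrightarrow> q t = p (f t)"
  shows "homotopic_in_complex K p q"
  using assms homotopic_paths_reparametrize[of p _ f q] unfolding homotopic_in_complex_def path_in_complex_def by meson

lemma homotopic_in_complex_eq:
  assumes "path_in_complex K p" "\<And>t. t \<in> {0..1} \<Longrightarrow> p t = q t"
  shows "homotopic_in_complex K p q"
  by (rule homotopic_in_complex_reparam[OF assms(1), of "\<lambda>t. t"]) (use assms(2) in auto)

text \<open>\<open>p\<close> is reparametrized by a time change that waits at 0 during the first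
  half.\<close>

lemma homotopic_in_complex_const_left:
  assumes "path_in_complex K p" "p 0 = a"
  shows "homotopic_in_complex K ((\<lambda>_. a) +++ p) p"
proof (rule homotopic_in_complex_sym, rule homotopic_in_complex_reparam[OF assms(1), where f = "\<lambda>t. if t \<le> 1/2 then 0 else 2 * t - 1"])
  show "continuous_on {0..1} (\<lambda>t::real. if t \<le> 1/2 then 0 else 2 * t - 1)"
    by (rule continuous_on_cases_le) (auto intro!: continuous_intros)
qed (auto simp: joinpaths_def assms)

section \<open>Edge words and approximation of paths\<close>

text \<open>These are the moves of the edge path groupoid. \<open>collapse\<close> admits degenerate
  triangles: for \<open>u = w\<close> it turns a backtrack into a repeated vertex, which
  \<open>stutter\<close> removes. The context \<open>us\<close>, \<open>ws\<close> is arbitrary, so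
  the relation lives on all lists; \<open>edge_equiv_word_iff\<close> shows that it respects edge
  words.\<close>

inductive edge_equiv :: "'a set set \<Rightarrow> 'a list \<Rightarrow> 'a list \<Rightarrow> bool" for K where
  edge_refl: "edge_equiv K xs xs"
| edge_sym: "edge_equiv K xs ys \<Longrightarrow> edge_equiv K ys xs"
| edge_trans [trans]: "edge_equiv K xs ys \<Longrightarrow> edge_equiv K ys zs \<Longrightarrow> edge_equiv K xs zs"
| collapse: "{u, v, w} \<in> K \<Longrightarrow> edge_equiv K (us @ u # v # w # ws) (us @ u # w # ws)"
| stutter: "{u} \<in> K \<Longrightarrow> edge_equiv K (us @ u # u # ws) (us @ u # ws)"

definition edge_word :: "'a set set \<Rightarrow> 'a list \<Rightarrow> bool" where
  "edge_word K xs \<longleftrightarrow> xs \<noteq> [] \<and> successively (\<lambda>u v. {u, v} \<in> K) xs \<and> (\<forall>u\<in>set xs. {u} \<in> K)"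

text \<open>Joins nest to the right, so in a long word the first edge takes half of the time, the
  next a quarter, and so on. The value at \<open>[]\<close> is a default; \<open>edge_word\<close>
  excludes the empty list.\<close>

fun edge_path :: "'a list \<Rightarrow> real \<Rightarrow> 'a \<Rightarrow> real" where
  "edge_path [] = (\<lambda>_ _. 0)"
| "edge_path [u] = (\<lambda>_. vertex_point u)"
| "edge_path (u # v # xs) = edge u v +++ edge_path (v # xs)"

lemma edge_word_Cons_Cons: "edge_word K (u # v # xs) \<longleftrightarrow> {u, v} \<in> K \<and> {u} \<in> K \<and> edge_word K (v # xs)"
  unfolding edge_word_def by auto

lemma edge_word_singleton: "edge_word K [u] \<longleftrightarrow> {u} \<in> K"
  unfolding edge_word_def by simp

lemma edge_word_append_Cons: "edge_word K (us @ u # ws) \<longleftrightarrow> edge_word K (us @ [u]) \<and> edge_word K (u # ws)"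
  unfolding edge_word_def successively_append_iff by (auto simp: successively_Cons)

lemma pathstart_edge_path: "xs \<noteq> [] \<Longrightarrow> pathstart (edge_path xs) = vertex_point (hd xs)"
  by (induction xs rule: edge_path.induct) (auto simp: pathstart_def joinpaths_def)

lemma path_in_complex_edge_path: "edge_word K xs \<Longrightarrow> path_in_complex K (edge_path xs)"
proof (induction xs rule: edge_path.induct)
  case (2 u)
  then have "path_in_complex K (edge u u)"
    by (intro path_in_complex_edge) (simp add: edge_word_singleton)
  then show ?case by (simp add: linepath_vertex_eq_edge)
next
  case (3 u v xs)
  then show ?case
    by (auto simp: edge_word_Cons_Cons pathstart_edge_path intro!: path_in_complex_join path_in_complex_edge)
qed (simp add: edge_word_def)

text \<open>The common prefix contributes the same edges in front of both paths, so a move has to be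
  checked only at the front of a word.\<close>

lemma homotopic_in_complex_edge_path_append:
  assumes "homotopic_in_complex K (edge_path (u # xs)) (edge_path (u # ys))" "edge_word K (us @ [u])"
  shows "homotopic_in_complex K (edge_path (us @ u # xs)) (edge_path (us @ u # ys))"
  using assms(2)
proof (induction us)
  case (Cons a us)
  \<comment> \<open>\<open>b\<close> is the letter after \<open>a\<close>; it is found in
    \<open>us @ [u]\<close> and so does not depend on what follows \<open>u\<close>.\<close>
  then obtain b where b: "{a, b} \<in> K" "us @ [u] = b # tl (us @ [u])"
      and w: "edge_word K (us @ [u])"
    by (cases us) (auto simp: edge_word_Cons_Cons)
  have eq: "us @ u # zs = b # tl (us @ u # zs)" for zs
    using b(2) by (cases us) auto
  have "edge_path ((a # us) @ u # zs) = edge a b +++ edge_path (us @ u # zs)" for zs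
    using edge_path.simps(3)[of a b "tl (us @ u # zs)"] eq[of zs] by simp
  moreover have "pathstart (edge_path (us @ u # xs)) = vertex_point b"
    by (subst pathstart_edge_path) (simp, subst eq, simp)
  ultimately show ?case
    using Cons.IH[OF w] path_in_complex_edge[OF b(1)] by (simp add: homotopic_in_complex_join homotopic_in_complex_refl)
qed (use assms in simp)

text \<open>Stated as an equivalence because the relation is symmetric; the faces of
  \<open>{u, v, w}\<close> supply the edges on either side of \<open>collapse\<close>.\<close>

lemma edge_equiv_word_iff:
  assumes K: "abstract_complex K"
  shows "edge_equiv K xs ys \<Longrightarrow> edge_word K xs \<longleftrightarrow> edge_word K ys"
proof (induction rule: edge_equiv.induct)
  case (collapse u v w us ws)
  have "{u} \<in> K" "{v} \<in> K" "{w} \<in> K" "{u, v} \<in> K" "{v, w} \<in> K" "{u, w} \<in> K"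
    by (rule abstract_complexD(3)[OF K collapse]; blast)+
  then have "edge_word K (u # v # w # ws) \<longleftrightarrow> edge_word K (u # w # ws)"
    by (simp add: edge_word_Cons_Cons)
  then show ?case
    using edge_word_append_Cons by metis
next
  case (stutter u us ws)
  then have "edge_word K (u # u # ws) \<longleftrightarrow> edge_word K (u # ws)"
    by (simp add: edge_word_Cons_Cons)
  then show ?case
    using edge_word_append_Cons by metis
qed auto

text \<open>After reassociation \<open>collapse\<close> is a homotopy across a triangle, and
  \<open>stutter\<close> drops a constant path.\<close>

lemma edge_equiv_imp_homotopic_in_complex:
  assumes K: "abstract_complex K"
  shows "edge_equiv K xs ys \<Longrightarrow> edge_word K xs \<Longrightarrow> homotopic_in_complex K (edge_path xs) (edge_path ys)"
proof (induction rule: edge_equiv.induct)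
  case (edge_refl xs)
  then show ?case by (simp add: homotopic_in_complex_refl path_in_complex_edge_path)
next
  case (edge_sym xs ys)
  then show ?case using edge_equiv_word_iff[OF K] homotopic_in_complex_sym by blast
next
  case (edge_trans xs ys zs)
  then show ?case using edge_equiv_word_iff[OF K] homotopic_in_complex_trans by blast
next
  case (collapse u v w us ws)
  have uvw: "{u, v} \<in> K" "{v, w} \<in> K"
    by (rule abstract_complexD(3)[OF K collapse(1)]; blast)+
  have w: "edge_word K (w # ws)" "edge_word K (us @ [u])"
    using collapse(2) edge_word_append_Cons[of K us u "v # w # ws"] by (auto simp: edge_word_Cons_Cons)
  note ps = pathstart_edge_path[of "w # ws"]
  have "homotopic_in_complex K (edge u v +++ (edge v w +++ edge_path (w # ws))) ((edge u v +++ edge v w) +++ edge_path (w # ws))"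
    using uvw w ps by (intro homotopic_in_complex_assoc path_in_complex_edge path_in_complex_edge_path) auto
  also have "homotopic_in_complex K \<dots> (edge u w +++ edge_path (w # ws))"
    using w ps by (intro homotopic_in_complex_join homotopic_in_complex_edge_triangle collapse) (auto simp: homotopic_in_complex_refl path_in_complex_edge_path)
  finally show ?case
    using w(2) by (intro homotopic_in_complex_edge_path_append) auto
next
  case (stutter u us ws)
  have w: "edge_word K (u # ws)" "edge_word K (us @ [u])"
    using stutter(2) edge_word_append_Cons[of K us u "u # ws"] by (auto simp: edge_word_Cons_Cons)
  have "homotopic_in_complex K ((\<lambda>_. vertex_point u) +++ edge_path (u # ws)) (edge_path (u # ws))"
    using pathstart_edge_path[of "u # ws"] w(1)
    by (intro homotopic_in_complex_const_left path_in_complex_edge_path) (auto simp: pathstart_def)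
  then show ?case
    using w(2) by (intro homotopic_in_complex_edge_path_append) (auto simp: linepath_vertex_eq_edge)
qed

text \<open>Replaces \<^const>\<open>subpath\<close>, which is restricted to normed vector spaces.\<close>

definition path_segment :: "real \<Rightarrow> real \<Rightarrow> (real \<Rightarrow> 'b) \<Rightarrow> real \<Rightarrow> 'b" where
  "path_segment u w g = (\<lambda>t. g ((w - u) * t + u))"

lemma path_segment_ends [simp]: "pathstart (path_segment u w g) = g u" "pathfinish (path_segment u w g) = g w"
  by (simp_all add: path_segment_def pathstart_def pathfinish_def)

lemma path_in_complex_path_segment:
  assumes "path_in_complex K g" "0 \<le> u" "u \<le> w" "w \<le> 1"
  shows "path_in_complex K (path_segment u w g)"
proof -
  obtain F where F: "finite F" "F \<subseteq> K" "continuous_on {0..1} g" "g ` {0..1} \<subseteq> simplex_union F"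
    using assms(1) unfolding path_in_complex_def path_def path_image_def by blast
  have "(w - u) * t + u \<in> {0..1}" if "t \<in> {0..1}" for t
  proof -
    have "0 \<le> (w - u) * t" "(w - u) * t \<le> w - u"
      using that assms by (auto intro: mult_left_le)
    then show ?thesis using assms by auto
  qed
  then have sub: "(\<lambda>t. (w - u) * t + u) ` {0..1} \<subseteq> {0..1}" by blast
  have "continuous_on {0..1} (\<lambda>t. g ((w - u) * t + u))"
    by (rule continuous_on_compose2[OF F(3) _ sub]) (intro continuous_intros)
  moreover have "(\<lambda>t. g ((w - u) * t + u)) ` {0..1} \<subseteq> simplex_union F"
    using F(4) sub by blast
  ultimately show ?thesis
    using F
    unfolding path_in_complex_def path_def path_image_def path_segment_def by blast
qed

text \<open>A time change that runs the first half over \<open>[0, a]\<close> and the second half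
  over \<open>[a, 1]\<close> turns one segment into the join.\<close>

lemma homotopic_in_complex_join_path_segments:
  assumes g: "path_in_complex K g" and uvw: "0 \<le> u" "u \<le> v" "v \<le> w" "w \<le> 1" "u < w"
  shows "homotopic_in_complex K (path_segment u w g) (path_segment u v g +++ path_segment v w g)"
proof -
  \<comment> \<open>The fraction of the way from \<open>u\<close> to \<open>w\<close> at which
    \<open>v\<close> is passed.\<close>
  define a where "a = (v - u) / (w - u)"
  have a: "0 \<le> a" "a \<le> 1" "(w - u) * a = v - u"
    using uvw unfolding a_def by auto
  show ?thesis
  proof (rule homotopic_in_complex_reparam[where f = "\<lambda>t. if t \<le> 1/2 then a * (2 * t) else a + (1 - a) * (2 * t - 1)"])
    show "path_in_complex K (path_segment u w g)"
      using g uvw by (intro path_in_complex_path_segment) auto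
    have half: "2 * t = 1" if "t = 1/2" for t :: real using that by simp
    show "continuous_on {0..1} (\<lambda>t. if t \<le> 1/2 then a * (2 * t) else a + (1 - a) * (2 * t - 1))"
      by (rule continuous_on_cases_le) (intro continuous_intros | simp add: half)+
    show "(\<lambda>t. if t \<le> 1/2 then a * (2 * t) else a + (1 - a) * (2 * t - 1)) \<in> {0..1} \<rightarrow> {0..1}"
    proof
      fix t :: real assume t: "t \<in> {0..1}"
      have "0 \<le> a * (2 * t)" using a t by auto
      moreover have "a * (2 * t) \<le> 1" if "t \<le> 1/2" using that a t by (simp add: mult_le_one)
      moreover have "(1 - a) * (2 * t - 1) \<le> 1 - a" using a t by (intro mult_left_le) auto
      moreover have "(1 - a) * (2 * t - 1) \<ge> 0" if "\<not> t \<le> 1/2" using that a t by simp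
      ultimately show "(if t \<le> 1/2 then a * (2 * t) else a + (1 - a) * (2 * t - 1)) \<in> {0..1}"
        using a t by auto
    qed
    fix t :: real
    have e1: "(w - u) * (a * (2 * t)) = (v - u) * (2 * t)"
      using a(3) by (metis mult.assoc)
    have e2: "(w - u) * (a + (1 - a) * (2 * t - 1)) = (v - u) + (w - v) * (2 * t - 1)"
    proof -
      have "(w - u) * (a + (1 - a) * (2 * t - 1)) = (w - u) * a + ((w - u) - (w - u) * a) * (2 * t - 1)"
        by (simp add: algebra_simps)
      also have "\<dots> = (v - u) + (w - v) * (2 * t - 1)"
        unfolding a(3) by simp
      finally show ?thesis .
    qed
    have e3: "(v - u) + (w - v) * (2 * t - 1) + u = (w - v) * (2 * t - 1) + v" by simp
    show "(path_segment u v g +++ path_segment v w g) t =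
        path_segment u w g (if t \<le> 1/2 then a * (2 * t) else a + (1 - a) * (2 * t - 1))"
      unfolding joinpaths_def path_segment_def
      by (cases "t \<le> 1/2") (simp_all only: e1 e2 e3 if_True if_False)
  qed auto
qed

text \<open>The edge path through \<open>v 0, \<dots>, v N\<close> at constant speed, written with hat functions so that
  continuity is immediate.\<close>

definition piecewise_linear :: "nat \<Rightarrow> (nat \<Rightarrow> 'a) \<Rightarrow> real \<Rightarrow> 'a \<Rightarrow> real" where
  "piecewise_linear N v t w = (\<Sum>j\<le>N. max 0 (1 - \<bar>N * t - j\<bar>) * vertex_point (v j) w)"

text \<open>Between \<open>k / N\<close> and \<open>Suc k / N\<close> only the hats centred there
  contribute.\<close>

lemma piecewise_linear_eq_edge:
  fixes t :: real
  assumes "k < N" "k \<le> N * t" "N * t \<le> Suc k"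
  shows "piecewise_linear N v t = edge (v k) (v (Suc k)) (N * t - k)"
proof
  fix w
  have "piecewise_linear N v t w = (\<Sum>j\<in>{k, Suc k}. max 0 (1 - \<bar>N * t - j\<bar>) * vertex_point (v j) w)"
    unfolding piecewise_linear_def
  proof (rule sum.mono_neutral_right)
    show "\<forall>j\<in>{..N} - {k, Suc k}. max 0 (1 - \<bar>N * t - j\<bar>) * vertex_point (v j) w = 0"
    proof
      fix j assume "j \<in> {..N} - {k, Suc k}"
      \<comment> \<open>The conjunct \<open>1 \<le> k\<close> guards the truncated subtraction in
        the passage to reals.\<close>
      then have "j \<le> k - 1 \<and> 1 \<le> k \<or> Suc (Suc k) \<le> j" by auto
      then have "real j \<le> real k - 1 \<or> real k + 2 \<le> real j" by linarith
      then have "1 - \<bar>N * t - j\<bar> \<le> 0" using assms by auto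
      then show "max 0 (1 - \<bar>N * t - j\<bar>) * vertex_point (v j) w = 0" by simp
    qed
  qed (use assms in auto)
  also have "\<dots> = edge (v k) (v (Suc k)) (N * t - k) w"
    using assms by (simp add: edge_def algebra_simps)
  finally show "piecewise_linear N v t w = edge (v k) (v (Suc k)) (N * t - k) w" .
qed

lemma path_piecewise_linear: "path (piecewise_linear N v)"
  unfolding path_def
proof (rule continuous_on_coordinatewise_then_product)
  show "continuous_on {0..1} (\<lambda>t. piecewise_linear N v t w)" for w
    unfolding piecewise_linear_def by (intro continuous_intros)
qed

lemma grid_interval:
  fixes t :: real
  assumes "t \<in> {0..1::real}" "N > (0::nat)"
  obtains k where "k < N" "real k \<le> N * t" "N * t \<le> Suc k"
proof (cases "t = 1")
  case True
  \<comment> \<open>The right end is assigned to the last interval; the floor would give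
    \<open>N\<close>.\<close>
  with assms that[of "N - 1"] show ?thesis by (auto simp: of_nat_diff)
next
  case False
  define k where "k = nat \<lfloor>N * t\<rfloor>"
  have "real k \<le> N * t" "N * t < real k + 1"
    using assms unfolding k_def by (auto simp: le_nat_floor)
  moreover have "N * t < N" using False assms by auto
  ultimately show ?thesis using that[of k] by auto
qed

text \<open>\<open>near\<close> says that \<open>p\<close> maps the grid intervals around
  \<open>j / N\<close> into the open star of \<open>v j\<close>. Between \<open>k / N\<close> and
  \<open>Suc k / N\<close> both \<open>v k\<close> and \<open>v (Suc k)\<close> therefore belong to
  every simplex containing \<open>p t\<close>, so \<open>p\<close> and the piecewise linear path
  share simplices and a straight homotopy joins them.\<close>

lemma path_approx:
  assumes K: "abstract_complex K" and p: "path_in_complex K p" and N: "N > 0"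
    and near: "\<And>j t. j \<le> N \<Longrightarrow> t \<in> {0..1} \<Longrightarrow> \<bar>t - j / N\<bar> \<le> 1 / N \<Longrightarrow> p t (v j) > 0"
    and ends: "p 0 = vertex_point (v 0)" "p 1 = vertex_point (v N)"
  shows "edge_word K (map v [0..<Suc N])" "homotopic_in_complex K p (edge_path (map v [0..<Suc N]))"
proof -
  obtain F where F: "finite F" "F \<subseteq> K" "path p" "path_image p \<subseteq> simplex_union F"
    using p unfolding path_in_complex_def by blast
  have support: "support (p t) \<in> K" if "t \<in> {0..1}" for t
    using support_in_complex(1)[OF K, of "p t"] that F simplex_union_mono[OF F(2)] unfolding path_image_def by blast
  have grid: "\<bar>Suc j / N - j / N\<bar> \<le> 1 / N" "\<bar>j / N - Suc j / N\<bar> \<le> 1 / N" for j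
  proof -
    have "real (Suc j) / N - j / N = 1 / N"
      by (simp add: add_divide_distrib)
    moreover have "0 \<le> 1 / real N" by simp
    ultimately show "\<bar>Suc j / N - j / N\<bar> \<le> 1 / N" "\<bar>j / N - Suc j / N\<bar> \<le> 1 / N"
      by linarith+
  qed
  have edges: "{v j, v (Suc j)} \<in> K" if "j < N" for j
  proof (rule abstract_complexD(3)[OF K support])
    show j: "j / N \<in> {0..1}" using that by auto
    \<comment> \<open>The point at \<open>j / N\<close> lies in the stars of both vertices.\<close>
    show "{v j, v (Suc j)} \<subseteq> support (p (j / N))"
      using near[of j "j / N"] near[of "Suc j" "j / N"] j that grid[of j] by (auto simp: support_def)
  qed auto
  have vert: "{v j} \<in> K" if "j \<le> N" for j
  proof (rule abstract_complexD(3)[OF K support])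
    show j: "j / N \<in> {0..1}" using that N by auto
    show "{v j} \<subseteq> support (p (j / N))"
      using near[of j "j / N"] j that by (auto simp: support_def)
  qed auto
  have edge_word: "edge_word K (map v [j..<Suc N])" if "j \<le> N" for j
    using that
  proof (induction rule: inc_induct)
    case base
    then show ?case using vert by (simp add: edge_word_singleton)
  next
    case (step n)
    then have "map v [n..<Suc N] = v n # v (Suc n) # map v [Suc (Suc n)..<Suc N]"
      by (simp add: upt_conv_Cons del: upt_Suc)
    moreover have "map v [Suc n..<Suc N] = v (Suc n) # map v [Suc (Suc n)..<Suc N]"
      using step by (simp add: upt_conv_Cons del: upt_Suc)
    ultimately show ?case
      using step edges[of n] vert[of n] by (simp add: edge_word_Cons_Cons del: upt_Suc)
  qed
  then show "edge_word K (map v [0..<Suc N])" by blast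
  let ?Q = "piecewise_linear N v"
  have Q0: "?Q 0 = vertex_point (v 0)" using piecewise_linear_eq_edge[of 0 N 0 v] N by simp
  have Q1: "?Q 1 = vertex_point (v N)"
    using piecewise_linear_eq_edge[of "N - 1" N 1 v] N by (auto simp: of_nat_diff)
  have near': "\<exists>\<sigma>\<in>F. p t \<in> closed_simplex \<sigma> \<and> ?Q t \<in> closed_simplex \<sigma>" if t: "t \<in> {0..1}" for t
  proof -
    obtain k where k: "k < N" "real k \<le> N * t" "N * t \<le> Suc k"
      using grid_interval[OF t N] .
    obtain \<sigma> where \<sigma>: "\<sigma> \<in> F" "p t \<in> closed_simplex \<sigma>"
      using F(4) t unfolding path_image_def simplex_union_def by blast
    have "t - k / N = (N * t - k) / N" "t - Suc k / N = (N * t - Suc k) / N"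
      using N by (simp_all add: field_simps)
    moreover have "\<bar>N * t - k\<bar> \<le> 1" "\<bar>N * t - Suc k\<bar> \<le> 1"
      using k by auto
    ultimately have "\<bar>t - k / N\<bar> \<le> 1 / N" "\<bar>t - Suc k / N\<bar> \<le> 1 / N"
      by (simp_all add: abs_divide divide_right_mono)
    then have "p t (v k) > 0" "p t (v (Suc k)) > 0"
      using near t k(1) by auto
    then have "v k \<in> \<sigma>" "v (Suc k) \<in> \<sigma>"
      using \<sigma>(2) by (auto simp: closed_simplex_def)
    moreover have "finite \<sigma>"
      using \<sigma>(1) F(2) abstract_complexD(1)[OF K] by blast
    ultimately have "edge (v k) (v (Suc k)) (N * t - k) \<in> closed_simplex \<sigma>"
      using k by (intro edge_in_closed_simplex) auto
    then show ?thesis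
      using \<sigma> piecewise_linear_eq_edge[OF k(1), of t v] k by auto
  qed
  have pQ: "homotopic_in_complex K p ?Q"
    by (rule homotopic_in_complex_straight_line[OF F(1,2,3) path_piecewise_linear]) (use ends Q0 Q1 near' in auto)
  have Q: "path_image ?Q \<subseteq> simplex_union F"
    using near' unfolding path_image_def simplex_union_def by blast
  \<comment> \<open>Downward induction on \<open>j\<close>, because \<open>edge_path\<close> splits
    off its first edge: the rest of the path after \<open>j / N\<close> is matched with the tail of
    the word.\<close>
  have "homotopic_in_complex K (path_segment (j / N) 1 ?Q) (edge_path (map v [j..<Suc N]))" if "j \<le> N" for j
    using that
  proof (induction rule: inc_induct)
    case base
    have "path_segment (N / N) 1 ?Q = (\<lambda>_. vertex_point (v N))"
      using N Q1 by (simp add: path_segment_def)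
    then show ?case
      using path_in_complex_edge_path[OF edge_word[of N]] by (simp add: homotopic_in_complex_refl)
  next
    case (step n)
    then have eq: "map v [n..<Suc N] = v n # v (Suc n) # map v [Suc (Suc n)..<Suc N]"
        "map v [Suc n..<Suc N] = v (Suc n) # map v [Suc (Suc n)..<Suc N]"
      by (simp_all add: upt_conv_Cons del: upt_Suc)
    have edge: "homotopic_in_complex K (edge (v n) (v (Suc n))) (path_segment (n / N) (Suc n / N) ?Q)"
    proof (rule homotopic_in_complex_eq[OF path_in_complex_edge[OF edges]])
      fix t :: real assume t: "t \<in> {0..1}"
      have e: "N * ((Suc n / N - n / N) * t + n / N) = n + t"
        using N by (simp add: field_simps)
      have "?Q ((Suc n / N - n / N) * t + n / N) = edge (v n) (v (Suc n)) t"
        by (subst piecewise_linear_eq_edge[of n]) (use e t step in auto)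
      then show "edge (v n) (v (Suc n)) t = path_segment (n / N) (Suc n / N) ?Q t"
        unfolding path_segment_def by simp
    qed (use step in simp)
    have "homotopic_in_complex K (path_segment (n / N) 1 ?Q) (path_segment (n / N) (Suc n / N) ?Q +++ path_segment (Suc n / N) 1 ?Q)"
      using step(2) by (intro homotopic_in_complex_join_path_segments homotopic_in_complex_imp_path_in_complex(2)[OF pQ]) (auto simp: field_simps)
    also have "homotopic_in_complex K \<dots> (edge (v n) (v (Suc n)) +++ edge_path (map v [Suc n..<Suc N]))"
      by (intro homotopic_in_complex_join step(3) homotopic_in_complex_sym[OF edge]) simp
    finally show ?case by (simp only: eq edge_path.simps)
  qed
  from this[of 0] have "homotopic_in_complex K ?Q (edge_path (map v [0..<Suc N]))" by (simp add: path_segment_def del: upt_Suc)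
  with pQ show "homotopic_in_complex K p (edge_path (map v [0..<Suc N]))" by (rule homotopic_in_complex_trans)
qed

text \<open>A Lebesgue number argument for the cover by the open stars \<open>{x. x v > 0}\<close>.\<close>

lemma star_grid:
  assumes h: "continuous_on ({0..1} \<times> {0..1}) h" "h ` ({0..1} \<times> {0..1}) \<subseteq> simplex_union F"
  obtains N :: nat and v :: "nat \<Rightarrow> nat \<Rightarrow> 'a" where "N > 0"
    "\<And>i j s t. i \<le> N \<Longrightarrow> j \<le> N \<Longrightarrow> s \<in> {0..1} \<Longrightarrow> t \<in> {0..1} \<Longrightarrow>
       \<bar>s - i / N\<bar> \<le> 1 / N \<Longrightarrow> \<bar>t - j / N\<bar> \<le> 1 / N \<Longrightarrow> h (s :: real, t :: real) (v i j) > (0 :: real)"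
proof -
  let ?S = "{0..1::real} \<times> {0..1::real}"
  define \<G> where "\<G> = {U. open U \<and> (\<exists>v. \<forall>z\<in>U \<inter> ?S. h z v > 0)}"
  have cover: "?S \<subseteq> \<Union>\<G>"
  proof
    fix z assume z: "z \<in> ?S"
    then obtain \<sigma> where \<sigma>: "h z \<in> closed_simplex \<sigma>"
      using h(2) unfolding simplex_union_def by blast
    have "\<exists>v. h z v > 0"
    proof (rule ccontr)
      assume "\<not> (\<exists>v. h z v > 0)"
      then have "\<forall>v. h z v = 0"
        using \<sigma> unfolding closed_simplex_def by (simp add: order.antisym not_less)
      then show False using \<sigma> unfolding closed_simplex_def by simp
    qed
    then obtain v where v: "h z v > 0" ..
    have "continuous_on ?S (\<lambda>z. h z v)"
      by (rule continuous_on_product_then_coordinatewise[OF h(1)])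
    then have "openin (top_of_set ?S) (?S \<inter> (\<lambda>z. h z v) -` {0<..})"
      by (rule continuous_openin_preimage_gen) simp
    then obtain U where U: "open U" "?S \<inter> (\<lambda>z. h z v) -` {0<..} = ?S \<inter> U"
      unfolding openin_open by blast
    then have "z \<in> U" "\<forall>z\<in>U \<inter> ?S. h z v > 0"
      using z v by blast+
    with U(1) show "z \<in> \<Union>\<G>" unfolding \<G>_def by blast
  qed
  obtain e where e: "e > 0" "\<And>z. z \<in> ?S \<Longrightarrow> \<exists>U\<in>\<G>. ball z e \<subseteq> U"
  proof (rule Heine_Borel_lemma[OF _ cover])
    show "compact ?S" by (intro compact_Times compact_Icc)
  qed (auto simp: \<G>_def)
  have "\<exists>v. \<forall>z'\<in>ball z e \<inter> ?S. h z' v > 0" if "z \<in> ?S" for z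
    using e(2)[OF that] unfolding \<G>_def by blast
  then obtain f where f: "\<And>z z'. z \<in> ?S \<Longrightarrow> z' \<in> ball z e \<Longrightarrow> z' \<in> ?S \<Longrightarrow> h z' (f z) > 0"
    by (metis IntI)
  \<comment> \<open>Points of the box of half side \<open>1 / N\<close> around a grid point are
    within \<open>2 / N\<close> of it, which has to stay below the Lebesgue number
    \<open>e\<close>.\<close>
  obtain N :: nat where N: "real N > 2 / e" using reals_Archimedean2 by blast
  then have "N > 0"
    using e(1) by (intro gr0I) auto
  then have "2 / N < e"
    using e(1) N by (simp add: field_simps)
  show thesis
  proof (rule that[of N "\<lambda>i j. f (i / N, j / N)"])
    fix i j s t
    assume *: "i \<le> N" "j \<le> N" "s \<in> {0..1::real}" "t \<in> {0..1::real}" "\<bar>s - i / N\<bar> \<le> 1 / N" "\<bar>t - j / N\<bar> \<le> 1 / N"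
    have "dist (i / N, j / N) (s, t) \<le> \<bar>s - i / N\<bar> + \<bar>t - j / N\<bar>"
      unfolding dist_Pair_Pair dist_real_def
      by (rule order_trans[OF sqrt_sum_squares_le_sum_abs]) (simp add: abs_minus_commute)
    also have "\<dots> \<le> 2 / N" using * by linarith
    finally have "(s, t) \<in> ball (i / N, j / N) e"
      using \<open>2 / N < e\<close> by simp
    then show "h (s, t) (f (i / N, j / N)) > 0"
      using * \<open>N > 0\<close> by (intro f) auto
  qed (rule \<open>N > 0\<close>)
qed

text \<open>The word is swept from row \<open>a\<close> to row \<open>c\<close> one square at a
  time; the diagonal from \<open>c j\<close> to \<open>a (Suc j)\<close> cuts each square into the
  two triangles of \<open>sq\<close>.\<close>

lemma edge_equiv_rows:
  assumes sq: "\<And>j. j < N \<Longrightarrow> {c j, a j, a (Suc j)} \<in> K \<and> {c j, c (Suc j), a (Suc j)} \<in> K"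
    and ends: "a 0 = c 0" "a N = c N" "{a 0} \<in> K" "{a N} \<in> K"
  shows "edge_equiv K (map a [0..<Suc N]) (map c [0..<Suc N])"
proof -
  \<comment> \<open>\<open>W j\<close> follows \<open>c\<close> up to column \<open>j\<close>, steps
    over to \<open>a j\<close> and continues along \<open>a\<close>. The rows agree at both ends, so
    \<open>W 0\<close> and \<open>W N\<close> repeat a vertex, which \<open>stutter\<close>
    removes.\<close>
  define W where "W j = map c [0..<Suc j] @ map a [j..<Suc N]" for j
  have W: "edge_equiv K (W 0) (W j)" if "j \<le> N" for j
    using that
  proof (induction j)
    case 0
    show ?case by (rule edge_equiv.edge_refl)
  next
    case (Suc j)
    let ?us = "map c [0..<j]" and ?ws = "map a [Suc (Suc j)..<Suc N]"
    have tl: "map a [Suc j..<Suc N] = a (Suc j) # ?ws" "map a [j..<Suc N] = a j # a (Suc j) # ?ws"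
      using Suc.prems by (simp_all add: upt_conv_Cons del: upt_Suc)
    have 1: "W j = ?us @ c j # a j # a (Suc j) # ?ws"
      unfolding W_def tl by simp
    have 2: "W (Suc j) = ?us @ c j # c (Suc j) # a (Suc j) # ?ws"
      unfolding W_def tl by simp
    have "edge_equiv K (W 0) (W j)" using Suc by simp
    also have "edge_equiv K (W j) (?us @ c j # a (Suc j) # ?ws)"
      unfolding 1 using sq Suc.prems by (intro edge_equiv.collapse) auto
    also have "edge_equiv K \<dots> (W (Suc j))"
      unfolding 2 using sq Suc.prems by (intro edge_equiv.edge_sym[OF edge_equiv.collapse]) auto
    finally show ?case .
  qed
  have "W 0 = [] @ a 0 # a 0 # map a [Suc 0..<Suc N]"
    unfolding W_def using ends by (simp add: upt_conv_Cons del: upt_Suc)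
  then have "edge_equiv K (W 0) ([] @ a 0 # map a [Suc 0..<Suc N])"
    using edge_equiv.stutter[OF ends(3)] by metis
  then have "edge_equiv K (map a [0..<Suc N]) (W 0)"
    using edge_equiv.edge_sym by (simp add: upt_conv_Cons del: upt_Suc)
  also have "edge_equiv K (W 0) (W N)" by (rule W) simp
  also have "W N = map c [0..<N] @ a N # a N # []"
    unfolding W_def using ends by simp
  also have "edge_equiv K \<dots> (map c [0..<N] @ a N # [])"
    by (rule edge_equiv.stutter[OF ends(4)])
  also have "\<dots> = map c [0..<Suc N]"
    using ends by simp
  finally show ?thesis .
qed

text \<open>The paths lie in \<open>K\<close>, the homotopy only in \<open>L\<close>. One grid
  serves both: the outer rows approximate \<open>p\<close> and \<open>q\<close>, whose carriers are
  in \<open>K\<close>, while the moves between rows use simplices of \<open>L\<close>.\<close>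

lemma homotopy_approx:
  assumes K: "abstract_complex K" and L: "abstract_complex L" and KL: "K \<subseteq> L"
    and p: "path_in_complex K p" and q: "path_in_complex K q" and pq: "homotopic_in_complex L p q"
    and ends: "p 0 = vertex_point a" "p 1 = vertex_point b"
  obtains xs ys where "edge_word K xs" "edge_word K ys" "homotopic_in_complex K p (edge_path xs)" "homotopic_in_complex K q (edge_path ys)" "edge_equiv L xs ys"
proof -
  obtain F where F: "finite F" "F \<subseteq> L" "homotopic_paths (simplex_union F) p q"
    using pq unfolding homotopic_in_complex_def by blast
  then obtain h where h: "continuous_on ({0..1} \<times> {0..1}) h" "h \<in> ({0..1} \<times> {0..1}) \<rightarrow> simplex_union F"
      and h0: "\<And>t. t \<in> {0..1::real} \<Longrightarrow> h (0::real, t) = p t" and h1: "\<And>t. t \<in> {0..1} \<Longrightarrow> h (1, t) = q t"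
      and hends: "\<And>s. s \<in> {0..1} \<Longrightarrow> h (s, 0) = vertex_point a \<and> h (s, 1) = vertex_point b"
    unfolding homotopic_paths using ends by (auto simp: pathstart_def pathfinish_def)
  obtain N :: nat and v :: "nat \<Rightarrow> nat \<Rightarrow> 'a" where N: "N > 0" and
    v: "\<And>i j s t. i \<le> N \<Longrightarrow> j \<le> N \<Longrightarrow> s \<in> {0..1} \<Longrightarrow> t \<in> {0..1} \<Longrightarrow>
       \<bar>s - i / N\<bar> \<le> 1 / N \<Longrightarrow> \<bar>t - j / N\<bar> \<le> 1 / N \<Longrightarrow> h (s, t) (v i j) > 0"
    using star_grid[OF h(1), of F] h(2) by (auto simp: image_subset_iff_funcset)
  have N1: "i / N \<in> {0..1::real}" if "i \<le> N" for i
    using that N by auto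
  \<comment> \<open>On these two sides the homotopy is constant at a vertex, whose only positive
    coordinate is its own.\<close>
  have va: "v i 0 = a" and vb: "v i N = b" if "i \<le> N" for i
    using v[of i 0 "i / N" 0] v[of i N "i / N" 1] hends[OF N1[OF that]] that N N1[OF that]
    by (auto simp: vertex_point_def split: if_splits)
  have support: "support (h (s, t)) \<in> L" if "s \<in> {0..1}" "t \<in> {0..1}" for s t
    using support_in_complex(1)[OF L, of "h (s, t)"] that h(2) simplex_union_mono[OF F(2)] by blast
  have grid: "\<bar>j / N - Suc j / N\<bar> \<le> 1 / N" for j
  proof -
    have "real (Suc j) / N - j / N = 1 / N"
      by (simp add: add_divide_distrib)
    moreover have "0 \<le> 1 / real N" by simp
    ultimately show ?thesis by linarith
  qed
  \<comment> \<open>At one corner of a grid square all four chosen vertices have positive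
    coordinates, so they span a face of its carrier.\<close>
  have square: "{v i j, v i (Suc j), v (Suc i) j, v (Suc i) (Suc j)} \<subseteq> support (h (i / N, j / N))"
    if "i < N" "j < N" for i j
    using that N N1[of i] N1[of j] grid[of i] grid[of j]
      v[of i j "i / N" "j / N"] v[of i "Suc j" "i / N" "j / N"]
      v[of "Suc i" j "i / N" "j / N"] v[of "Suc i" "Suc j" "i / N" "j / N"]
    by (auto simp: support_def)
  define row where "row i = map (v i) [0..<Suc N]" for i
  have "edge_equiv L (row i) (row (Suc i))" if "i < N" for i
    unfolding row_def
  proof (rule edge_equiv_rows)
    fix j assume "j < N"
    note sq = abstract_complexD(3)[OF L support[OF N1[of i] N1[of j]]]
    show "{v (Suc i) j, v i j, v i (Suc j)} \<in> L \<and> {v (Suc i) j, v (Suc i) (Suc j), v i (Suc j)} \<in> L"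
      using square[OF that \<open>j < N\<close>] that \<open>j < N\<close> by (intro conjI sq) auto
  next
    have "0 \<in> {0..1::real}" by simp
    note sq = abstract_complexD(3)[OF L support[OF N1[of i] N1[of 0]]]
    show "{v i 0} \<in> L" 
      using square[OF that N] that by (intro sq) auto
    \<comment> \<open>Squares exist only for \<open>j < N\<close>, so the last column needs its own
      grid point.\<close>
    have "{v i N} \<subseteq> support (h (i / N, N / N))"
      using v[of i N "i / N" 1] that N N1[of i] by (auto simp: support_def)
    then show "{v i N} \<in> L" 
      using that by (intro abstract_complexD(3)[OF L support[OF N1[of i] N1[of N]]]) auto
  qed (use va vb that in auto)
  then have edge_equiv: "edge_equiv L (row 0) (row i)" if "i \<le> N" for i
    using that by (induction i) (auto intro: edge_equiv.edge_refl edge_equiv.edge_trans)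
  have near_p: "p t (v 0 j) > 0" if "j \<le> N" "t \<in> {0..1}" "\<bar>t - j / N\<bar> \<le> 1 / N" for j t
    using v[of 0 j 0 t] that h0[of t] N by auto
  have near_q: "q t (v N j) > 0" if "j \<le> N" "t \<in> {0..1}" "\<bar>t - j / N\<bar> \<le> 1 / N" for j t
    using v[of N j 1 t] that h1[of t] N by auto
  have qends: "q 0 = vertex_point a" "q 1 = vertex_point b"
    using h1[of 0] h1[of 1] hends[of 1] by auto
  show thesis
  proof (rule that[of "row 0" "row N"])
    show "edge_word K (row 0)" "homotopic_in_complex K p (edge_path (row 0))"
      unfolding row_def using path_approx[OF K p N, of "v 0"] near_p ends va[of 0] vb[of 0] by auto
    show "edge_word K (row N)" "homotopic_in_complex K q (edge_path (row N))"
      unfolding row_def using path_approx[OF K q N, of "v N"] near_q qends va[of N] vb[of N] by auto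
    show "edge_equiv L (row 0) (row N)" by (rule edge_equiv) simp
  qed
qed

section \<open>The fundamental group of a subdivided complex\<close>

lemma loops_realization:
  assumes "abstract_complex K"
  shows "p \<in> loops (realization K) x \<longleftrightarrow> path_in_complex K p \<and> p 0 = x \<and> p 1 = x"
  unfolding loops_def by (simp add: pathin_realization_iff[OF assms])

lemma loop_rel_realization:
  assumes "abstract_complex K"
  shows "loop_rel (realization K) x =
    {(p, q). p \<in> loops (realization K) x \<and> q \<in> loops (realization K) x \<and> homotopic_in_complex K p q}"
  unfolding loop_rel_def using homotopic_with_realization_iff[OF assms]
  by (auto simp: loops_def)

lemma equiv_loop_rel:
  assumes "abstract_complex K"
  shows "equiv (loops (realization K) x) (loop_rel (realization K) x)"
  unfolding equiv_def refl_on_def sym_def trans_def loop_rel_realization[OF assms]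
  using homotopic_in_complex_sym homotopic_in_complex_trans by (auto simp: loops_realization[OF assms] homotopic_in_complex_refl)

lemma loops_join:
  assumes "abstract_complex K" "p \<in> loops (realization K) x" "q \<in> loops (realization K) x"
  shows "p +++ q \<in> loops (realization K) x"
proof -
  have "path_in_complex K (p +++ q)"
    using assms by (intro path_in_complex_join) (auto simp: loops_realization pathstart_def pathfinish_def)
  then show ?thesis
    using assms by (simp add: loops_realization joinpaths_def)
qed

abbreviation loop_class :: "'a set set \<Rightarrow> 'a \<Rightarrow> (real \<Rightarrow> 'a \<Rightarrow> real) \<Rightarrow> (real \<Rightarrow> 'a \<Rightarrow> real) set" where
  "loop_class K b p \<equiv> loop_rel (realization K) (vertex_point b) `` {p}"

lemma carrier_pi1: "carrier (pi1 K b) = loop_class K b ` loops (realization K) (vertex_point b)"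
  unfolding pi1_def fundamental_group_def quotient_def by auto

lemma loop_class_eq_iff:
  assumes "abstract_complex K"
    "p \<in> loops (realization K) (vertex_point b)" "q \<in> loops (realization K) (vertex_point b)"
  shows "loop_class K b p = loop_class K b q \<longleftrightarrow> homotopic_in_complex K p q"
  using eq_equiv_class_iff[OF equiv_loop_rel[OF assms(1)] assms(2,3)] assms
  by (simp add: loop_rel_realization)

text \<open>Products and induced maps are defined as unions over all representatives; a value that
  is constant on the class makes the union collapse.\<close>

lemma UN_loop_class:
  assumes K: "abstract_complex K" and p: "p \<in> loops (realization K) (vertex_point b)"
    and f: "\<And>q. q \<in> loops (realization K) (vertex_point b) \<Longrightarrow> homotopic_in_complex K p q \<Longrightarrow> f q = f p"
  shows "(\<Union>q\<in>loop_class K b p. f q) = f p"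
proof -
  have "p \<in> loop_class K b p"
    using p K by (auto simp: loop_rel_realization loops_realization homotopic_in_complex_refl)
  moreover have "f q = f p" if "q \<in> loop_class K b p" for q
    using that f by (auto simp: loop_rel_realization[OF K])
  ultimately show ?thesis by blast
qed

lemma mult_pi1:
  assumes K: "abstract_complex K"
    and p: "p \<in> loops (realization K) (vertex_point b)"
    and q: "q \<in> loops (realization K) (vertex_point b)"
  shows "loop_class K b p \<otimes>\<^bsub>pi1 K b\<^esub> loop_class K b q = loop_class K b (p +++ q)"
proof -
  have cong: "loop_class K b (p' +++ q') = loop_class K b (p +++ q)"
    if "p' \<in> loops (realization K) (vertex_point b)" "homotopic_in_complex K p p'"
      "q' \<in> loops (realization K) (vertex_point b)" "homotopic_in_complex K q q'" for p' q'
    using that p q loops_join[OF K]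
    by (intro loop_class_eq_iff[THEN iffD2] homotopic_in_complex_sym[OF homotopic_in_complex_join])
      (auto simp: K loops_realization[OF K] pathstart_def pathfinish_def)
  have homotopic_in_complex: "homotopic_in_complex K p p" "homotopic_in_complex K q q"
    using p q by (auto simp: homotopic_in_complex_refl loops_realization[OF K])
  have "loop_class K b p \<otimes>\<^bsub>pi1 K b\<^esub> loop_class K b q =
      (\<Union>p'\<in>loop_class K b p. \<Union>q'\<in>loop_class K b q. loop_class K b (p' +++ q'))"
    unfolding pi1_def fundamental_group_def by simp
  also have "\<dots> = (\<Union>p'\<in>loop_class K b p. loop_class K b (p' +++ q))"
  proof (rule SUP_cong[OF HOL.refl])
    fix p' assume "p' \<in> loop_class K b p"
    then have p': "p' \<in> loops (realization K) (vertex_point b)" "homotopic_in_complex K p p'"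
      by (auto simp: loop_rel_realization[OF K])
    show "(\<Union>q'\<in>loop_class K b q. loop_class K b (p' +++ q')) = loop_class K b (p' +++ q)"
      by (rule UN_loop_class[OF K q]) (use cong[OF p'] cong[OF p' q homotopic_in_complex(2)] in simp)
  qed
  also have "\<dots> = loop_class K b (p +++ q)"
    by (rule UN_loop_class[OF K p]) (use cong[OF _ _ q homotopic_in_complex(2)] in simp)
  finally show ?thesis .
qed

lemma pi1_incl_loop_class:
  assumes K: "abstract_complex K" and L: "abstract_complex L" and KL: "K \<subseteq> L"
    and p: "p \<in> loops (realization K) (vertex_point b)"
  shows "pi1_incl L b (loop_class K b p) = loop_class L b p"
  unfolding pi1_incl_def
proof (rule UN_loop_class[OF K p])
  fix q assume "q \<in> loops (realization K) (vertex_point b)" "homotopic_in_complex K p q"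
  then show "loop_class L b q = loop_class L b p"
    using p KL
    by (subst loop_class_eq_iff[OF L])
      (auto simp: loops_realization[OF K] loops_realization[OF L] intro: path_in_complex_mono homotopic_in_complex_mono homotopic_in_complex_sym)
qed

lemma loops_mono:
  assumes "abstract_complex K" "abstract_complex L" "K \<subseteq> L"
  shows "loops (realization K) x \<subseteq> loops (realization L) x"
  using assms path_in_complex_mono by (auto simp: loops_realization)

lemma pi1_incl_comp:
  assumes "abstract_complex K" "abstract_complex L" "abstract_complex J" "K \<subseteq> L" "L \<subseteq> J"
    and A: "A \<in> carrier (pi1 K b)"
  shows "pi1_incl J b (pi1_incl L b A) = pi1_incl J b A"
proof -
  obtain p where "p \<in> loops (realization K) (vertex_point b)" "A = loop_class K b p"
    using A unfolding carrier_pi1 by blast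
  then show ?thesis
    using assms loops_mono[OF assms(1,2,4)] by (simp add: pi1_incl_loop_class subset_iff)
qed

lemma pi1_incl_iso:
  assumes K: "abstract_complex K" and L: "abstract_complex L" and KL: "K \<subseteq> L"
    and inj: "\<And>p q. p \<in> loops (realization K) (vertex_point b) \<Longrightarrow>
      q \<in> loops (realization K) (vertex_point b) \<Longrightarrow> homotopic_in_complex L p q \<Longrightarrow> homotopic_in_complex K p q"
    and surj: "\<And>p. p \<in> loops (realization L) (vertex_point b) \<Longrightarrow>
      \<exists>q\<in>loops (realization K) (vertex_point b). homotopic_in_complex L q p"
  shows "pi1_incl L b \<in> iso (pi1 K b) (pi1 L b)"
proof (rule isoI)
  note incl = pi1_incl_loop_class[OF K L KL]
  note sub = loops_mono[OF K L KL, THEN subsetD]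
  show "pi1_incl L b \<in> hom (pi1 K b) (pi1 L b)"
  proof (rule homI)
    show "pi1_incl L b A \<in> carrier (pi1 L b)" if "A \<in> carrier (pi1 K b)" for A
      using that sub incl unfolding carrier_pi1 by auto
    fix A B assume "A \<in> carrier (pi1 K b)" "B \<in> carrier (pi1 K b)"
    then obtain p q where "p \<in> loops (realization K) (vertex_point b)" "A = loop_class K b p"
        "q \<in> loops (realization K) (vertex_point b)" "B = loop_class K b q"
      unfolding carrier_pi1 by blast
    then show "pi1_incl L b (A \<otimes>\<^bsub>pi1 K b\<^esub> B) = pi1_incl L b A \<otimes>\<^bsub>pi1 L b\<^esub> pi1_incl L b B"
      using incl sub loops_join[OF K] by (simp add: mult_pi1[OF K] mult_pi1[OF L])
  qed
  show "bij_betw (pi1_incl L b) (carrier (pi1 K b)) (carrier (pi1 L b))"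
    unfolding bij_betw_def
  proof
    show "inj_on (pi1_incl L b) (carrier (pi1 K b))"
      unfolding carrier_pi1
      using inj by (auto simp: inj_on_def incl loop_class_eq_iff[OF K] loop_class_eq_iff[OF L] sub)
    have "\<exists>q\<in>loops (realization K) (vertex_point b). loop_class L b p = loop_class L b q"
      if "p \<in> loops (realization L) (vertex_point b)" for p
      using surj[OF that] that sub by (metis loop_class_eq_iff[OF L])
    then have "loop_class L b ` loops (realization K) (vertex_point b) =
        loop_class L b ` loops (realization L) (vertex_point b)"
      using sub by blast
    then show "pi1_incl L b ` carrier (pi1 K b) = carrier (pi1 L b)"
      unfolding carrier_pi1 image_image by (simp add: incl cong: image_cong)
  qed
qed

section \<open>Subdivision of edge words\<close>

lemma edge_equiv_context:
  assumes "edge_equiv K xs ys"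
  shows "edge_equiv K (as @ xs @ bs) (as @ ys @ bs)"
  using assms
proof (induction rule: edge_equiv.induct)
  case (collapse u v w us ws)
  then show ?case using edge_equiv.collapse[of u v w K "as @ us" "ws @ bs"] by simp
next
  case (stutter u us ws)
  then show ?case using edge_equiv.stutter[of u K "as @ us" "ws @ bs"] by simp
qed (blast intro: edge_equiv.edge_refl edge_equiv.edge_sym edge_equiv.edge_trans)+

fun midword :: "('a \<Rightarrow> 'a \<Rightarrow> 'a) \<Rightarrow> 'a list \<Rightarrow> 'a list" where
  "midword m [] = []"
| "midword m [u] = [u]"
| "midword m (u # v # xs) = u # m u v # midword m (v # xs)"

lemma midword_Cons: "midword m (u # xs) = u # tl (midword m (u # xs))"
  by (cases xs) auto

text \<open>Each inserted letter is removed by collapsing the triangle on an edge and its midpoint.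
  Applied to both complexes of a subdivision.\<close>

lemma edge_equiv_midword_self:
  assumes "\<And>u v. {u, v} \<in> K \<Longrightarrow> {u, m u v, v} \<in> K" and "edge_word K xs"
  shows "edge_equiv K (midword m xs) xs"
  using assms(2)
proof (induction xs rule: induct_list012)
  case (3 u v xs)
  let ?t = "tl (midword m (v # xs))"
  have "midword m (u # v # xs) = [] @ u # m u v # v # ?t"
    using midword_Cons[of m v xs] by simp
  also have "edge_equiv K \<dots> ([] @ u # v # ?t)"
    using 3 by (intro edge_equiv.collapse assms(1)) (simp add: edge_word_Cons_Cons)
  also have "[] @ u # v # ?t = [u] @ midword m (v # xs) @ []"
    using midword_Cons[of m v xs] by simp
  also have "edge_equiv K \<dots> ([u] @ (v # xs) @ [])"
    using 3 by (intro edge_equiv_context) (simp add: edge_word_Cons_Cons)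
  finally show ?case by simp
qed (auto intro: edge_equiv.edge_refl)

text \<open>\<open>midword\<close> keeps \<open>u\<close>, so the letters inserted before it do not
  depend on what follows.\<close>

lemma edge_equiv_midword_append:
  assumes "edge_equiv K (midword m (u # xs)) (midword m (u # ys))"
  shows "edge_equiv K (midword m (us @ u # xs)) (midword m (us @ u # ys))"
proof (induction us)
  case (Cons a us)
  obtain c where c: "us @ u # zs = c # tl (us @ u # zs)" for zs
    by (cases us) auto
  have "midword m ((a # us) @ u # zs) = [a, m a c] @ midword m (us @ u # zs) @ []" for zs
    using midword.simps(3)[of m a c "tl (us @ u # zs)"] c[of zs] by simp
  then show ?case using edge_equiv_context[OF Cons, of "[a, m a c]" "[]"] by simp
qed (use assms in simp)

text \<open>What makes edge subdivision an inverse of the inclusion: \<open>half_K\<close> brings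
  words of \<open>L\<close> into \<open>K\<close>, \<open>mid_K\<close> and \<open>mid_L\<close> say
  that subdividing changes nothing up to moves in either complex, and \<open>triangle\<close> turns
  a collapse in \<open>L\<close> into moves in \<open>K\<close>. \<open>m_sym\<close> is there
  because edges are unoriented; \<open>m_neq\<close> keeps the halves of a proper edge nondegenerate
  for the chain formula.\<close>

locale subdivision =
  fixes K L :: "'a set set" and m :: "'a \<Rightarrow> 'a \<Rightarrow> 'a"
  assumes K: "abstract_complex K" and L: "abstract_complex L" and KL: "K \<subseteq> L"
    and m_sym: "m u v = m v u"
    and m_neq: "{u, v} \<in> L \<Longrightarrow> u \<noteq> v \<Longrightarrow> m u v \<noteq> u"
    and mid_L: "{u, v} \<in> L \<Longrightarrow> {u, m u v, v} \<in> L"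
    and half_K: "{u, v} \<in> L \<Longrightarrow> {u, m u v} \<in> K"
    and mid_K: "{u, v} \<in> K \<Longrightarrow> {u, m u v, v} \<in> K"
    and triangle: "{u, v, w} \<in> L \<Longrightarrow> edge_equiv K [u, m u v, v, m v w, w] [u, m u w, w]"
begin

lemma half_K': "{u, v} \<in> L \<Longrightarrow> {m u v, v} \<in> K"
  using half_K[of v u] by (simp add: m_sym insert_commute)

lemma edge_word_midword: "edge_word L xs \<Longrightarrow> edge_word K (midword m xs)"
proof (induction xs rule: induct_list012)
  case (2 u)
  \<comment> \<open>The vertex is treated as a degenerate edge of \<open>L\<close>; it is a face of
    the half of that edge in \<open>K\<close>.\<close>
  then have "{u, m u u} \<in> K" by (intro half_K) (simp add: edge_word_singleton)
  then show ?case using abstract_complexD(3)[OF K, of _ "{u}"] by (auto simp: edge_word_singleton)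
next
  case (3 u v xs)
  then have uv: "{u, v} \<in> L" "edge_word K (midword m (v # xs))"
    by (auto simp: edge_word_Cons_Cons)
  then have "{u, m u v} \<in> K" "{m u v, v} \<in> K" "{u} \<in> K" "{m u v} \<in> K"
    using half_K half_K' abstract_complexD(3)[OF K half_K[OF uv(1)]] by auto
  then show ?case
    using uv(2) midword_Cons[of m v xs] by (metis midword.simps(3) edge_word_Cons_Cons)
qed (simp add: edge_word_def)

text \<open>For \<open>collapse\<close> this is \<open>triangle\<close> in a context. A repeated
  vertex acquires the letter \<open>m u u\<close>, which \<open>mid_K\<close> removes before
  \<open>stutter\<close> applies.\<close>

lemma edge_equiv_midword: "edge_equiv L xs ys \<Longrightarrow> edge_equiv K (midword m xs) (midword m ys)"
proof (induction rule: edge_equiv.induct)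
  case (collapse u v w us ws)
  let ?t = "tl (midword m (w # ws))"
  have eq: "midword m (w # ws) = w # ?t" by (rule midword_Cons)
  have "edge_equiv K ([] @ [u, m u v, v, m v w, w] @ ?t) ([] @ [u, m u w, w] @ ?t)"
    by (rule edge_equiv_context[OF triangle[OF collapse]])
  then show ?case
    using eq by (intro edge_equiv_midword_append) simp
next
  case (stutter u us ws)
  let ?t = "tl (midword m (u # ws))"
  have eq: "midword m (u # ws) = u # ?t" by (rule midword_Cons)
  have u: "{u} \<in> K"
    using edge_word_midword[of "[u]"] stutter by (simp add: edge_word_singleton)
  have "edge_equiv K ([] @ u # m u u # u # ?t) ([] @ u # u # ?t)"
    using mid_K[of u u] u by (intro edge_equiv.collapse) simp
  also have "edge_equiv K \<dots> ([] @ u # ?t)"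
    by (rule edge_equiv.stutter[OF u])
  finally show ?case
    using eq by (intro edge_equiv_midword_append) simp
qed (blast intro: edge_equiv.edge_refl edge_equiv.edge_sym edge_equiv.edge_trans)+

text \<open>Injectivity: a homotopy in \<open>L\<close> becomes moves in \<open>L\<close> between
  two words of \<open>K\<close>; \<open>midword\<close> transports these moves to \<open>K\<close>,
  where both words are equivalent to their subdivisions. Surjectivity: a word of \<open>L\<close> is
  equivalent in \<open>L\<close> to its subdivision, which is a word of \<open>K\<close>.\<close>

theorem pi1_incl_iso_subdivision: "pi1_incl L b \<in> iso (pi1 K b) (pi1 L b)"
proof (rule pi1_incl_iso[OF K L KL])
  fix p q assume "p \<in> loops (realization K) (vertex_point b)" "q \<in> loops (realization K) (vertex_point b)"
    and pq: "homotopic_in_complex L p q"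
  then have p: "path_in_complex K p" "p 0 = vertex_point b" "p 1 = vertex_point b" and q: "path_in_complex K q"
    by (auto simp: loops_realization[OF K])
  obtain xs ys where w: "edge_word K xs" "edge_word K ys" "homotopic_in_complex K p (edge_path xs)" "homotopic_in_complex K q (edge_path ys)" "edge_equiv L xs ys"
    using homotopy_approx[OF K L KL p(1) q pq p(2,3)] .
  have "edge_equiv K xs (midword m xs)"
    by (intro edge_equiv.edge_sym[OF edge_equiv_midword_self] mid_K w)
  also have "edge_equiv K \<dots> (midword m ys)"
    by (rule edge_equiv_midword[OF w(5)])
  also have "edge_equiv K \<dots> ys"
    by (intro edge_equiv_midword_self mid_K w)
  finally have "homotopic_in_complex K (edge_path xs) (edge_path ys)"
    by (intro edge_equiv_imp_homotopic_in_complex[OF K] w)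
  with w(3,4) show "homotopic_in_complex K p q"
    using homotopic_in_complex_trans homotopic_in_complex_sym by blast
next
  fix p assume "p \<in> loops (realization L) (vertex_point b)"
  then have p: "path_in_complex L p" "p 0 = vertex_point b" "p 1 = vertex_point b"
    by (auto simp: loops_realization[OF L])
  \<comment> \<open>The constant homotopy lets the approximation of homotopies produce a word for a
    single path.\<close>
  then have "homotopic_in_complex L p p" by (simp add: homotopic_in_complex_refl)
  then obtain xs where w: "edge_word L xs" "homotopic_in_complex L p (edge_path xs)"
    using homotopy_approx[OF L L order_refl p(1,1) _ p(2,3)] by metis
  have "edge_equiv L xs (midword m xs)"
    by (intro edge_equiv.edge_sym[OF edge_equiv_midword_self] mid_L w)
  then have q: "homotopic_in_complex L p (edge_path (midword m xs))"
    using edge_equiv_imp_homotopic_in_complex[OF L _ w(1)] w(2) homotopic_in_complex_trans by blast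
  then have "edge_path (midword m xs) \<in> loops (realization K) (vertex_point b)"
    using homotopic_in_complex_imp_ends[OF q] p path_in_complex_edge_path[OF edge_word_midword[OF w(1)]]
    by (simp add: loops_realization[OF K] pathstart_def pathfinish_def)
  with q show "\<exists>q\<in>loops (realization K) (vertex_point b). homotopic_in_complex L q p"
    using homotopic_in_complex_sym by blast
qed

end

section \<open>Chains with finite support\<close>

text \<open>An ambient group independent of complex and degree. Cycles and boundaries of both
  complexes are subgroups of it, so their cosets can be compared directly.\<close>

definition fin_chains :: "('g, 'm) monoid_scheme \<Rightarrow> ('a list \<Rightarrow> 'g) monoid" where
  "fin_chains G = \<lparr>carrier = {c. range c \<subseteq> carrier G \<and> finite {xs. c xs \<noteq> \<one>\<^bsub>G\<^esub>}},
     mult = (\<lambda>c e xs. c xs \<otimes>\<^bsub>G\<^esub> e xs), one = (\<lambda>_. \<one>\<^bsub>G\<^esub>)\<rparr>"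

lemma fin_chains_simps [simp]:
  "c \<otimes>\<^bsub>fin_chains G\<^esub> e = (\<lambda>xs. c xs \<otimes>\<^bsub>G\<^esub> e xs)" "\<one>\<^bsub>fin_chains G\<^esub> = (\<lambda>_. \<one>\<^bsub>G\<^esub>)"
  by (simp_all add: fin_chains_def)

text \<open>Complex and degree enter \<open>chain_grp\<close> through the carrier alone, which is
  overwritten.\<close>

lemma chain_grp_carrier_update:
  "(chain_grp K G p)\<lparr>carrier := Z\<rparr> = (fin_chains G)\<lparr>carrier := Z\<rparr>"
  by (simp add: chain_grp_def fin_chains_def)

lemma r_coset_chain_grp: "B #>\<^bsub>chain_grp K G p\<^esub> c = B #>\<^bsub>fin_chains G\<^esub> c"
  unfolding r_coset_def by (simp add: chain_grp_def)

section \<open>Quotients of subgroups of one Abelian group\<close>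

context comm_group begin

text \<open>Restricting the carrier leaves the coset \<open>B #> z\<close> unchanged, since it
  depends only on the multiplication.\<close>

lemma carrier_Mod_subgroup: "carrier (G\<lparr>carrier := Z\<rparr> Mod B) = (#>) B ` Z"
  unfolding FactGroup_def RCOSETS_def r_coset_def by auto

lemma mult_Mod_subgroup: "X \<otimes>\<^bsub>G\<lparr>carrier := Z\<rparr> Mod B\<^esub> Y = X <#> Y"
  unfolding FactGroup_def set_mult_def by auto

lemma Mod_subgroup_closed:
  assumes "subgroup Z G" "subgroup B G"
    and "X \<in> carrier (G\<lparr>carrier := Z\<rparr> Mod B)" "Y \<in> carrier (G\<lparr>carrier := Z\<rparr> Mod B)"
  shows "X \<otimes>\<^bsub>G\<lparr>carrier := Z\<rparr> Mod B\<^esub> Y \<in> carrier (G\<lparr>carrier := Z\<rparr> Mod B)"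
proof -
  obtain x y where xy: "x \<in> Z" "X = B #> x" "y \<in> Z" "Y = B #> y"
    using assms(3,4) unfolding carrier_Mod_subgroup by blast
  have "X <#> Y = B #> (x \<otimes> y)"
    unfolding xy using xy(1,3) subgroup.subset[OF assms(1)]
    by (intro normal.rcos_sum[OF subgroup_imp_normal[OF assms(2)]]) auto
  then show ?thesis
    unfolding mult_Mod_subgroup carrier_Mod_subgroup
    using subgroup.m_closed[OF assms(1) xy(1,3)] by blast
qed

text \<open>Each \<open>b\<close> in \<open>B\<close> is absorbed by \<open>B'\<close>, so all
  representatives of a coset of \<open>B\<close> give the same coset of \<open>B'\<close>.\<close>

lemma UN_rcoset:
  assumes "subgroup B G" "subgroup B' G" "B \<subseteq> B'" "z \<in> carrier G"
  shows "(\<Union>c\<in>B #> z. B' #> c) = B' #> z"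
proof -
  have "B' #> (b \<otimes> z) = B' #> z" if "b \<in> B" for b
    using that assms subgroup.subset[OF assms(1)] subgroup.subset[OF assms(2)] coset_join2[of b B']
    by (simp add: coset_mult_assoc[symmetric] subset_iff)
  moreover have "B \<noteq> {}" using subgroup.one_closed[OF assms(1)] by blast
  ultimately show ?thesis unfolding r_coset_def[of _ B] by auto
qed

text \<open>This is the second isomorphism theorem: \<open>surj\<close> says that \<open>Z\<close>
  and \<open>B'\<close> together generate \<open>Z'\<close>, and \<open>inj\<close> that
  \<open>B\<close> is the intersection of \<open>Z\<close> and \<open>B'\<close>.\<close>

lemma mod_incl_iso:
  assumes Z: "subgroup Z G" "subgroup Z' G" "Z \<subseteq> Z'"
    and B: "subgroup B G" "subgroup B' G" "B \<subseteq> B'" "B \<subseteq> Z" "B' \<subseteq> Z'"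
    and surj: "\<And>z. z \<in> Z' \<Longrightarrow> \<exists>c\<in>Z. B' #> c = B' #> z"
    and inj: "\<And>z. z \<in> Z \<Longrightarrow> z \<in> B' \<Longrightarrow> z \<in> B"
  shows "(\<lambda>X. \<Union>c\<in>X. B' #> c) \<in> iso (G\<lparr>carrier := Z\<rparr> Mod B) (G\<lparr>carrier := Z'\<rparr> Mod B')"
proof -
  note carr = carrier_Mod_subgroup[of Z B] carrier_Mod_subgroup[of Z' B']
    and mult = mult_Mod_subgroup
  note ZG = subgroup.subset[OF Z(1)] subgroup.subset[OF Z(2)]
  note BG = subgroup.subset[OF B(1)] subgroup.subset[OF B(2)]
  interpret B: normal B G by (rule subgroup_imp_normal[OF B(1)])
  interpret B': normal B' G by (rule subgroup_imp_normal[OF B(2)])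
  have incl: "(\<Union>c\<in>B #> z. B' #> c) = B' #> z" if z: "z \<in> Z" for z
    using UN_rcoset[OF B(1-3)] z ZG by blast
  show ?thesis
  proof (rule isoI)
    show "(\<lambda>X. \<Union>c\<in>X. B' #> c) \<in> hom (G\<lparr>carrier := Z\<rparr> Mod B) (G\<lparr>carrier := Z'\<rparr> Mod B')"
    proof (rule homI)
      show "(\<Union>c\<in>X. B' #> c) \<in> carrier (G\<lparr>carrier := Z'\<rparr> Mod B')" if "X \<in> carrier (G\<lparr>carrier := Z\<rparr> Mod B)" for X
        using that incl Z(3) unfolding carr by auto
      fix X Y assume "X \<in> carrier (G\<lparr>carrier := Z\<rparr> Mod B)" "Y \<in> carrier (G\<lparr>carrier := Z\<rparr> Mod B)"
      then obtain x y where xy: "x \<in> Z" "X = B #> x" "y \<in> Z" "Y = B #> y"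
        unfolding carr by blast
      then have "x \<otimes> y \<in> Z" "x \<in> carrier G" "y \<in> carrier G"
        using Z(1) ZG by (auto simp: subgroup.m_closed)
      then show "(\<Union>c\<in>X \<otimes>\<^bsub>G\<lparr>carrier := Z\<rparr> Mod B\<^esub> Y. B' #> c) =
          (\<Union>c\<in>X. B' #> c) \<otimes>\<^bsub>G\<lparr>carrier := Z'\<rparr> Mod B'\<^esub> (\<Union>c\<in>Y. B' #> c)"
        using xy by (simp add: mult B.rcos_sum B'.rcos_sum incl)
    qed
    have inj_B: "B #> x = B #> y" if "x \<in> Z" "y \<in> Z" "B' #> x = B' #> y" for x y
    proof -
      have xy: "x \<in> carrier G" "y \<in> carrier G" using that ZG by auto
      have "B' #> (x \<otimes> inv y) = B'"
        using coset_mult_inv2[OF that(3) xy BG(2)] .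
      then have "x \<otimes> inv y \<in> B'"
        using xy by (intro coset_join1[OF _ _ B(2)]) auto
      then have "x \<otimes> inv y \<in> B"
        using that Z(1) by (intro inj) (auto simp: subgroup.m_closed subgroup.m_inv_closed)
      then have "B #> (x \<otimes> inv y) = B"
        using xy by (intro coset_join2 B(1)) auto
      then show ?thesis
        using coset_mult_inv1[OF _ xy BG(1)] by blast
    qed
    have "inj_on (\<lambda>X. \<Union>c\<in>X. B' #> c) ((#>) B ` Z)"
    proof (rule inj_onI)
      fix X Y assume "X \<in> (#>) B ` Z" "Y \<in> (#>) B ` Z"
        and eq: "(\<Union>c\<in>X. B' #> c) = (\<Union>c\<in>Y. B' #> c)"
      then obtain x y where xy: "x \<in> Z" "X = B #> x" "y \<in> Z" "Y = B #> y"
        by blast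
      have "B' #> x = B' #> y"
        using eq unfolding xy(2,4) incl[OF xy(1)] incl[OF xy(3)] .
      then show "X = Y"
        unfolding xy(2,4) by (rule inj_B[OF xy(1,3)])
    qed
    moreover have "(\<lambda>X. \<Union>c\<in>X. B' #> c) ` (#>) B ` Z = (#>) B' ` Z"
      by (simp add: image_image incl cong: image_cong)
    moreover have "(#>) B' ` Z = (#>) B' ` Z'"
    proof
      show "(#>) B' ` Z' \<subseteq> (#>) B' ` Z"
      proof (rule image_subsetI)
        fix z assume "z \<in> Z'"
        then obtain c where c: "c \<in> Z" "B' #> c = B' #> z" using surj by blast
        show "B' #> z \<in> (#>) B' ` Z" unfolding c(2)[symmetric] using c(1) by (rule imageI)
      qed
    qed (use Z(3) in blast)
    ultimately show "bij_betw (\<lambda>X. \<Union>c\<in>X. B' #> c) (carrier (G\<lparr>carrier := Z\<rparr> Mod B)) (carrier (G\<lparr>carrier := Z'\<rparr> Mod B'))"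
      unfolding bij_betw_def carr by simp
  qed
qed

lemma in_fin_chains: "c \<in> carrier (fin_chains G) \<longleftrightarrow> (\<forall>xs. c xs \<in> carrier G) \<and> finite {xs. c xs \<noteq> \<one>}"
  by (auto simp: fin_chains_def)

lemma comm_group_fin_chains: "comm_group (fin_chains G)"
proof (rule comm_groupI)
  fix c e :: "'c list \<Rightarrow> 'a"
  assume c: "c \<in> carrier (fin_chains G)" and e: "e \<in> carrier (fin_chains G)"
  have "finite {xs. c xs \<otimes> e xs \<noteq> \<one>}"
    by (rule finite_subset[of _ "{xs. c xs \<noteq> \<one>} \<union> {xs. e xs \<noteq> \<one>}"]) (use c e in \<open>auto simp: in_fin_chains\<close>)
  then show "c \<otimes>\<^bsub>fin_chains G\<^esub> e \<in> carrier (fin_chains G)"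
    using c e by (simp add: in_fin_chains)
next
  fix c :: "'c list \<Rightarrow> 'a"
  assume c: "c \<in> carrier (fin_chains G)"
  have "(\<lambda>xs. inv (c xs)) \<in> carrier (fin_chains G)"
    using c by (auto simp: in_fin_chains inv_eq_1_iff)
  moreover have "(\<lambda>xs. inv (c xs)) \<otimes>\<^bsub>fin_chains G\<^esub> c = \<one>\<^bsub>fin_chains G\<^esub>"
    using c by (simp add: in_fin_chains)
  ultimately show "\<exists>e\<in>carrier (fin_chains G). e \<otimes>\<^bsub>fin_chains G\<^esub> c = \<one>\<^bsub>fin_chains G\<^esub>"
    by blast
qed (auto simp: in_fin_chains m_ac)

end

text \<open>A name of its own for the coefficient group, so that the interpretation \<open>A\<close>
  of \<open>comm_group\<close> for chains is attached here and not to \<open>comm_group\<close>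
  itself.\<close>

locale chain_coefficients = comm_group G for G :: "('g, 'm) monoid_scheme" (structure)
begin

sublocale A: comm_group "fin_chains G :: ('a list \<Rightarrow> 'g) monoid"
  by (rule comm_group_fin_chains)

lemma inv_fin_chains:
  assumes "c \<in> carrier (fin_chains G)"
  shows "inv\<^bsub>fin_chains G\<^esub> c = (\<lambda>xs. inv (c xs))"
proof -
  have "(\<lambda>xs. inv (c xs)) \<in> carrier (fin_chains G)"
    using assms by (auto simp: in_fin_chains inv_eq_1_iff)
  then show ?thesis
    using assms by (intro A.inv_equality) (auto simp: in_fin_chains)
qed

lemma simplicial_chains_iff:
  "c \<in> simplicial_chains K G p \<longleftrightarrow> c \<in> carrier (fin_chains G) \<and>
     (\<forall>xs. c xs \<noteq> \<one> \<longrightarrow> length xs = Suc p \<and> distinct xs \<and> set xs \<in> K) \<and>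
     (\<forall>us v w ws. c (us @ w # v # ws) = inv c (us @ v # w # ws))"
  unfolding simplicial_chains_def in_fin_chains image_subset_iff by blast

lemma simplicial_chains_subset: "simplicial_chains K G p \<subseteq> carrier (fin_chains G)"
  using simplicial_chains_iff by blast

lemma subgroup_simplicial_chains: "subgroup (simplicial_chains K G p) (fin_chains G)"
proof (rule A.subgroupI)
  show "simplicial_chains K G p \<subseteq> carrier (fin_chains G)"
    by (rule simplicial_chains_subset)
  have "(\<lambda>_. \<one>) \<in> simplicial_chains K G p"
    by (simp add: simplicial_chains_iff in_fin_chains)
  then show "simplicial_chains K G p \<noteq> {}" by blast
  fix c assume c: "c \<in> simplicial_chains K G p"
  then have cA: "c \<in> carrier (fin_chains G)"
    using simplicial_chains_subset by blast
  then have cG: "c xs \<in> carrier G" for xs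
    by (simp add: in_fin_chains)
  have alt: "c (us @ w # v # ws) = inv c (us @ v # w # ws)" for us v w ws
    using c unfolding simplicial_chains_iff by blast
  have sc: "length xs = Suc p \<and> distinct xs \<and> set xs \<in> K" if "c xs \<noteq> \<one>" for xs
    using c that unfolding simplicial_chains_iff by blast
  have inv: "inv\<^bsub>fin_chains G\<^esub> c = (\<lambda>xs. inv (c xs))"
    by (rule inv_fin_chains[OF cA])
  show "inv\<^bsub>fin_chains G\<^esub> c \<in> simplicial_chains K G p"
    unfolding simplicial_chains_iff
  proof (intro conjI allI impI)
    show "inv\<^bsub>fin_chains G\<^esub> c \<in> carrier (fin_chains G)" using cA by simp
    show "length xs = Suc p" "distinct xs" "set xs \<in> K" if "(inv\<^bsub>fin_chains G\<^esub> c) xs \<noteq> \<one>" for xs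
      using sc[of xs] that cG[of xs] unfolding inv by auto
    show "(inv\<^bsub>fin_chains G\<^esub> c) (us @ w # v # ws) = inv ((inv\<^bsub>fin_chains G\<^esub> c) (us @ v # w # ws))" for us v w ws
      unfolding inv by (rule arg_cong[OF alt])
  qed
  fix e assume e: "e \<in> simplicial_chains K G p"
  then have eA: "e \<in> carrier (fin_chains G)"
    using simplicial_chains_subset by blast
  then have eG: "e xs \<in> carrier G" for xs
    by (simp add: in_fin_chains)
  have alt': "e (us @ w # v # ws) = inv e (us @ v # w # ws)" for us v w ws
    using e unfolding simplicial_chains_iff by blast
  have sc': "length xs = Suc p \<and> distinct xs \<and> set xs \<in> K" if "e xs \<noteq> \<one>" for xs
    using e that unfolding simplicial_chains_iff by blast
  show "c \<otimes>\<^bsub>fin_chains G\<^esub> e \<in> simplicial_chains K G p"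
    unfolding simplicial_chains_iff
  proof (intro conjI allI impI)
    show "c \<otimes>\<^bsub>fin_chains G\<^esub> e \<in> carrier (fin_chains G)" using cA eA by (rule A.m_closed)
    fix xs assume "(c \<otimes>\<^bsub>fin_chains G\<^esub> e) xs \<noteq> \<one>"
    then have "c xs \<noteq> \<one> \<or> e xs \<noteq> \<one>" by auto
    then have "length xs = Suc p \<and> distinct xs \<and> set xs \<in> K" using sc sc' by blast
    then show "length xs = Suc p" "distinct xs" "set xs \<in> K" by blast+
  next
    show "(c \<otimes>\<^bsub>fin_chains G\<^esub> e) (us @ w # v # ws) = inv ((c \<otimes>\<^bsub>fin_chains G\<^esub> e) (us @ v # w # ws))" for us v w ws
      \<comment> \<open>The sign rule survives products because inversion is multiplicative in a
        commutative group.\<close>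
      unfolding fin_chains_simps alt[of us w v ws] alt'[of us w v ws]
      using cG eG by (simp add: inv_mult)
  qed
qed

text \<open>The index set in \<open>bdry\<close> depends on the chain; enlarging it allows several
  chains to be summed over a common set.\<close>

lemma bdry_eq:
  assumes "\<And>xs. c xs \<in> carrier G" "finite S" "\<And>v. c (v # vs) \<noteq> \<one> \<Longrightarrow> v \<in> S" "vs \<noteq> []"
  shows "bdry G c vs = finprod G (\<lambda>v. c (v # vs)) S"
  unfolding bdry_def using assms
  by (auto intro!: finprod_mono_neutral_cong_left)

lemma finite_cone_support:
  assumes "c \<in> carrier (fin_chains G)"
  shows "finite {v. c (v # vs) \<noteq> \<one>}"
proof (rule finite_imageD)
  show "finite ((\<lambda>v. v # vs) ` {v. c (v # vs) \<noteq> \<one>})"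
    by (rule finite_subset[of _ "{xs. c xs \<noteq> \<one>}"]) (use assms in \<open>auto simp: in_fin_chains\<close>)
qed (simp add: inj_on_def)

lemma bdry_mult:
  assumes "c \<in> carrier (fin_chains G)" "e \<in> carrier (fin_chains G)"
  shows "bdry G (c \<otimes>\<^bsub>fin_chains G\<^esub> e) = bdry G c \<otimes>\<^bsub>fin_chains G\<^esub> bdry G e"
proof
  fix vs
  show "bdry G (c \<otimes>\<^bsub>fin_chains G\<^esub> e) vs = (bdry G c \<otimes>\<^bsub>fin_chains G\<^esub> bdry G e) vs"
  proof (cases "vs = []")
    case False
    let ?S = "{v. c (v # vs) \<noteq> \<one>} \<union> {v. e (v # vs) \<noteq> \<one>}"
    have ce: "c xs \<in> carrier G" "e xs \<in> carrier G" for xs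
      using assms by (auto simp: in_fin_chains)
    have S: "finite ?S" using assms finite_cone_support by blast
    have "bdry G (c \<otimes>\<^bsub>fin_chains G\<^esub> e) vs = finprod G (\<lambda>v. c (v # vs) \<otimes> e (v # vs)) ?S"
      by (subst bdry_eq[of _ ?S]) (use S ce False in auto)
    also have "\<dots> = finprod G (\<lambda>v. c (v # vs)) ?S \<otimes> finprod G (\<lambda>v. e (v # vs)) ?S"
      using ce by (intro finprod_multf) auto
    also have "\<dots> = bdry G c vs \<otimes> bdry G e vs"
      by (subst (1 2) bdry_eq[of _ ?S]) (use S ce False in auto)
    finally show ?thesis by simp
  qed (simp add: bdry_def)
qed

lemma bdry_one: "bdry G (\<lambda>_. \<one>) = (\<lambda>_. \<one>)"
  by (auto simp: bdry_def fun_eq_iff)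

lemma bdry_closed:
  assumes c: "c \<in> carrier (fin_chains G)"
  shows "bdry G c \<in> carrier (fin_chains G)"
proof -
  have "bdry G c vs \<in> carrier G" for vs
    unfolding bdry_def using c by (auto simp: in_fin_chains intro!: finprod_closed)
  moreover have "{vs. bdry G c vs \<noteq> \<one>} \<subseteq> tl ` {xs. c xs \<noteq> \<one>}"
  proof
    fix vs assume "vs \<in> {vs. bdry G c vs \<noteq> \<one>}"
    then have "{v. c (v # vs) \<noteq> \<one>} \<noteq> {}"
      by (intro notI) (simp add: bdry_def split: if_splits)
    then show "vs \<in> tl ` {xs. c xs \<noteq> \<one>}" by (auto intro: rev_image_eqI)
  qed
  then have "finite {vs. bdry G c vs \<noteq> \<one>}"
    by (rule finite_surj[rotated]) (use c in \<open>simp add: in_fin_chains\<close>)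
  ultimately show ?thesis by (simp add: in_fin_chains)
qed

end

text \<open>The oriented edge from \<open>u\<close> to \<open>v\<close> with coefficient
  \<open>g\<close>. It is trivial for \<open>u = v\<close>, so repeated letters of a word contribute
  nothing.\<close>

definition edge_chain :: "('g, 'm) monoid_scheme \<Rightarrow> 'g \<Rightarrow> 'a \<Rightarrow> 'a \<Rightarrow> 'a list \<Rightarrow> 'g" where
  "edge_chain G g u v xs =
     (if u \<noteq> v \<and> xs = [u, v] then g else if u \<noteq> v \<and> xs = [v, u] then inv\<^bsub>G\<^esub> g else \<one>\<^bsub>G\<^esub>)"

text \<open>For distinct vertices, even orderings carry \<open>g\<close> and odd ones its
  inverse.\<close>

definition triangle_chain :: "('g, 'm) monoid_scheme \<Rightarrow> 'g \<Rightarrow> 'a \<Rightarrow> 'a \<Rightarrow> 'a \<Rightarrow> 'a list \<Rightarrow> 'g" where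
  "triangle_chain G g u v w xs =
     (if xs \<in> {[u, v, w], [v, w, u], [w, u, v]} then g
      else if xs \<in> {[v, u, w], [u, w, v], [w, v, u]} then inv\<^bsub>G\<^esub> g else \<one>\<^bsub>G\<^esub>)"

text \<open>The 1-chain traced out by an edge path, with coefficient \<open>g\<close> on every step:
  the Hurewicz map at the level of words.\<close>

fun word_chain :: "('g, 'm) monoid_scheme \<Rightarrow> 'g \<Rightarrow> 'a list \<Rightarrow> 'a list \<Rightarrow> 'g" where
  "word_chain G g [] = (\<lambda>_. \<one>\<^bsub>G\<^esub>)"
| "word_chain G g [u] = (\<lambda>_. \<one>\<^bsub>G\<^esub>)"
| "word_chain G g (u # v # xs) = edge_chain G g u v \<otimes>\<^bsub>fin_chains G\<^esub> word_chain G g (v # xs)"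

section \<open>Generators of the chains in degrees one and two\<close>

context chain_coefficients begin

lemma edge_chain_simplicial:
  assumes "g \<in> carrier G" "{u, v} \<in> K"
  shows "edge_chain G g u v \<in> simplicial_chains K G (Suc 0)"
  unfolding simplicial_chains_def
proof (intro CollectI conjI allI impI)
  show "range (edge_chain G g u v) \<subseteq> carrier G"
    using assms by (auto simp: edge_chain_def)
  show "finite {xs. edge_chain G g u v xs \<noteq> \<one>}"
    by (rule finite_subset[of _ "{[u, v], [v, u]}"]) (auto simp: edge_chain_def)
  show "length xs = Suc (Suc 0)" "distinct xs" "set xs \<in> K" if "edge_chain G g u v xs \<noteq> \<one>" for xs
    using that assms by (auto simp: edge_chain_def insert_commute split: if_splits)
  fix us x y ws
  show "edge_chain G g u v (us @ y # x # ws) = inv edge_chain G g u v (us @ x # y # ws)"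
  proof (cases "us = [] \<and> ws = []")
    case True
    then show ?thesis using assms by (auto simp: edge_chain_def)
  next
    case False
    then have "length (us @ y # x # ws) \<noteq> 2" "length (us @ x # y # ws) \<noteq> 2"
      by (auto simp: neq_Nil_conv)
    moreover have "edge_chain G g u v ys = \<one>" if "length ys \<noteq> 2" for ys
      using that by (auto simp: edge_chain_def)
    ultimately show ?thesis by simp
  qed
qed

lemma edge_chain_closed: "g \<in> carrier G \<Longrightarrow> edge_chain G g u v \<in> carrier (fin_chains G)"
  using edge_chain_simplicial[of g u v "{{u, v}}"] simplicial_chains_subset by blast

lemma triangle_chain_support:
  assumes "triangle_chain G g u v w xs \<noteq> \<one>"
  shows "xs \<in> {[u, v, w], [v, w, u], [w, u, v], [v, u, w], [u, w, v], [w, v, u]}"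
  using assms by (rule contrapos_np) (simp add: triangle_chain_def)

text \<open>A transposition exchanges even and odd orderings; a list of length three has just these
  two adjacent ones.\<close>

lemma triangle_chain_swap:
  assumes "g \<in> carrier G" "distinct [u, v, w]"
  shows "triangle_chain G g u v w [b, a, c] = inv triangle_chain G g u v w [a, b, c]"
    and "triangle_chain G g u v w [a, c, b] = inv triangle_chain G g u v w [a, b, c]"
proof -
  let ?A = "{[u, v, w], [v, w, u], [w, u, v]}" and ?B = "{[v, u, w], [u, w, v], [w, v, u]}"
  have swap: "[b, a, c] \<in> ?A \<longleftrightarrow> [a, b, c] \<in> ?B" "[b, a, c] \<in> ?B \<longleftrightarrow> [a, b, c] \<in> ?A"
      "[a, c, b] \<in> ?A \<longleftrightarrow> [a, b, c] \<in> ?B" "[a, c, b] \<in> ?B \<longleftrightarrow> [a, b, c] \<in> ?A"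
    by (simp_all only: insert_iff empty_iff list.inject) blast+
  \<comment> \<open>\<open>triangle_chain\<close> tests the even orderings first, so the case split
    needs that none of them is odd.\<close>
  have disj: "[a, b, c] \<in> ?A \<Longrightarrow> [a, b, c] \<notin> ?B"
    using assms(2) by auto
  have inv: "inv \<one> = \<one>" "inv (inv g) = g" using assms(1) by simp_all
  show "triangle_chain G g u v w [b, a, c] = inv triangle_chain G g u v w [a, b, c]"
    and "triangle_chain G g u v w [a, c, b] = inv triangle_chain G g u v w [a, b, c]"
    unfolding triangle_chain_def swap
    by (cases "[a, b, c] \<in> ?A"; cases "[a, b, c] \<in> ?B"; use disj in \<open>simp only: if_True if_False inv not_True_eq_False\<close>)+
qed

lemma triangle_chain_simplicial:
  assumes "g \<in> carrier G" "{u, v, w} \<in> K" "distinct [u, v, w]"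
  shows "triangle_chain G g u v w \<in> simplicial_chains K G (Suc (Suc 0))"
  unfolding simplicial_chains_def
proof (intro CollectI conjI allI impI)
  show "range (triangle_chain G g u v w) \<subseteq> carrier G"
    using assms by (auto simp: triangle_chain_def)
  have "{xs. triangle_chain G g u v w xs \<noteq> \<one>} \<subseteq>
      {[u, v, w], [v, w, u], [w, u, v], [v, u, w], [u, w, v], [w, v, u]}"
    by (rule subsetI, rule triangle_chain_support[of g]) (rule CollectD)
  then show "finite {xs. triangle_chain G g u v w xs \<noteq> \<one>}"
    by (rule finite_subset) simp
  fix xs assume "triangle_chain G g u v w xs \<noteq> \<one>"
  then have "xs \<in> {[u, v, w], [v, w, u], [w, u, v], [v, u, w], [u, w, v], [w, v, u]}"
    by (rule triangle_chain_support)
  then have "length xs = Suc (Suc (Suc 0)) \<and> distinct xs \<and> set xs = {u, v, w}"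
    using assms(3) by (elim insertE emptyE) (auto simp: insert_commute)
  then show "length xs = Suc (Suc (Suc 0))" "distinct xs" "set xs \<in> K"
    using assms(2) by simp_all
next
  fix us x y ws
  show "triangle_chain G g u v w (us @ y # x # ws) = inv triangle_chain G g u v w (us @ x # y # ws)"
  proof (cases "length us + length ws = 1")
    case True
    then consider z where "us = []" "ws = [z]" | z where "us = [z]" "ws = []"
      by (cases us; cases ws) auto
    then show ?thesis
    proof cases
      case 1
      show ?thesis unfolding 1 append.simps by (rule triangle_chain_swap(1)[OF assms(1,3)])
    next
      case 2
      show ?thesis unfolding 2 append.simps by (rule triangle_chain_swap(2)[OF assms(1,3)])
    qed
  next
    case False
    then have "length (us @ y # x # ws) \<noteq> 3" "length (us @ x # y # ws) \<noteq> 3"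
      by auto
    moreover have "triangle_chain G g u v w ys = \<one>" if "length ys \<noteq> 3" for ys
      using that by (auto simp: triangle_chain_def)
    ultimately show ?thesis by simp
  qed
qed

text \<open>At a list in the support of \<open>c\<close> the chain \<open>e\<close> agrees with
  \<open>c\<close>, and elsewhere it is trivial or agrees too. Dividing \<open>c\<close> by
  \<open>e\<close> therefore shrinks the support strictly, and induction on its size
  applies.\<close>

lemma chains_generated:
  assumes c: "c \<in> simplicial_chains K G p"
    and H: "(\<lambda>_. \<one>) \<in> H" "\<And>c e. c \<in> H \<Longrightarrow> e \<in> H \<Longrightarrow> c \<otimes>\<^bsub>fin_chains G\<^esub> e \<in> H"
    and gen: "\<And>c xs. c \<in> simplicial_chains K G p \<Longrightarrow> c xs \<noteq> \<one> \<Longrightarrow>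
      \<exists>e\<in>H \<inter> simplicial_chains K G p. e xs = c xs \<and> (\<forall>ys. e ys = c ys \<or> e ys = \<one>)"
  shows "c \<in> H"
  using c
proof (induction "card {xs. c xs \<noteq> \<one>}" arbitrary: c rule: less_induct)
  case less
  show ?case
  proof (cases "\<exists>xs. c xs \<noteq> \<one>")
    case False
    then have "c = (\<lambda>_. \<one>)" by auto
    then show ?thesis using H(1) by simp
  next
    case True
    then obtain xs where xs: "c xs \<noteq> \<one>" ..
    then obtain e where e: "e \<in> H" "e \<in> simplicial_chains K G p" "e xs = c xs"
        "\<And>ys. e ys = c ys \<or> e ys = \<one>"
      using gen[OF less.prems] by blast
    have ce: "c \<in> carrier (fin_chains G)" "e \<in> carrier (fin_chains G)"
      using less.prems e(2) simplicial_chains_subset by blast+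
    define c' where "c' = inv\<^bsub>fin_chains G\<^esub> e \<otimes>\<^bsub>fin_chains G\<^esub> c"
    have c'_eq: "c' = (\<lambda>ys. inv (e ys) \<otimes> c ys)"
      using ce by (simp add: c'_def inv_fin_chains)
    have "c' \<in> simplicial_chains K G p"
      unfolding c'_def using less.prems e(2) subgroup_simplicial_chains[of K p]
      by (meson subgroup.m_closed subgroup.m_inv_closed)
    moreover have "{ys. c' ys \<noteq> \<one>} \<subset> {ys. c ys \<noteq> \<one>}"
    proof
      show "{ys. c' ys \<noteq> \<one>} \<subseteq> {ys. c ys \<noteq> \<one>}"
      proof clarify
        fix ys assume "c' ys \<noteq> \<one>" "c ys = \<one>"
        then show False using e(4)[of ys] by (auto simp: c'_eq)
      qed
      have "c' xs = \<one>" using ce by (simp add: c'_eq e(3) in_fin_chains)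
      then show "{ys. c' ys \<noteq> \<one>} \<noteq> {ys. c ys \<noteq> \<one>}" using xs by blast
    qed
    then have "card {ys. c' ys \<noteq> \<one>} < card {ys. c ys \<noteq> \<one>}"
      using ce by (intro psubset_card_mono) (auto simp: in_fin_chains)
    ultimately have "c' \<in> H" by (intro less.hyps)
    moreover have "c = e \<otimes>\<^bsub>fin_chains G\<^esub> c'"
      unfolding c'_def using ce by (subst A.m_assoc[symmetric]) (auto simp del: fin_chains_simps)
    ultimately show ?thesis using H(2) e(1) by metis
  qed
qed

text \<open>Serves as an induction principle: \<open>H\<close> will be the set of chains with some
  property stable under products. The sign rule makes one coefficient determine both orderings of an
  edge.\<close>

lemma edge_chains_generate:
  assumes c: "c \<in> simplicial_chains K G (Suc 0)"
    and H: "(\<lambda>_. \<one>) \<in> H" "\<And>c e. c \<in> H \<Longrightarrow> e \<in> H \<Longrightarrow> c \<otimes>\<^bsub>fin_chains G\<^esub> e \<in> H"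
    and gen: "\<And>g u v. g \<in> carrier G \<Longrightarrow> {u, v} \<in> K \<Longrightarrow> u \<noteq> v \<Longrightarrow> edge_chain G g u v \<in> H"
  shows "c \<in> H"
proof (rule chains_generated[OF c H])
  fix c xs assume c: "c \<in> simplicial_chains K G (Suc 0)" and xs: "c xs \<noteq> \<one>"
  then have "length xs = Suc (Suc 0)" "distinct xs" "set xs \<in> K"
    unfolding simplicial_chains_def by blast+
  then obtain u v where uv: "xs = [u, v]" "u \<noteq> v" "{u, v} \<in> K"
    by (auto simp: length_Suc_conv)
  have g: "c xs \<in> carrier G" using c by (auto simp: simplicial_chains_def)
  have "c ([] @ v # u # []) = inv c ([] @ u # v # [])"
    using c unfolding simplicial_chains_def by blast
  then have "\<forall>ys. edge_chain G (c xs) u v ys = c ys \<or> edge_chain G (c xs) u v ys = \<one>"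
    using uv by (simp add: edge_chain_def)
  then show "\<exists>e\<in>H \<inter> simplicial_chains K G (Suc 0). e xs = c xs \<and> (\<forall>ys. e ys = c ys \<or> e ys = \<one>)"
    using uv gen[OF g uv(3,2)] edge_chain_simplicial[OF g uv(3)]
    by (intro bexI[of _ "edge_chain G (c xs) u v"]) (auto simp: edge_chain_def)
qed

text \<open>Adjacent transpositions reach all six orderings from one, so a single coefficient
  determines \<open>c\<close> on the whole triangle.\<close>

lemma triangle_chains_generate:
  assumes c: "c \<in> simplicial_chains K G (Suc (Suc 0))"
    and H: "(\<lambda>_. \<one>) \<in> H" "\<And>c e. c \<in> H \<Longrightarrow> e \<in> H \<Longrightarrow> c \<otimes>\<^bsub>fin_chains G\<^esub> e \<in> H"
    and gen: "\<And>g u v w. g \<in> carrier G \<Longrightarrow> {u, v, w} \<in> K \<Longrightarrow> distinct [u, v, w] \<Longrightarrow> triangle_chain G g u v w \<in> H"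
  shows "c \<in> H"
proof (rule chains_generated[OF c H])
  fix c xs assume c: "c \<in> simplicial_chains K G (Suc (Suc 0))" and xs: "c xs \<noteq> \<one>"
  then have "length xs = Suc (Suc (Suc 0))" "distinct xs" "set xs \<in> K"
    unfolding simplicial_chains_def by blast+
  then obtain u v w where uvw: "xs = [u, v, w]" "distinct [u, v, w]" "{u, v, w} \<in> K"
    by (auto simp: length_Suc_conv)
  have cG: "c ys \<in> carrier G" for ys using c by (auto simp: simplicial_chains_def)
  have alt: "c (us @ y # x # ws) = inv c (us @ x # y # ws)" for us x y ws
    using c unfolding simplicial_chains_def by blast
  have "c [v, u, w] = inv c xs" "c [u, w, v] = inv c xs"
    using alt[of "[]" v u "[w]"] alt[of "[u]" w v "[]"] uvw(1) by auto
  moreover from this have "c [v, w, u] = c xs" "c [w, u, v] = c xs"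
    using alt[of "[v]" w u "[]"] alt[of "[]" w u "[v]"] cG by auto
  moreover from this have "c [w, v, u] = inv c xs"
    using alt[of "[]" w v "[u]"] by auto
  ultimately have "\<forall>ys. triangle_chain G (c xs) u v w ys = c ys \<or> triangle_chain G (c xs) u v w ys = \<one>"
    using uvw(1) by (auto simp: triangle_chain_def)
  moreover have "triangle_chain G (c xs) u v w xs = c xs"
    using uvw(1) by (simp add: triangle_chain_def)
  ultimately show "\<exists>e\<in>H \<inter> simplicial_chains K G (Suc (Suc 0)). e xs = c xs \<and> (\<forall>ys. e ys = c ys \<or> e ys = \<one>)"
    using gen[OF cG uvw(3,2)] triangle_chain_simplicial[OF cG uvw(3,2)] by blast
qed

lemma bdry_edge_chain:
  assumes "g \<in> carrier G" "u \<noteq> v"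
  shows "bdry G (edge_chain G g u v) xs = (if xs = [v] then g else if xs = [u] then inv g else \<one>)"
proof (cases "xs = []")
  case False
  have cl: "edge_chain G g u v ys \<in> carrier G" for ys
    using assms by (simp add: edge_chain_def)
  have "bdry G (edge_chain G g u v) xs = finprod G (\<lambda>x. edge_chain G g u v (x # xs)) {u, v}"
    by (rule bdry_eq) (use cl False in \<open>auto simp: edge_chain_def split: if_splits\<close>)
  also have "\<dots> = edge_chain G g u v (u # xs) \<otimes> edge_chain G g u v (v # xs)"
    using assms(2) cl by (simp add: finprod_insert)
  finally show ?thesis
    using assms by (auto simp: edge_chain_def)
qed (simp add: bdry_def)

text \<open>Prepending the missing vertex to a side, as in \<open>[w, u, v]\<close>, gives a cyclic
  rotation of \<open>[u, v, w]\<close>; hence all three sides carry \<open>g\<close>.\<close>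

lemma bdry_triangle_chain:
  assumes g: "g \<in> carrier G" and uvw: "distinct [u, v, w]"
  shows "bdry G (triangle_chain G g u v w) =
    edge_chain G g u v \<otimes>\<^bsub>fin_chains G\<^esub> (edge_chain G g v w \<otimes>\<^bsub>fin_chains G\<^esub> edge_chain G g w u)"
proof
  fix xs
  show "bdry G (triangle_chain G g u v w) xs = (edge_chain G g u v \<otimes>\<^bsub>fin_chains G\<^esub>
      (edge_chain G g v w \<otimes>\<^bsub>fin_chains G\<^esub> edge_chain G g w u)) xs"
  proof (cases "xs = []")
    case False
    have cl: "triangle_chain G g u v w ys \<in> carrier G" for ys
      using g by (simp add: triangle_chain_def)
    have "bdry G (triangle_chain G g u v w) xs = finprod G (\<lambda>x. triangle_chain G g u v w (x # xs)) {u, v, w}"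
      by (rule bdry_eq) (use cl False in \<open>auto simp: triangle_chain_def split: if_splits\<close>)
    also have "\<dots> = triangle_chain G g u v w (u # xs) \<otimes>
        (triangle_chain G g u v w (v # xs) \<otimes> triangle_chain G g u v w (w # xs))"
      using uvw cl by (simp add: finprod_insert)
    also have "\<dots> = edge_chain G g u v xs \<otimes> (edge_chain G g v w xs \<otimes> edge_chain G g w u xs)"
      using uvw g by (auto simp: triangle_chain_def edge_chain_def)
    finally show ?thesis by simp
  qed (use g in \<open>simp add: bdry_def edge_chain_def\<close>)
qed

end

section \<open>First homology of a subdivided complex\<close>

text \<open>\<open>subdivide\<close> sends \<open>[u, v]\<close> to \<open>[u, m u v] + [m u v, v]\<close>. The two factors at \<open>[x, y]\<close> collect the edges
  starting in \<open>x\<close> with midpoint \<open>y\<close> and, reversed, those starting in \<open>y\<close> with midpoint \<open>x\<close>; for symmetric \<open>m\<close>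
  this makes the choice of an orientation of each edge unnecessary.\<close>

definition half_edge_sum ::
  "('g, 'm) monoid_scheme \<Rightarrow> ('a \<Rightarrow> 'a \<Rightarrow> 'a) \<Rightarrow> ('a list \<Rightarrow> 'g) \<Rightarrow> 'a \<Rightarrow> 'a \<Rightarrow> 'g" where
  "half_edge_sum G m c x y =
     finprod G (\<lambda>v. if m x v = y then c [x, v] else \<one>\<^bsub>G\<^esub>) {v. c [x, v] \<noteq> \<one>\<^bsub>G\<^esub>}"

definition subdivide ::
  "('g, 'm) monoid_scheme \<Rightarrow> ('a \<Rightarrow> 'a \<Rightarrow> 'a) \<Rightarrow> ('a list \<Rightarrow> 'g) \<Rightarrow> 'a list \<Rightarrow> 'g" where
  "subdivide G m c xs =
     (case xs of [x, y] \<Rightarrow> half_edge_sum G m c x y \<otimes>\<^bsub>G\<^esub> inv\<^bsub>G\<^esub> half_edge_sum G m c y x | _ \<Rightarrow> \<one>\<^bsub>G\<^esub>)"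

context chain_coefficients begin

lemma half_edge_sum_eq:
  assumes "\<And>xs. c xs \<in> carrier G" "finite S" "\<And>v. c [x, v] \<noteq> \<one> \<Longrightarrow> v \<in> S"
  shows "half_edge_sum G m c x y = finprod G (\<lambda>v. if m x v = y then c [x, v] else \<one>) S"
  unfolding half_edge_sum_def using assms
  by (intro finprod_mono_neutral_cong_left) auto

lemma half_edge_sum_closed:
  "(\<And>xs. c xs \<in> carrier G) \<Longrightarrow> half_edge_sum G m c x y \<in> carrier G"
  unfolding half_edge_sum_def by (rule finprod_closed) auto

lemma finite_half_edge_support:
  assumes "c \<in> carrier (fin_chains G)"
  shows "finite {v. c [x, v] \<noteq> \<one>}"
proof (rule finite_imageD)
  show "finite ((\<lambda>v. [x, v]) ` {v. c [x, v] \<noteq> \<one>})"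
    by (rule finite_subset[of _ "{xs. c xs \<noteq> \<one>}"]) (use assms in \<open>auto simp: in_fin_chains\<close>)
qed (simp add: inj_on_def)

lemma half_edge_sum_mult:
  assumes "c \<in> carrier (fin_chains G)" "e \<in> carrier (fin_chains G)"
  shows "half_edge_sum G m (c \<otimes>\<^bsub>fin_chains G\<^esub> e) x y =
    half_edge_sum G m c x y \<otimes> half_edge_sum G m e x y"
proof -
  let ?S = "{v. c [x, v] \<noteq> \<one>} \<union> {v. e [x, v] \<noteq> \<one>}"
  have ce: "c xs \<in> carrier G" "e xs \<in> carrier G" for xs
    using assms by (auto simp: in_fin_chains)
  have S: "finite ?S" using assms[THEN finite_half_edge_support] by simp
  have "half_edge_sum G m (c \<otimes>\<^bsub>fin_chains G\<^esub> e) x y =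
      finprod G (\<lambda>v. if m x v = y then c [x, v] \<otimes> e [x, v] else \<one>) ?S"
    unfolding fin_chains_simps by (subst half_edge_sum_eq[of _ ?S]) (use S ce in auto)
  also have "\<dots> = finprod G (\<lambda>v. (if m x v = y then c [x, v] else \<one>) \<otimes> (if m x v = y then e [x, v] else \<one>)) ?S"
    using ce by (intro finprod_cong') auto
  also have "\<dots> = finprod G (\<lambda>v. if m x v = y then c [x, v] else \<one>) ?S \<otimes>
      finprod G (\<lambda>v. if m x v = y then e [x, v] else \<one>) ?S"
    using ce by (intro finprod_multf) auto
  also have "\<dots> = half_edge_sum G m c x y \<otimes> half_edge_sum G m e x y"
    by (subst (1 2) half_edge_sum_eq[of _ ?S]) (use S ce in auto)
  finally show ?thesis .
qed

lemma subdivide_mult: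
  assumes "c \<in> carrier (fin_chains G)" "e \<in> carrier (fin_chains G)"
  shows "subdivide G m (c \<otimes>\<^bsub>fin_chains G\<^esub> e) = subdivide G m c \<otimes>\<^bsub>fin_chains G\<^esub> subdivide G m e"
proof
  have cl: "half_edge_sum G m c x y \<in> carrier G" "half_edge_sum G m e x y \<in> carrier G" for x y
    using assms by (auto intro!: half_edge_sum_closed simp: in_fin_chains)
  have "half_edge_sum G m c x y \<otimes> half_edge_sum G m e x y \<otimes>
      inv (half_edge_sum G m c y x \<otimes> half_edge_sum G m e y x) =
      half_edge_sum G m c x y \<otimes> inv half_edge_sum G m c y x \<otimes>
      (half_edge_sum G m e x y \<otimes> inv half_edge_sum G m e y x)" for x y
    using cl by (simp add: inv_mult m_ac)
  then show "subdivide G m (c \<otimes>\<^bsub>fin_chains G\<^esub> e) xs = (subdivide G m c \<otimes>\<^bsub>fin_chains G\<^esub> subdivide G m e) xs" for xs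
    unfolding subdivide_def half_edge_sum_mult[OF assms] by (auto split: list.split)
qed

lemma subdivide_one: "subdivide G m (\<lambda>_. \<one>) = (\<lambda>_. \<one>)"
  by (auto simp: subdivide_def half_edge_sum_def fun_eq_iff split: list.split)

text \<open>The half sums are \<open>g\<close> at \<open>u, z\<close> and \<open>inv g\<close> at
  \<open>v, z\<close>. As \<open>z\<close> differs from \<open>u\<close> and \<open>v\<close>, none
  starts in \<open>z\<close>; so \<open>[u, z]\<close> receives \<open>g\<close> from the first
  factor and \<open>[z, v]\<close> receives \<open>g\<close> from the inverted one.\<close>

lemma subdivide_edge_chain:
  assumes g: "g \<in> carrier G" and uv: "u \<noteq> v" and m: "m u v = z" "m v u = z" "z \<noteq> u" "z \<noteq> v"
  shows "subdivide G m (edge_chain G g u v) =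
    edge_chain G g u z \<otimes>\<^bsub>fin_chains G\<^esub> edge_chain G g z v"
proof
  have cl: "edge_chain G g u v ys \<in> carrier G" for ys
    using g by (simp add: edge_chain_def)
  have half: "half_edge_sum G m (edge_chain G g u v) x y =
      (if x = u \<and> y = z then g else if x = v \<and> y = z then inv g else \<one>)" for x y
  proof -
    have "half_edge_sum G m (edge_chain G g u v) x y =
        finprod G (\<lambda>w. if m x w = y then edge_chain G g u v [x, w] else \<one>) {u, v}"
      by (rule half_edge_sum_eq) (use cl in \<open>auto simp: edge_chain_def split: if_splits\<close>)
    also have "\<dots> = (if m x u = y then edge_chain G g u v [x, u] else \<one>) \<otimes>
        (if m x v = y then edge_chain G g u v [x, v] else \<one>)"
      using uv cl by (simp add: finprod_insert)
    also have "\<dots> = (if x = u \<and> y = z then g else if x = v \<and> y = z then inv g else \<one>)"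
      using uv g m by (auto simp: edge_chain_def)
    finally show ?thesis .
  qed
  fix xs
  show "subdivide G m (edge_chain G g u v) xs =
      (edge_chain G g u z \<otimes>\<^bsub>fin_chains G\<^esub> edge_chain G g z v) xs"
    unfolding subdivide_def half
    using uv g m by (auto simp: edge_chain_def split: list.split)
qed

lemma edge_chain_same: "edge_chain G g u u = (\<lambda>_. \<one>)"
  by (simp add: edge_chain_def fun_eq_iff)

lemma edge_chain_swap:
  assumes "g \<in> carrier G"
  shows "inv\<^bsub>fin_chains G\<^esub> edge_chain G g u v = edge_chain G g v u"
  using assms by (auto simp: inv_fin_chains[OF edge_chain_closed] edge_chain_def fun_eq_iff)

end

text \<open>From here on chains are handled by the group laws of \<open>A\<close>, which unfolding
  products into values would block.\<close>

declare fin_chains_simps [simp del]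

context chain_coefficients begin

lemma fin_chains_one: "\<one>\<^bsub>fin_chains G\<^esub> = (\<lambda>_. \<one>)"
  by (rule fin_chains_simps)

lemma word_chain_closed: "g \<in> carrier G \<Longrightarrow> word_chain G g xs \<in> carrier (fin_chains G)"
  by (induction xs rule: induct_list012) (simp_all add: fin_chains_one[symmetric] edge_chain_closed)

lemma group_hom_bdry: "group_hom (fin_chains G :: ('a list \<Rightarrow> 'g) monoid) (fin_chains G) (bdry G)"
  by (intro group_hom.intro group_hom_axioms.intro homI A.is_group bdry_closed bdry_mult)

text \<open>Both claims are stable under products, so triangles suffice; there each vertex ends one
  side and starts another, and the coefficients cancel.\<close>

lemma bdry_simplicial_chains:
  assumes K: "abstract_complex K" and t: "t \<in> simplicial_chains K G (Suc (Suc 0))"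
  shows "bdry G t \<in> simplicial_chains K G (Suc 0)" "bdry G (bdry G t) = (\<lambda>_. \<one>)"
proof -
  interpret C: subgroup "simplicial_chains K G (Suc 0)" "fin_chains G"
    by (rule subgroup_simplicial_chains)
  let ?H = "{t \<in> carrier (fin_chains G). bdry G t \<in> simplicial_chains K G (Suc 0) \<and> bdry G (bdry G t) = (\<lambda>_. \<one>)}"
  have "t \<in> ?H"
  proof (rule triangle_chains_generate[OF t])
    show "(\<lambda>_. \<one>) \<in> ?H"
      using C.one_closed A.one_closed by (simp add: bdry_one fin_chains_one)
    show "c \<otimes>\<^bsub>fin_chains G\<^esub> e \<in> ?H" if "c \<in> ?H" "e \<in> ?H" for c e
      using that by (simp add: bdry_mult bdry_closed C.m_closed) (simp add: fin_chains_simps)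
    fix g u v w assume *: "g \<in> carrier G" "{u, v, w} \<in> K" "distinct [u, v, w]"
    have edges: "{u, v} \<in> K" "{v, w} \<in> K" "{w, u} \<in> K"
      by (rule abstract_complexD(3)[OF K *(2)]; blast)+
    have "triangle_chain G g u v w \<in> carrier (fin_chains G)"
      using triangle_chain_simplicial[OF *] simplicial_chains_subset by blast
    moreover have "bdry G (triangle_chain G g u v w) \<in> simplicial_chains K G (Suc 0)"
      unfolding bdry_triangle_chain[OF *(1,3)]
      by (intro C.m_closed edge_chain_simplicial * edges)
    moreover have "bdry G (bdry G (triangle_chain G g u v w)) = (\<lambda>_. \<one>)"
      unfolding bdry_triangle_chain[OF *(1,3)]
      using * by (simp add: bdry_mult edge_chain_closed) (auto simp: fin_chains_simps bdry_edge_chain fun_eq_iff)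
    ultimately show "triangle_chain G g u v w \<in> ?H" by simp
  qed
  then show "bdry G t \<in> simplicial_chains K G (Suc 0)" "bdry G (bdry G t) = (\<lambda>_. \<one>)" by auto
qed

section \<open>Homology classes of words\<close>

lemma subgroup_boundaries: "subgroup (boundaries K G p) (fin_chains G)"
  unfolding boundaries_def
  by (rule group_hom.subgroup_img_is_subgroup[OF group_hom_bdry subgroup_simplicial_chains])

lemma subgroup_cycles: "subgroup (cycles K G p) (fin_chains G)"
proof -
  have "cycles K G p = simplicial_chains K G p \<inter> kernel (fin_chains G) (fin_chains G) (bdry G)"
    unfolding cycles_def kernel_def using simplicial_chains_subset[of K p] by (auto simp: fin_chains_one)
  then show ?thesis
    using A.subgroups_Inter_pair[OF subgroup_simplicial_chains group_hom.subgroup_kernel[OF group_hom_bdry]]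
    by simp
qed

lemma boundaries_subset_cycles:
  "abstract_complex K \<Longrightarrow> boundaries K G (Suc 0) \<subseteq> cycles K G (Suc 0)"
  using bdry_simplicial_chains by (auto simp: boundaries_def cycles_def)

lemma simplicial_chains_mono: "K \<subseteq> L \<Longrightarrow> simplicial_chains K G p \<subseteq> simplicial_chains L G p"
  unfolding simplicial_chains_def by blast

abbreviation boundary_coset :: "'a set set \<Rightarrow> ('a list \<Rightarrow> 'g) \<Rightarrow> ('a list \<Rightarrow> 'g) set" where
  "boundary_coset K c \<equiv> boundaries K G (Suc 0) #>\<^bsub>fin_chains G\<^esub> c"

lemma boundary_coset_mult:
  assumes "c \<in> carrier (fin_chains G)" "e \<in> carrier (fin_chains G)"
  shows "boundary_coset K (c \<otimes>\<^bsub>fin_chains G\<^esub> e) = boundary_coset K c <#>\<^bsub>fin_chains G\<^esub> boundary_coset K e"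
  using normal.rcos_sum[OF A.subgroup_imp_normal[OF subgroup_boundaries] assms] by simp

lemma boundary_coset_eq_iff:
  assumes "c \<in> carrier (fin_chains G)" "e \<in> carrier (fin_chains G)"
  shows "boundary_coset K c = boundary_coset K e \<longleftrightarrow> c \<otimes>\<^bsub>fin_chains G\<^esub> inv\<^bsub>fin_chains G\<^esub> e \<in> boundaries K G (Suc 0)"
proof -
  note sub = subgroup.subset[OF subgroup_boundaries]
  have ce: "c \<otimes>\<^bsub>fin_chains G\<^esub> inv\<^bsub>fin_chains G\<^esub> e \<in> carrier (fin_chains G)"
    using assms by simp
  show ?thesis
    using A.coset_mult_inv1[OF _ assms sub] A.coset_mult_inv2[OF _ assms sub]
      A.coset_join1[OF _ ce subgroup_boundaries] A.coset_join2[OF ce subgroup_boundaries] by metis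
qed

text \<open>The quotient of the two chains is the boundary of the triangle. If vertices coincide, as
  \<open>collapse\<close> permits, the edge chains vanish or cancel instead.\<close>

lemma boundary_coset_triangle:
  assumes g: "g \<in> carrier G" and uvw: "{u, v, w} \<in> K"
  shows "boundary_coset K (edge_chain G g u v \<otimes>\<^bsub>fin_chains G\<^esub> edge_chain G g v w) = boundary_coset K (edge_chain G g u w)"
proof -
  note cl = edge_chain_closed[OF g]
  note one = fin_chains_one[symmetric]
  consider "u = v" | "v = w" | "u = w" | "distinct [u, v, w]" by auto
  then show ?thesis
  proof cases
    case 1
    then show ?thesis by (simp add: edge_chain_same one cl)
  next
    case 2
    then show ?thesis by (simp add: edge_chain_same one cl)
  next
    case 3
    then show ?thesis
      using A.r_inv[OF cl[of u v]] by (simp add: cl edge_chain_same edge_chain_swap[OF g] one)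
  next
    case 4
    have "edge_chain G g u v \<otimes>\<^bsub>fin_chains G\<^esub> edge_chain G g v w \<otimes>\<^bsub>fin_chains G\<^esub> inv\<^bsub>fin_chains G\<^esub> edge_chain G g u w
        = bdry G (triangle_chain G g u v w)"
      by (simp add: cl bdry_triangle_chain[OF g 4] edge_chain_swap[OF g] A.m_assoc)
    then show ?thesis
      using triangle_chain_simplicial[OF g uvw 4]
      by (subst boundary_coset_eq_iff) (auto simp: boundaries_def cl)
  qed
qed

lemma word_chain_append:
  assumes g: "g \<in> carrier G"
  shows "word_chain G g (us @ u # ws) = word_chain G g (us @ [u]) \<otimes>\<^bsub>fin_chains G\<^esub> word_chain G g (u # ws)"
proof (induction us)
  case Nil
  then show ?case using word_chain_closed[OF g, of "u # ws"] by (simp add: fin_chains_one[symmetric])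
next
  case (Cons a us)
  obtain c where c: "us @ u # zs = c # tl (us @ u # zs)" for zs
    by (cases us) auto
  have "word_chain G g ((a # us) @ u # zs) = edge_chain G g a c \<otimes>\<^bsub>fin_chains G\<^esub> word_chain G g (us @ u # zs)" for zs
    using word_chain.simps(3)[of G g a c "tl (us @ u # zs)"] c[of zs] by simp
  then show ?case
    using Cons.IH by (simp add: A.m_assoc edge_chain_closed[OF g] word_chain_closed[OF g])
qed

text \<open>Cosets are multiplicative along a word, so the contexts of a move factor out and only
  the moves themselves have to be compared.\<close>

lemma edge_equiv_boundary_coset_word_chain:
  assumes g: "g \<in> carrier G"
  shows "edge_equiv K xs ys \<Longrightarrow> boundary_coset K (word_chain G g xs) = boundary_coset K (word_chain G g ys)"
proof (induction rule: edge_equiv.induct)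
  case (collapse u v w us ws)
  note cl = edge_chain_closed[OF g] word_chain_closed[OF g]
  have "boundary_coset K (word_chain G g (u # v # w # ws)) = boundary_coset K (word_chain G g (u # w # ws))"
    using boundary_coset_triangle[OF g collapse] by (simp add: cl A.m_assoc[symmetric] boundary_coset_mult)
  then show ?case
    unfolding word_chain_append[OF g, of us u "v # w # ws"] word_chain_append[OF g, of us u "w # ws"]
    by (simp only: cl boundary_coset_mult)
next
  case (stutter u us ws)
  have "word_chain G g (u # u # ws) = word_chain G g (u # ws)"
    using word_chain_closed[OF g, of "u # ws"] by (simp add: edge_chain_same fin_chains_one[symmetric])
  then show ?case
    unfolding word_chain_append[OF g, of us u "u # ws"] word_chain_append[OF g, of us u ws]
    by simp
qed auto

end

locale homology_subdivision = subdivision K L m + chain_coefficients G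
  for K L :: "'a set set" and m :: "'a \<Rightarrow> 'a \<Rightarrow> 'a" and G :: "('g, 'm) monoid_scheme" (structure)
begin

lemma subdivide_edge:
  assumes "g \<in> carrier G" "{u, v} \<in> L" "u \<noteq> v"
  shows "subdivide G m (edge_chain G g u v) = word_chain G g [u, m u v, v]"
proof -
  have "subdivide G m (edge_chain G g u v) =
      edge_chain G g u (m u v) \<otimes>\<^bsub>fin_chains G\<^esub> edge_chain G g (m u v) v"
    using assms m_neq[of u v] m_neq[of v u] m_sym
    by (intro subdivide_edge_chain) (auto simp: insert_commute)
  then show ?thesis
    by (simp add: edge_chain_closed[OF assms(1)] fin_chains_one[symmetric])
qed

text \<open>On a generator the difference bounds the triangle on an edge and its midpoint.
  \<open>J\<close> stands for \<open>K\<close> (through \<open>mid_K\<close>) or \<open>L\<close>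
  (through \<open>mid_L\<close>).\<close>

lemma subdivide_homologous:
  assumes J: "\<And>u v. {u, v} \<in> J \<Longrightarrow> {u, m u v, v} \<in> J" "J \<subseteq> L"
    and c: "c \<in> simplicial_chains J G (Suc 0)"
  shows "subdivide G m c \<in> simplicial_chains K G (Suc 0)" "boundary_coset J (subdivide G m c) = boundary_coset J c"
proof -
  interpret C: subgroup "simplicial_chains K G (Suc 0)" "fin_chains G"
    by (rule subgroup_simplicial_chains)
  let ?H = "{c \<in> carrier (fin_chains G). subdivide G m c \<in> simplicial_chains K G (Suc 0) \<and>
      boundary_coset J (subdivide G m c) = boundary_coset J c}"
  have "c \<in> ?H"
  proof (rule edge_chains_generate[OF c])
    show "(\<lambda>_. \<one>) \<in> ?H"
      using C.one_closed A.one_closed by (simp add: subdivide_one fin_chains_one)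
    show "c \<otimes>\<^bsub>fin_chains G\<^esub> e \<in> ?H" if "c \<in> ?H" "e \<in> ?H" for c e
      using that simplicial_chains_subset[of K "Suc 0"]
      by (simp add: subdivide_mult C.m_closed boundary_coset_mult subset_iff)
    fix g u v assume *: "g \<in> carrier G" "{u, v} \<in> J" "u \<noteq> v"
    then have uv: "{u, v} \<in> L" using J(2) by blast
    have cl: "edge_chain G g u v \<in> carrier (fin_chains G)"
      by (rule edge_chain_closed[OF *(1)])
    have s: "subdivide G m (edge_chain G g u v) = word_chain G g [u, m u v, v]"
      by (rule subdivide_edge[OF *(1) uv *(3)])
    moreover have "word_chain G g [u, m u v, v] \<in> simplicial_chains K G (Suc 0)"
      unfolding word_chain.simps fin_chains_one[symmetric]
      by (intro C.m_closed C.one_closed edge_chain_simplicial * half_K half_K' uv)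
    moreover have "edge_equiv J ([] @ [u, m u v, v] @ []) ([] @ [u, v] @ [])"
      using edge_equiv.collapse[OF J(1)[OF *(2)], of "[]" "[]"] by simp
    from edge_equiv_boundary_coset_word_chain[OF *(1) this]
    have "boundary_coset J (word_chain G g [u, m u v, v]) = boundary_coset J (edge_chain G g u v)"
      using cl by (simp add: fin_chains_one[symmetric])
    ultimately show "edge_chain G g u v \<in> ?H"
      using cl by simp
  qed
  then show "subdivide G m c \<in> simplicial_chains K G (Suc 0)" "boundary_coset J (subdivide G m c) = boundary_coset J c"
    by auto
qed

text \<open>On a generator the subdivided boundary is the quotient of the chains of the two words in
  \<open>triangle\<close>, which have the same class in \<open>K\<close>.\<close>

lemma subdivide_boundary:
  assumes t: "t \<in> simplicial_chains L G (Suc (Suc 0))"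
  shows "subdivide G m (bdry G t) \<in> boundaries K G (Suc 0)"
proof -
  interpret B: subgroup "boundaries K G (Suc 0)" "fin_chains G"
    by (rule subgroup_boundaries)
  let ?H = "{t \<in> carrier (fin_chains G). subdivide G m (bdry G t) \<in> boundaries K G (Suc 0)}"
  have "t \<in> ?H"
  proof (rule triangle_chains_generate[OF t])
    show "(\<lambda>_. \<one>) \<in> ?H"
      using B.one_closed A.one_closed by (simp add: subdivide_one bdry_one fin_chains_one)
    show "c \<otimes>\<^bsub>fin_chains G\<^esub> e \<in> ?H" if "c \<in> ?H" "e \<in> ?H" for c e
      using that by (simp add: bdry_mult bdry_closed subdivide_mult B.m_closed)
    fix g u v w assume *: "g \<in> carrier G" "{u, v, w} \<in> L" "distinct [u, v, w]"
    note ecl = edge_chain_closed[OF *(1)] and wcl = word_chain_closed[OF *(1)]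
    have edges: "{u, v} \<in> L" "{v, w} \<in> L" "{w, u} \<in> L"
      by (rule abstract_complexD(3)[OF L *(2)]; blast)+
    have neq: "u \<noteq> v" "v \<noteq> w" "w \<noteq> u" using *(3) by auto
    have tcl: "triangle_chain G g u v w \<in> carrier (fin_chains G)"
      using triangle_chain_simplicial[OF *] simplicial_chains_subset by blast
    let ?p = "[u, m u v, v, m v w, w]" and ?q = "[u, m u w, w]"
    have "subdivide G m (bdry G (triangle_chain G g u v w)) =
        word_chain G g [u, m u v, v] \<otimes>\<^bsub>fin_chains G\<^esub>
        (word_chain G g [v, m v w, w] \<otimes>\<^bsub>fin_chains G\<^esub> word_chain G g [w, m w u, u])"
      using * by (simp add: bdry_triangle_chain subdivide_mult ecl
        subdivide_edge[OF *(1) edges(1) neq(1)] subdivide_edge[OF *(1) edges(2) neq(2)]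
        subdivide_edge[OF *(1) edges(3) neq(3)] del: word_chain.simps)
    also have "\<dots> = word_chain G g ?p \<otimes>\<^bsub>fin_chains G\<^esub> word_chain G g [w, m w u, u]"
      by (simp add: ecl A.m_assoc fin_chains_one[symmetric])
    \<comment> \<open>Reversing a word inverts its chain; \<open>m_sym\<close> makes the midpoints
      agree.\<close>
    also have "word_chain G g [w, m w u, u] = inv\<^bsub>fin_chains G\<^esub> word_chain G g ?q"
      by (simp add: ecl fin_chains_one[symmetric] A.inv_mult edge_chain_swap[OF *(1)] m_sym[of w u] A.m_comm)
    finally have eq: "subdivide G m (bdry G (triangle_chain G g u v w)) =
        word_chain G g ?p \<otimes>\<^bsub>fin_chains G\<^esub> inv\<^bsub>fin_chains G\<^esub> word_chain G g ?q" .
    have "boundary_coset K (word_chain G g ?p) = boundary_coset K (word_chain G g ?q)"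
      by (rule edge_equiv_boundary_coset_word_chain[OF *(1) triangle[OF *(2)]])
    then have "subdivide G m (bdry G (triangle_chain G g u v w)) \<in> boundaries K G (Suc 0)"
      unfolding eq boundary_coset_eq_iff[OF wcl wcl] .
    then show "triangle_chain G g u v w \<in> ?H"
      using tcl by simp
  qed
  then show ?thesis by simp
qed

text \<open>\<open>subdivide\<close> plays the part of \<open>midword\<close>: it replaces a cycle
  of \<open>L\<close> by a homologous one in \<open>K\<close>, and it turns a boundary in
  \<open>L\<close> into a boundary in \<open>K\<close> without changing classes of
  \<open>K\<close>.\<close>

theorem homology_incl_iso_subdivision:
  "homology_incl L G (Suc 0) \<in> iso (homology K G (Suc 0)) (homology L G (Suc 0))"
proof -
  note CK = simplicial_chains_subset[of K "Suc 0"] and CL = simplicial_chains_subset[of L "Suc 0"]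
  have "(\<lambda>X. \<Union>c\<in>X. boundary_coset L c) \<in>
      iso ((fin_chains G)\<lparr>carrier := cycles K G (Suc 0)\<rparr> Mod boundaries K G (Suc 0))
        ((fin_chains G)\<lparr>carrier := cycles L G (Suc 0)\<rparr> Mod boundaries L G (Suc 0))"
  proof (rule A.mod_incl_iso[OF subgroup_cycles subgroup_cycles _ subgroup_boundaries subgroup_boundaries])
    show "cycles K G (Suc 0) \<subseteq> cycles L G (Suc 0)"
      unfolding cycles_def using simplicial_chains_mono[OF KL] by blast
    show "boundaries K G (Suc 0) \<subseteq> boundaries L G (Suc 0)"
      unfolding boundaries_def using simplicial_chains_mono[OF KL] by blast
    show "boundaries K G (Suc 0) \<subseteq> cycles K G (Suc 0)" "boundaries L G (Suc 0) \<subseteq> cycles L G (Suc 0)"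
      by (rule boundaries_subset_cycles[OF K] boundaries_subset_cycles[OF L])+
  next
    fix z assume z: "z \<in> cycles L G (Suc 0)"
    then have "z \<in> simplicial_chains L G (Suc 0)" by (simp add: cycles_def)
    note s = subdivide_homologous[OF mid_L order_refl this]
    have zA: "z \<in> carrier (fin_chains G)" "subdivide G m z \<in> carrier (fin_chains G)"
      using subgroup.subset[OF subgroup_cycles] z s(1) CK by blast+
    \<comment> \<open>That \<open>subdivide G m z\<close> is a cycle is deduced from the difference
      to \<open>z\<close>: it bounds in \<open>L\<close>, hence is a cycle.\<close>
    have "subdivide G m z \<otimes>\<^bsub>fin_chains G\<^esub> inv\<^bsub>fin_chains G\<^esub> z \<in> cycles L G (Suc 0)"
      using boundary_coset_eq_iff[OF zA(2,1)] s(2) boundaries_subset_cycles[OF L] by blast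
    then have "subdivide G m z \<otimes>\<^bsub>fin_chains G\<^esub> inv\<^bsub>fin_chains G\<^esub> z \<otimes>\<^bsub>fin_chains G\<^esub> z \<in> cycles L G (Suc 0)"
      using z by (rule subgroup.m_closed[OF subgroup_cycles])
    then have "subdivide G m z \<in> cycles L G (Suc 0)"
      using zA by (simp add: A.m_assoc)
    then have "subdivide G m z \<in> cycles K G (Suc 0)"
      using s(1) by (simp add: cycles_def)
    with s(2) show "\<exists>c\<in>cycles K G (Suc 0). boundary_coset L c = boundary_coset L z" by blast
  next
    fix z assume z: "z \<in> cycles K G (Suc 0)" "z \<in> boundaries L G (Suc 0)"
    then have zK: "z \<in> simplicial_chains K G (Suc 0)" by (simp add: cycles_def)
    then have s: "boundary_coset K (subdivide G m z) = boundary_coset K z" "subdivide G m z \<in> simplicial_chains K G (Suc 0)"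
      using subdivide_homologous[OF mid_K KL zK] by blast+
    have "subdivide G m z \<in> boundaries K G (Suc 0)"
      using z(2) subdivide_boundary unfolding boundaries_def[of L] by blast
    then have "boundary_coset K z = boundaries K G (Suc 0)"
      using s CK A.coset_join2[OF _ subgroup_boundaries] by blast
    then show "z \<in> boundaries K G (Suc 0)"
      using zK CK by (intro A.coset_join1[OF _ _ subgroup_boundaries]) auto
  qed
  then show ?thesis
    unfolding homology_def homology_incl_def chain_grp_carrier_update r_coset_chain_grp .
qed

end

section \<open>Geodesic spaces\<close>

text \<open>The isomorphism is \<open>i\<close> followed by the inverse of \<open>j\<close>; its
  identities are checked after applying the injective \<open>j\<close>. Closure under multiplication
  is assumed because \<open>F r\<close> and \<open>F' r\<close> are mere records here.\<close>

lemma persistence_iso_cospan: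
  assumes i: "\<And>r. 0 < r \<Longrightarrow> i r \<in> iso (F r) (H r)" and j: "\<And>r. 0 < r \<Longrightarrow> j r \<in> iso (F' r) (H r)"
    and closed: "\<And>r x y. 0 < r \<Longrightarrow> x \<in> carrier (F r) \<Longrightarrow> y \<in> carrier (F r) \<Longrightarrow> x \<otimes>\<^bsub>F r\<^esub> y \<in> carrier (F r)"
    and closed': "\<And>r x y. 0 < r \<Longrightarrow> x \<in> carrier (F' r) \<Longrightarrow> y \<in> carrier (F' r) \<Longrightarrow> x \<otimes>\<^bsub>F' r\<^esub> y \<in> carrier (F' r)"
    and f': "\<And>r s x. 0 < r \<Longrightarrow> r \<le> s \<Longrightarrow> x \<in> carrier (F' r) \<Longrightarrow> f' r s x \<in> carrier (F' s)"
    and nat: "\<And>r s x. 0 < r \<Longrightarrow> r \<le> s \<Longrightarrow> x \<in> carrier (F r) \<Longrightarrow> i s (f r s x) = h r s (i r x)"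
    and nat': "\<And>r s x. 0 < r \<Longrightarrow> r \<le> s \<Longrightarrow> x \<in> carrier (F' r) \<Longrightarrow> j s (f' r s x) = h r s (j r x)"
  shows "persistence_iso F f F' f'"
proof -
  define \<phi> where "\<phi> r = inv_into (carrier (F' r)) (j r) \<circ> i r" for r
  have bij_i: "bij_betw (i r) (carrier (F r)) (carrier (H r))"
    and bij_j: "bij_betw (j r) (carrier (F' r)) (carrier (H r))" if "0 < r" for r
    using i[OF that] j[OF that] by (auto simp: iso_def)
  have bij: "bij_betw (\<phi> r) (carrier (F r)) (carrier (F' r))" if "0 < r" for r
    unfolding \<phi>_def by (rule bij_betw_trans[OF bij_i[OF that] bij_betw_inv_into[OF bij_j[OF that]]])
  have j\<phi>: "j r (\<phi> r x) = i r x" if "0 < r" "x \<in> carrier (F r)" for r x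
    unfolding \<phi>_def o_def
    by (rule bij_betw_inv_into_right[OF bij_j[OF that(1)] bij_betwE[OF bij_i[OF that(1)], rule_format, OF that(2)]])
  have \<phi>: "\<phi> r x \<in> carrier (F' r)" if "0 < r" "x \<in> carrier (F r)" for r x
    using bij_betwE[OF bij[OF that(1)]] that(2) by blast
  have inj: "x = y" if "0 < r" "j r x = j r y" "x \<in> carrier (F' r)" "y \<in> carrier (F' r)" for r x y
    using bij_j[OF that(1)] that(2-4) by (meson bij_betw_def inj_onD)
  have "\<phi> r \<in> iso (F r) (F' r)" if r: "0 < r" for r
  proof (rule isoI[OF homI bij[OF r]])
    fix x y assume xy: "x \<in> carrier (F r)" "y \<in> carrier (F r)"
    note mult = hom_mult[of "i r" "F r" "H r" x y] hom_mult[of "j r" "F' r" "H r" "\<phi> r x" "\<phi> r y"]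
    have "j r (\<phi> r (x \<otimes>\<^bsub>F r\<^esub> y)) = j r (\<phi> r x \<otimes>\<^bsub>F' r\<^esub> \<phi> r y)"
      using i[OF r] j[OF r] mult xy \<phi>[OF r] j\<phi>[OF r] closed[OF r xy] by (simp add: iso_def)
    then show "\<phi> r (x \<otimes>\<^bsub>F r\<^esub> y) = \<phi> r x \<otimes>\<^bsub>F' r\<^esub> \<phi> r y"
      by (rule inj[OF r]) (intro \<phi> r closed closed' xy)+
  qed (rule \<phi>[OF r])
  moreover have "\<phi> s (f r s x) = f' r s (\<phi> r x)" if rs: "0 < r" "r \<le> s" and x: "x \<in> carrier (F r)" for r s x
  proof -
    have "0 < s" using rs by simp
    have "i s (f r s x) = j s (f' r s (\<phi> r x))"
      using nat[OF rs x] nat'[OF rs \<phi>[OF rs(1) x]] j\<phi>[OF rs(1) x] by simp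
    then show ?thesis
      unfolding \<phi>_def[of s] o_def
      using bij_betw_inv_into_left[OF bij_j[OF \<open>0 < s\<close>] f'[OF rs \<phi>[OF rs(1) x]]] by simp
  qed
  ultimately show ?thesis
    unfolding persistence_iso_def by blast
qed

section \<open>Closure and functoriality of the induced maps\<close>

lemma pi1_incl_closed:
  assumes "abstract_complex K" "abstract_complex L" "K \<subseteq> L" "A \<in> carrier (pi1 K b)"
  shows "pi1_incl L b A \<in> carrier (pi1 L b)"
  using assms(4) loops_mono[OF assms(1-3), THEN subsetD] unfolding carrier_pi1
  by (auto simp: pi1_incl_loop_class[OF assms(1-3)])

lemma pi1_mult_closed:
  assumes "abstract_complex K" "A \<in> carrier (pi1 K b)" "B \<in> carrier (pi1 K b)"
  shows "A \<otimes>\<^bsub>pi1 K b\<^esub> B \<in> carrier (pi1 K b)"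
  using assms(2,3) loops_join[OF assms(1)] unfolding carrier_pi1
  by (auto simp: mult_pi1[OF assms(1)])

context chain_coefficients begin

lemma homology_eq_Mod:
  "homology K G p = (fin_chains G)\<lparr>carrier := cycles K G p\<rparr> Mod boundaries K G p"
  unfolding homology_def chain_grp_carrier_update ..

lemma homology_mult_closed:
  "X \<in> carrier (homology K G p) \<Longrightarrow> Y \<in> carrier (homology K G p) \<Longrightarrow>
    X \<otimes>\<^bsub>homology K G p\<^esub> Y \<in> carrier (homology K G p)"
  unfolding homology_eq_Mod by (rule A.Mod_subgroup_closed[OF subgroup_cycles subgroup_boundaries])

lemma carrier_homology: "carrier (homology K G p) = (#>\<^bsub>fin_chains G\<^esub>) (boundaries K G p) ` cycles K G p"
  unfolding homology_eq_Mod by (rule A.carrier_Mod_subgroup)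

lemma homology_incl_coset:
  assumes "K \<subseteq> L" "c \<in> cycles K G p"
  shows "homology_incl L G p (boundaries K G p #>\<^bsub>fin_chains G\<^esub> c) = boundaries L G p #>\<^bsub>fin_chains G\<^esub> c"
proof -
  have "boundaries K G p \<subseteq> boundaries L G p"
    unfolding boundaries_def using simplicial_chains_mono[OF assms(1)] by blast
  moreover have "c \<in> carrier (fin_chains G)"
    using assms(2) subgroup.subset[OF subgroup_cycles] by blast
  ultimately show ?thesis
    unfolding homology_incl_def r_coset_chain_grp
    by (intro A.UN_rcoset subgroup_boundaries)
qed

lemma cycles_mono: "K \<subseteq> L \<Longrightarrow> cycles K G p \<subseteq> cycles L G p"
  unfolding cycles_def using simplicial_chains_mono by blast

lemma homology_incl_closed:
  assumes "K \<subseteq> L" "X \<in> carrier (homology K G p)"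
  shows "homology_incl L G p X \<in> carrier (homology L G p)"
  using assms(2) cycles_mono[OF assms(1), THEN subsetD] unfolding carrier_homology
  by (auto simp: homology_incl_coset[OF assms(1)])

lemma homology_incl_comp:
  assumes "K \<subseteq> L" "L \<subseteq> J" "X \<in> carrier (homology K G p)"
  shows "homology_incl J G p (homology_incl L G p X) = homology_incl J G p X"
proof -
  obtain c where c: "c \<in> cycles K G p" "X = boundaries K G p #>\<^bsub>fin_chains G\<^esub> c"
    using assms(3) unfolding carrier_homology by blast
  then have "c \<in> cycles L G p" using cycles_mono[OF assms(1)] by blast
  with c show ?thesis
    using assms(1,2) by (simp add: homology_incl_coset)
qed

end

section \<open>Simplices described by distances\<close>

lemma finite_diam_less_iff:
  assumes "finite \<sigma>" "\<sigma> \<noteq> {}"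
  shows "diam d \<sigma> < r \<longleftrightarrow> (\<forall>x\<in>\<sigma>. \<forall>y\<in>\<sigma>. d x y < r)"
  using assms unfolding diam_def by (subst cSup_eq_Max) auto

lemma in_Rips_iff:
  "\<sigma> \<in> Rips M d r \<longleftrightarrow> finite \<sigma> \<and> \<sigma> \<noteq> {} \<and> \<sigma> \<subseteq> M \<and> (\<forall>x\<in>\<sigma>. \<forall>y\<in>\<sigma>. d x y < r)"
  unfolding Rips_def using finite_diam_less_iff by blast

lemma (in Metric_space) in_Cech_iff:
  "\<sigma> \<in> Cech M d r \<longleftrightarrow> finite \<sigma> \<and> \<sigma> \<noteq> {} \<and> \<sigma> \<subseteq> M \<and> (\<exists>w\<in>M. \<forall>z\<in>\<sigma>. d z w < r)"
  unfolding Cech_def by fastforce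

lemma (in Metric_space) abstract_complex_Cech: "abstract_complex (Cech M d r)"
  unfolding abstract_complex_def
proof (intro ballI conjI allI impI)
  fix \<sigma> \<tau> assume "\<sigma> \<in> Cech M d r" "\<tau> \<subseteq> \<sigma> \<and> \<tau> \<noteq> {}"
  then show "\<tau> \<in> Cech M d r"
    unfolding in_Cech_iff by (blast intro: finite_subset)
qed (simp_all add: in_Cech_iff)

lemma abstract_complex_Rips: "abstract_complex (Rips M d r)"
  unfolding abstract_complex_def
proof (intro ballI conjI allI impI)
  fix \<sigma> \<tau> assume "\<sigma> \<in> Rips M d r" "\<tau> \<subseteq> \<sigma> \<and> \<tau> \<noteq> {}"
  then show "\<tau> \<in> Rips M d r"
    unfolding in_Rips_iff by (blast intro: finite_subset)
qed (simp_all add: in_Rips_iff)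

lemma abstract_complex_Un:
  "abstract_complex K \<Longrightarrow> abstract_complex L \<Longrightarrow> abstract_complex (K \<union> L)"
  unfolding abstract_complex_def by blast

lemma (in Metric_space) Cech_mono: "r \<le> s \<Longrightarrow> Cech M d r \<subseteq> Cech M d s"
  unfolding subset_iff in_Cech_iff by (meson order_less_le_trans)

lemma Rips_mono: "r \<le> s \<Longrightarrow> Rips M d r \<subseteq> Rips M d s"
  unfolding subset_iff in_Rips_iff by (meson order_less_le_trans)

text \<open>The intermediate value theorem finds a point of the path at the prescribed distance from
  \<open>x\<close>; minimality of the length then fixes its distance to \<open>y\<close>.\<close>

lemma geodesic_point:
  assumes simplex_union: "geodesic_space M d" and xy: "x \<in> M" "y \<in> M" and s: "0 \<le> s" "s \<le> 1"
  obtains z where "z \<in> M" "d x z = s * d x y" "d z y = (1 - s) * d x y"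
proof -
  interpret Metric_space M d using simplex_union by (simp add: geodesic_space_def)
  obtain g where g: "pathin mtopology g" "g 0 = x" "g 1 = y" "path_length d g = ereal (d x y)"
    using simplex_union xy unfolding geodesic_space_def by blast
  have gM: "g t \<in> M" if "t \<in> {0..1}" for t
    using g(1) that unfolding pathin_def continuous_map_def by auto
  have "continuous_map (top_of_set {0..1}) euclidean (\<lambda>t. mdist Self x (g t))"
    using g(1) xy unfolding pathin_def by (intro continuous_map_mdist) (auto simp: Self_def)
  then have "continuous_on {0..1} (\<lambda>t. d x (g t))"
    by simp
  moreover have "d x (g 0) \<le> s * d x y" "s * d x y \<le> d x (g 1)"
    using g s xy by (auto intro: mult_left_le_one_le)
  ultimately obtain t where t: "0 \<le> t" "t \<le> 1" "d x (g t) = s * d x y"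
    using IVT'[of "\<lambda>t. d x (g t)" 0 "s * d x y" 1] by auto
  \<comment> \<open>The partition 0, t, 1, whose sum is a lower bound for the length.\<close>
  define p where "p i = (if i = 0 then 0 else if i = 1 then t else 1)" for i :: nat
  have "mono_on {..2} p" using t by (auto simp: mono_on_def p_def)
  then have "(2, p) \<in> {(n, t). mono_on {..n} t \<and> t 0 = 0 \<and> t n = 1}"
    by (simp add: p_def)
  then have "ereal (\<Sum>i<2. d (g (p i)) (g (p (Suc i)))) \<le> path_length d g"
    unfolding path_length_def by (rule SUP_upper2) simp
  then have "d x (g t) + d (g t) y \<le> d x y"
    using g by (simp add: numeral_2_eq_2 p_def)
  moreover have "d x y \<le> d x (g t) + d (g t) y"
    using xy gM t by (intro triangle) auto
  ultimately show thesis
    using that[of "g t"] gM t by (auto simp: algebra_simps)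
qed


locale geodesic_metric = Metric_space M d for M :: "'a set" and d :: "'a \<Rightarrow> 'a \<Rightarrow> real" +
  assumes between: "x \<in> M \<Longrightarrow> y \<in> M \<Longrightarrow> 0 \<le> s \<Longrightarrow> s \<le> 1 \<Longrightarrow>
    \<exists>z\<in>M. d x z = s * d x y \<and> d z y = (1 - s) * d x y"
begin

text \<open>The condition is symmetric in \<open>x\<close> and \<open>y\<close>, so the choice does
  not depend on the orientation of an edge.\<close>

definition geodesic_midpoint :: "'a \<Rightarrow> 'a \<Rightarrow> 'a" where
  "geodesic_midpoint x y = (SOME z. z \<in> M \<and> d x z = d x y / 2 \<and> d y z = d x y / 2)"

lemma geodesic_midpoint_commute: "geodesic_midpoint x y = geodesic_midpoint y x"
  unfolding geodesic_midpoint_def by (intro arg_cong[of _ _ Eps]) (auto simp: commute[of x y])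

lemma geodesic_midpoint:
  assumes "x \<in> M" "y \<in> M"
  shows "geodesic_midpoint x y \<in> M" "d x (geodesic_midpoint x y) = d x y / 2" "d y (geodesic_midpoint x y) = d x y / 2"
proof -
  have "\<exists>z. z \<in> M \<and> d x z = d x y / 2 \<and> d y z = d x y / 2"
    using between[OF assms, of "1/2"] by (auto simp: commute[of _ y])
  from someI_ex[OF this] show "geodesic_midpoint x y \<in> M" "d x (geodesic_midpoint x y) = d x y / 2" "d y (geodesic_midpoint x y) = d x y / 2"
    unfolding geodesic_midpoint_def by auto
qed

lemma Cech_pair:
  assumes "{u, v} \<in> Cech M d r"
  shows "u \<in> M" "v \<in> M" "d u v < 2 * r"
proof -
  obtain w where w: "w \<in> M" "d u w < r" "d v w < r"
    using assms unfolding in_Cech_iff by auto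
  show "u \<in> M" "v \<in> M" using assms unfolding in_Cech_iff by auto
  then show "d u v < 2 * r"
    using triangle[of u w v] w commute[of v w] by linarith
qed

lemma Rips_pair: "{u, v} \<in> Rips M d r \<longleftrightarrow> u \<in> M \<and> v \<in> M \<and> d u v < r \<and> 0 < r"
  unfolding in_Rips_iff by (auto simp: commute[of v u])

lemma Rips_triple:
  "{u, v, w} \<in> Rips M d r \<longleftrightarrow>
    u \<in> M \<and> v \<in> M \<and> w \<in> M \<and> d u v < r \<and> d v w < r \<and> d u w < r \<and> 0 < r"
  unfolding in_Rips_iff by (auto simp: commute[of v u] commute[of w u] commute[of w v])

lemma Cech_tripleI:
  assumes "u \<in> M" "v \<in> M" "w \<in> M" "z \<in> M" "d u z < r" "d v z < r" "d w z < r"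
  shows "{u, v, w} \<in> Cech M d r"
  using assms unfolding in_Cech_iff by auto

text \<open>The midpoint itself lies in all three balls.\<close>

lemma Cech_geodesic_midpoint:
  assumes "u \<in> M" "v \<in> M" "d u v < 2 * r"
  shows "{u, geodesic_midpoint u v, v} \<in> Cech M d r"
proof -
  have "0 < r" using nonneg[of u v] assms(3) by linarith
  then show ?thesis
    using assms geodesic_midpoint[of u v] by (intro Cech_tripleI[of _ _ _ "geodesic_midpoint u v"]) auto
qed

section \<open>Filling short loops in the two complexes\<close>

lemma edge_equiv_triI:
  assumes "xs = us @ u # v # w # ws" "ys = us @ u # w # ws" "{u, v, w} \<in> K"
  shows "edge_equiv K xs ys" "edge_equiv K ys xs"
  using assms edge_equiv.collapse[of u v w K us ws] edge_equiv.edge_sym by auto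

lemma edge_equiv_contextI:
  assumes "edge_equiv K xs ys" "as = us @ xs @ ws" "bs = us @ ys @ ws"
  shows "edge_equiv K as bs"
  using assms edge_equiv_context by blast

text \<open>The midpoint \<open>q\<close> of \<open>{v, w}\<close> is antipodal to \<open>u\<close> on a circle of length \<open>12r\<close> with \<open>u, v, w\<close> at \<open>0, 4r, 8r\<close>;
  the point at \<open>3/4\<close> of an edge starting in \<open>u\<close> is then the centre of a half circle.\<close>

lemma edge_equiv_Rips_triangle_in_Cech:
  assumes uvw: "{u, v, w} \<in> Rips M d (4 * r)"
  shows "edge_equiv (Cech M d (3 * r)) [u, v, w] [u, w]"
proof -
  have M: "u \<in> M" "v \<in> M" "w \<in> M" and d: "d u v < 4 * r" "d v w < 4 * r" "d u w < 4 * r" "0 < r"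
    using uvw unfolding Rips_triple by auto
  let ?K = "Cech M d (3 * r)" and ?q = "geodesic_midpoint v w"
  note q = geodesic_midpoint[OF M(2,3)]
  \<comment> \<open>Used for \<open>x = v\<close> and \<open>x = w\<close>. The centre
    \<open>p\<close> is within 3r of \<open>u\<close>, within r of \<open>x\<close>, and so within
    2r + r of \<open>?q\<close>.\<close>
  have tri: "{u, x, ?q} \<in> ?K" if x: "x \<in> M" "d u x < 4 * r" "d x ?q < 2 * r" for x
  proof -
    obtain p where p: "p \<in> M" "d u p = 3/4 * d u x" "d p x = (1 - 3/4) * d u x"
      using between[OF M(1) x(1), of "3/4"] by auto
    have "d ?q p < 3 * r"
      using triangle[of ?q x p] p q x commute[of x ?q] commute[of x p] by auto
    then show ?thesis
      using p x q M d commute[of x p] by (intro Cech_tripleI[of _ _ _ p]) auto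
  qed
  have "edge_equiv ?K [u, v, w] [u, v, ?q, w]"
    by (rule edge_equiv_triI(2)[of _ "[u]" v ?q w "[]"]) (use Cech_geodesic_midpoint[OF M(2,3)] d in auto)
  also have "edge_equiv ?K \<dots> [u, ?q, w]"
    by (rule edge_equiv_triI(1)[of _ "[]" u v ?q "[w]"]) (use tri[of v] M d q in auto)
  also have "edge_equiv ?K \<dots> [u, w]"
    by (rule edge_equiv_triI(1)[of _ "[]" u ?q w "[]"]) (use tri[of w] M d q in \<open>auto simp: insert_commute\<close>)
  finally show ?thesis .
qed

text \<open>Put \<open>z, x, m, y\<close> at \<open>0, 3r, 6r, 9r\<close> on a circle of length \<open>12r\<close>; then \<open>z, p, q\<close> are the equidistant
  points \<open>0, 4r, 8r\<close>.\<close>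

lemma edge_equiv_Rips_quadrilateral:
  assumes M: "x \<in> M" "y \<in> M" "m \<in> M" "z \<in> M"
    and d: "d x z < 3 * r" "d z y < 3 * r" "d x m < 3 * r" "d m y < 3 * r"
  shows "edge_equiv (Rips M d (4 * r)) [x, m, y] [x, z, y]"
proof -
  let ?K = "Rips M d (4 * r)"
  have r: "0 < r" using d(1) nonneg[of x z] by linarith
  obtain p where p: "p \<in> M" "d x p = 1/3 * d x m" "d p m = (1 - 1/3) * d x m"
    using between[OF M(1,3), of "1/3"] by auto
  obtain q where q: "q \<in> M" "d m q = 2/3 * d m y" "d q y = (1 - 2/3) * d m y"
    using between[OF M(3,2), of "2/3"] by auto
  note [simp] = Rips_triple
  have pd: "d x p < r" "d p m < 2 * r" "d m q < 2 * r" "d q y < r"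
    using p q d by auto
  \<comment> \<open>The three detours have lengths below r + 3r, 3r + r and 2r + 2r.\<close>
  have pz: "d p z < 4 * r" and zq: "d z q < 4 * r" and pq: "d p q < 4 * r"
    using triangle[of p x z] triangle[of z y q] triangle[of p m q] M p(1) q(1) pd d
      commute[of x p] commute[of q y] by auto
  have "edge_equiv ?K [x, m, y] [x, p, m, y]"
    by (rule edge_equiv_triI(2)[of _ "[]" x p m "[y]"]) (use M p(1) pd d r in auto)
  also have "edge_equiv ?K \<dots> [x, p, m, q, y]"
    by (rule edge_equiv_triI(2)[of _ "[x, p]" m q y "[]"]) (use M q(1) pd d r in auto)
  also have "edge_equiv ?K \<dots> [x, p, q, y]"
    by (rule edge_equiv_triI(1)[of _ "[x]" p m q "[y]"]) (use M p(1) q(1) pd pq r in auto)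
  \<comment> \<open>The decisive move, across the triangle on the equidistant points; the others are
    thin triangles along the sides.\<close>
  also have "edge_equiv ?K \<dots> [x, p, z, q, y]"
    by (rule edge_equiv_triI(2)[of _ "[x]" p z q "[y]"]) (use M p(1) q(1) pz zq pq r in auto)
  also have "edge_equiv ?K \<dots> [x, z, q, y]"
    by (rule edge_equiv_triI(1)[of _ "[]" x p z "[q, y]"]) (use M p(1) pd pz d r in auto)
  also have "edge_equiv ?K \<dots> [x, z, y]"
    by (rule edge_equiv_triI(1)[of _ "[x]" z q y "[]"]) (use M q(1) pd zq d r in auto)
  finally show ?thesis .
qed

text \<open>When the sides can be subdivided within \<open>K\<close>, the axiom
  \<open>triangle\<close> reduces to the collapse of the unsubdivided word.\<close>

lemma edge_equiv_mid_triangle: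
  assumes "{u, geodesic_midpoint u v, v} \<in> K" "{v, geodesic_midpoint v w, w} \<in> K" "{u, geodesic_midpoint u w, w} \<in> K" "edge_equiv K [u, v, w] [u, w]"
  shows "edge_equiv K [u, geodesic_midpoint u v, v, geodesic_midpoint v w, w] [u, geodesic_midpoint u w, w]"
proof -
  have "edge_equiv K [u, geodesic_midpoint u v, v, geodesic_midpoint v w, w] [u, v, geodesic_midpoint v w, w]"
    by (rule edge_equiv_triI(1)[of _ "[]" u "geodesic_midpoint u v" v]) (use assms(1) in auto)
  also have "edge_equiv K \<dots> [u, v, w]"
    by (rule edge_equiv_triI(1)[of _ "[u]" v "geodesic_midpoint v w" w]) (use assms(2) in auto)
  also note assms(4)
  also have "edge_equiv K [u, w] [u, geodesic_midpoint u w, w]"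
    by (rule edge_equiv_triI(2)[of _ "[]" u "geodesic_midpoint u w" w]) (use assms(3) in auto)
  finally show ?thesis .
qed

text \<open>The bound is 2 * 3r for Cech edges, and Rips edges are even shorter than 4r.\<close>

lemma CechRips_pair:
  assumes "{u, v} \<in> Cech M d (3 * r) \<union> Rips M d (4 * r)" "0 < r"
  shows "u \<in> M" "v \<in> M" "d u v < 6 * r"
  using assms Cech_pair[of u v "3 * r"] Rips_pair[of u v "4 * r"] by auto

text \<open>All edges of the union are edges of the Cech complex, so only triangles coming from the
  Rips complex need the filling by half circles.\<close>

lemma subdivision_Cech:
  assumes r: "0 < r"
  shows "subdivision (Cech M d (3 * r)) (Cech M d (3 * r) \<union> Rips M d (4 * r)) geodesic_midpoint"
proof
  let ?K = "Cech M d (3 * r)" and ?L = "Cech M d (3 * r) \<union> Rips M d (4 * r)"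
  show "abstract_complex ?K" by (rule abstract_complex_Cech)
  show "abstract_complex ?L"
    by (intro abstract_complex_Un abstract_complex_Cech abstract_complex_Rips)
  show "?K \<subseteq> ?L" by blast
  show "geodesic_midpoint u v = geodesic_midpoint v u" for u v by (rule geodesic_midpoint_commute)
  have mid_K: "{u, geodesic_midpoint u v, v} \<in> ?K" if "{u, v} \<in> ?L" for u v
    using CechRips_pair[OF that r] by (intro Cech_geodesic_midpoint) auto
  then show "{u, geodesic_midpoint u v, v} \<in> ?L" if "{u, v} \<in> ?L" for u v
    using that by blast
  show "{u, geodesic_midpoint u v, v} \<in> ?K" if "{u, v} \<in> ?K" for u v
    using that mid_K by blast
  show "{u, geodesic_midpoint u v} \<in> ?K" if "{u, v} \<in> ?L" for u v
    by (rule abstract_complexD(3)[OF abstract_complex_Cech mid_K[OF that]]) auto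
  show "geodesic_midpoint u v \<noteq> u" if "{u, v} \<in> ?L" "u \<noteq> v" for u v
  proof -
    note uv = CechRips_pair[OF that(1) r]
    have "0 < d u (geodesic_midpoint u v)" using geodesic_midpoint[OF uv(1,2)] mdist_pos_less[OF that(2) uv(1,2)] by simp
    then show ?thesis using uv(1) by auto
  qed
  fix u v w assume uvw: "{u, v, w} \<in> ?L"
  have e: "{u, v} \<in> ?L" "{v, w} \<in> ?L" "{u, w} \<in> ?L"
    by (rule abstract_complexD(3)[OF \<open>abstract_complex ?L\<close> uvw]; blast)+
  have "edge_equiv ?K [u, v, w] [u, w]"
    using uvw edge_equiv_Rips_triangle_in_Cech[of u v w r] edge_equiv_triI(1)[of "[u, v, w]" "[]" u v w "[]"] by auto
  then show "edge_equiv ?K [u, geodesic_midpoint u v, v, geodesic_midpoint v w, w] [u, geodesic_midpoint u w, w]"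
    by (intro edge_equiv_mid_triangle mid_K e)
qed

text \<open>A Cech triangle may have sides too long for the Rips complex, but it has a point
  \<open>z\<close> within 3r of its vertices. Rerouting each subdivided side through
  \<open>z\<close> leaves a backtrack at \<open>v\<close>.\<close>

lemma subdivision_Rips:
  assumes r: "0 < r"
  shows "subdivision (Rips M d (4 * r)) (Cech M d (3 * r) \<union> Rips M d (4 * r)) geodesic_midpoint"
proof
  interpret C: subdivision "Cech M d (3 * r)" "Cech M d (3 * r) \<union> Rips M d (4 * r)" geodesic_midpoint
    by (rule subdivision_Cech[OF r])
  let ?K = "Rips M d (4 * r)" and ?L = "Cech M d (3 * r) \<union> Rips M d (4 * r)"
  show "abstract_complex ?K" by (rule abstract_complex_Rips)
  show "abstract_complex ?L" by (rule C.L)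
  show "?K \<subseteq> ?L" by blast
  show "geodesic_midpoint u v = geodesic_midpoint v u" for u v by (rule geodesic_midpoint_commute)
  show "geodesic_midpoint u v \<noteq> u" if "{u, v} \<in> ?L" "u \<noteq> v" for u v by (rule C.m_neq[OF that])
  show "{u, geodesic_midpoint u v, v} \<in> ?L" if "{u, v} \<in> ?L" for u v by (rule C.mid_L[OF that])
  show "{u, geodesic_midpoint u v} \<in> ?K" if "{u, v} \<in> ?L" for u v
    using CechRips_pair[OF that r] geodesic_midpoint[of u v] r by (simp add: Rips_pair)
  show mid_K: "{u, geodesic_midpoint u v, v} \<in> ?K" if "{u, v} \<in> ?K" for u v
    using that geodesic_midpoint[of u v] nonneg[of u v] commute[of v "geodesic_midpoint u v"] by (simp add: Rips_pair Rips_triple)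
  fix u v w assume uvw: "{u, v, w} \<in> ?L"
  show "edge_equiv ?K [u, geodesic_midpoint u v, v, geodesic_midpoint v w, w] [u, geodesic_midpoint u w, w]"
  proof (cases "{u, v, w} \<in> ?K")
    case True
    have e: "{u, v} \<in> ?K" "{v, w} \<in> ?K" "{u, w} \<in> ?K"
      by (rule abstract_complexD(3)[OF \<open>abstract_complex ?K\<close> True]; blast)+
    have "edge_equiv ?K [u, v, w] [u, w]"
      by (rule edge_equiv_triI(1)[of _ "[]" u v w "[]"]) (use True in auto)
    then show ?thesis
      by (intro edge_equiv_mid_triangle mid_K e)
  next
    case False
    then obtain z where z: "z \<in> M" "d u z < 3 * r" "d v z < 3 * r" "d w z < 3 * r"
      and M: "u \<in> M" "v \<in> M" "w \<in> M"
      using uvw False by (auto simp: in_Cech_iff)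
    \<comment> \<open>The detour through \<open>z\<close> bounds \<open>d x y\<close> by 6r, so the
      midpoint is within 3r of both ends, as the quadrilateral requires.\<close>
    have half: "edge_equiv ?K [x, geodesic_midpoint x y, y] [x, z, y]"
      if "x \<in> M" "y \<in> M" "d x z < 3 * r" "d y z < 3 * r" for x y
      using that z(1) geodesic_midpoint[OF that(1,2)] triangle[of x z y] commute[of y z] commute[of y "geodesic_midpoint x y"]
      by (intro edge_equiv_Rips_quadrilateral) auto
    have "edge_equiv ?K [u, geodesic_midpoint u v, v, geodesic_midpoint v w, w] [u, z, v, geodesic_midpoint v w, w]"
      by (rule edge_equiv_contextI[OF half[of u v], of _ "[]" "[geodesic_midpoint v w, w]"]) (use z M in auto)
    also have "edge_equiv ?K \<dots> [u, z, v, z, w]"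
      by (rule edge_equiv_contextI[OF half[of v w], of _ "[u, z]" "[]"]) (use z M in auto)
    \<comment> \<open>The backtrack \<open>z, v, z\<close> is a degenerate triangle.\<close>
    also have "edge_equiv ?K \<dots> [u, z, z, w]"
      by (rule edge_equiv_triI(1)[of _ "[u]" z v z "[w]"]) (use z M r commute[of v z] in \<open>auto simp: Rips_triple\<close>)
    also have "edge_equiv ?K \<dots> [u, z, w]"
      using edge_equiv.stutter[of z ?K "[u]" "[w]"] z r Rips_pair[of z z] by simp
    also have "edge_equiv ?K \<dots> [u, geodesic_midpoint u w, w]"
      by (rule edge_equiv.edge_sym[OF half]) (use z M in auto)
    finally show ?thesis .
  qed
qed

end

theorem theorem10p6:
  fixes M :: "'a set" and d :: "'a \<Rightarrow> 'a \<Rightarrow> real" and b :: 'a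
    and G :: "('g, 'm) monoid_scheme"
  assumes "geodesic_space M d" and "b \<in> M" and "comm_group G"
  shows "persistence_iso
           (\<lambda>r. pi1 (Cech M d (3 * r)) b) (\<lambda>r s. pi1_incl (Cech M d (3 * s)) b)
           (\<lambda>r. pi1 (Rips M d (4 * r)) b) (\<lambda>r s. pi1_incl (Rips M d (4 * s)) b) \<and>
         persistence_iso
           (\<lambda>r. homology (Cech M d (3 * r)) G 1) (\<lambda>r s. homology_incl (Cech M d (3 * s)) G 1)
           (\<lambda>r. homology (Rips M d (4 * r)) G 1) (\<lambda>r s. homology_incl (Rips M d (4 * s)) G 1)"
proof -
  interpret Metric_space M d using assms(1) by (simp add: geodesic_space_def)
  interpret geodesic_metric M d
    by unfold_locales (metis geodesic_point[OF assms(1)])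
  interpret chain_coefficients G
    by (rule chain_coefficients.intro[OF assms(3)])
  let ?C = "\<lambda>r. Cech M d (3 * r)" and ?R = "\<lambda>r. Rips M d (4 * r)"
  let ?L = "\<lambda>r. ?C r \<union> ?R r"
  note sC = abstract_complex_Cech and sR = abstract_complex_Rips
  have sL: "abstract_complex (?L r)" for r
    by (intro abstract_complex_Un sC sR)
  have mono: "?C r \<subseteq> ?C s" "?R r \<subseteq> ?R s" if "r \<le> s" for r s
    using that by (intro Cech_mono Rips_mono; simp)+
  have hC: "homology_subdivision (?C r) (?L r) geodesic_midpoint G" and hR: "homology_subdivision (?R r) (?L r) geodesic_midpoint G"
    if "0 < r" for r
    by (intro homology_subdivision.intro subdivision_Cech subdivision_Rips that chain_coefficients_axioms)+
  show ?thesis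
  proof
    show "persistence_iso
           (\<lambda>r. pi1 (?C r) b) (\<lambda>r s. pi1_incl (?C s) b) (\<lambda>r. pi1 (?R r) b) (\<lambda>r s. pi1_incl (?R s) b)"
    proof (rule persistence_iso_cospan)
      fix r :: real assume r: "0 < r"
      show "pi1_incl (?L r) b \<in> iso (pi1 (?C r) b) (pi1 (?L r) b)"
        by (rule subdivision.pi1_incl_iso_subdivision[OF subdivision_Cech[OF r]])
      show "pi1_incl (?L r) b \<in> iso (pi1 (?R r) b) (pi1 (?L r) b)"
        by (rule subdivision.pi1_incl_iso_subdivision[OF subdivision_Rips[OF r]])
      fix s x assume rs: "r \<le> s"
      note mono = mono[OF rs]
      show "pi1_incl (?R s) b x \<in> carrier (pi1 (?R s) b)" if "x \<in> carrier (pi1 (?R r) b)"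
        by (rule pi1_incl_closed[OF sR sR mono(2) that])
      \<comment> \<open>Both sides are the class of the same loop in \<open>?L s\<close>, reached
        through \<open>?C s\<close> and through \<open>?L r\<close>.\<close>
      show "pi1_incl (?L s) b (pi1_incl (?C s) b x) = pi1_incl (?L s) b (pi1_incl (?L r) b x)"
        if "x \<in> carrier (pi1 (?C r) b)"
        by (rule HOL.trans[OF pi1_incl_comp[OF sC sC sL _ _ that] pi1_incl_comp[OF sC sL sL _ _ that, symmetric]])
          (use mono in auto)
      show "pi1_incl (?L s) b (pi1_incl (?R s) b x) = pi1_incl (?L s) b (pi1_incl (?L r) b x)"
        if "x \<in> carrier (pi1 (?R r) b)"
        by (rule HOL.trans[OF pi1_incl_comp[OF sR sR sL _ _ that] pi1_incl_comp[OF sR sL sL _ _ that, symmetric]])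
          (use mono in auto)
    qed (rule pi1_mult_closed[OF sC] pi1_mult_closed[OF sR]; assumption)+
    show "persistence_iso
           (\<lambda>r. homology (?C r) G 1) (\<lambda>r s. homology_incl (?C s) G 1)
           (\<lambda>r. homology (?R r) G 1) (\<lambda>r s. homology_incl (?R s) G 1)"
      unfolding One_nat_def
    proof (rule persistence_iso_cospan)
      fix r :: real assume r: "0 < r"
      show "homology_incl (?L r) G (Suc 0) \<in> iso (homology (?C r) G (Suc 0)) (homology (?L r) G (Suc 0))"
        by (rule homology_subdivision.homology_incl_iso_subdivision[OF hC[OF r]])
      show "homology_incl (?L r) G (Suc 0) \<in> iso (homology (?R r) G (Suc 0)) (homology (?L r) G (Suc 0))"
        by (rule homology_subdivision.homology_incl_iso_subdivision[OF hR[OF r]])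
      fix s x assume rs: "r \<le> s"
      note mono = mono[OF rs]
      show "homology_incl (?R s) G (Suc 0) x \<in> carrier (homology (?R s) G (Suc 0))"
        if "x \<in> carrier (homology (?R r) G (Suc 0))"
        by (rule homology_incl_closed[OF mono(2) that])
      show "homology_incl (?L s) G (Suc 0) (homology_incl (?C s) G (Suc 0) x) =
          homology_incl (?L s) G (Suc 0) (homology_incl (?L r) G (Suc 0) x)"
        if "x \<in> carrier (homology (?C r) G (Suc 0))"
        by (rule HOL.trans[OF homology_incl_comp[OF _ _ that] homology_incl_comp[OF _ _ that, symmetric]])
          (use mono in auto)
      show "homology_incl (?L s) G (Suc 0) (homology_incl (?R s) G (Suc 0) x) =
          homology_incl (?L s) G (Suc 0) (homology_incl (?L r) G (Suc 0) x)"
        if "x \<in> carrier (homology (?R r) G (Suc 0))"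
        by (rule HOL.trans[OF homology_incl_comp[OF _ _ that] homology_incl_comp[OF _ _ that, symmetric]])
          (use mono in auto)
    qed (rule homology_mult_closed; assumption)+
  qed
qed

end
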